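(* Consider the AdamW-style Shampoo algorithm (defined in the context) without weight decay, $\lambda=0$, run for $K\ge1$ iterations on a differentiable function $f:\mathbb{R}^{m\times n}\to\mathbb{R}$ with lower bound $f^*$ and $f(\mathbf{X}_1)>f^*$, with exponents $p,q\in(0,+\infty]$ satisfying $\frac1p+\frac1q=2-\omega$ for an arbitrary $\omega\in(0,2]$. Suppose that Assumptions 1-3 (stated in the context) hold, and that for some deterministic $\hat\varepsilon\ge\varepsilon$ the conditions $\mathbf{L}_{k,\varepsilon}\succeq\hat\varepsilon\mathbf{I}_m$ and $\mathbf{R}_{k,\varepsilon}\succeq\hat\varepsilon\mathbf{I}_n$ hold for $k=1,\dots,K$. Let $\gamma\in(0,1)$ and $0<\tau\le1$ be arbitrary, let $$\hat\sigma^2=\max\Big\{\sigma^2,\frac{L(f(\mathbf{X}_1)-f^* )}{K\gamma^2}\Big\},\quad 1-\theta=\sqrt{\frac{L(f(\mathbf{X}_1)-f^* )}{K\hat\sigma^2}},\quad \eta=\hat\varepsilon^{1-\omega/2}\sqrt{\frac{f(\mathbf{X}_1)-f^*}{4LK\hat\sigma^2}},\quad \varepsilon=\frac{\tau\hat\sigma^2}{m+n},$$ and let $\beta\in(0,1)$ be a constant independent of $K$. Put $\hat C=\left(\frac{2(1-\beta)^{\omega/2}}{1-\beta^{\omega/2}}\right)^{2/\omega-1}$ (a constant independent of $K$). Then $$\frac1K\sum_{k=1}^K\mathbb{E}\big[\||\nabla f(\mathbf{X}_k)|^{\omega}\|_*\big]\le\frac{20\,\hat\sigma^{\frac{3\omega}{2}-\frac{\omega^2}{2}}(m+n)^{(1-\frac\omega2)^2}}{\omega\,\hat\varepsilon^{\frac\omega2-\frac{\omega^2}{4}}}\left(\frac{L(f(\mathbf{X}_1)-f^*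 )}{K}\right)^{\frac\omega4}+\frac{10\hat C}{\hat\varepsilon^{1-\frac\omega2}}\left(\frac{\hat\sigma^2L(f(\mathbf{X}_1)-f^* )}{K}\right)^{\frac12}.$$ In the case $\hat\varepsilon=\varepsilon$ (for which the conditions on $\mathbf{L}_{k,\varepsilon},\mathbf{R}_{k,\varepsilon}$ always hold), $$\frac1K\sum_{k=1}^K\mathbb{E}\big[\||\nabla f(\mathbf{X}_k)|^{\omega}\|_*\big]\le\frac{20(m+n)^{1-\frac\omega2}}{\omega\,\tau^{\frac\omega2-\frac{\omega^2}{4}}}\max\left\{\sigma^{\frac\omega2}\Big(\frac{L(f(\mathbf{X}_1)-f^* )}{K}\Big)^{\frac\omega4},\Big(\frac{L(f(\mathbf{X}_1)-f^* )}{K\gamma}\Big)^{\frac\omega2}\right\}+\frac{10\hat C(m+n)^{1-\frac\omega2}}{\tau^{1-\frac\omega2}}\,B,$$ where $$B=\begin{cases}\max\left\{\sigma^{\omega-1}\Big(\frac{L(f(\mathbf{X}_1)-f^* )}{K}\Big)^{\frac12},\ \frac{1}{\gamma^{\omega-1}}\Big(\frac{L(f(\mathbf{X}_1)-f^* )}{K}\Big)^{\frac\omega2}\right\},&1\le\omega\le2,\\[2mm]\frac{1}{\gamma^{\omega-1}}\Big(\frac{L(f(\mathbf{X}_1)-f^* )}{K}\Big)^{\frac\omega2},&0<\omega<1.\end{cases}$$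
   Context: Norms: $\|\cdot\|_F$ and $\|\cdot\|_*$ are the Frobenius norm and the nuclear norm (sum of singular values). For $\mathbf{A}\in\mathbb{R}^{m\times n}$, $|\mathbf{A}|=(\mathbf{A}^T\mathbf{A})^{1/2}$, so $\||\mathbf{A}|^\omega\|_*=\sum_i\sigma_i(\mathbf{A})^\omega$, where $\sigma_i(\mathbf{A})$ are the singular values. $\preceq$ is the Loewner order. Powers of a symmetric positive (semi)definite matrix are defined by applying the power to the eigenvalues in an eigendecomposition. Algorithm (AdamW-style Shampoo). Hyperparameters $\eta>0$, $\theta,\beta\in[0,1)$, $\lambda\ge0$, $\varepsilon>0$, and $p,q\in(0,+\infty]$ with $\frac1p+\frac1q=2-\omega$, $\omega\in(0,2]$ (convention $1/\infty=0$; $\mathbf{L}_{k,\varepsilon}^{\pm1/\infty}=\mathbf{I}_m$, $\mathbf{R}_{k,\varepsilon}^{\pm1/\infty}=\mathbf{I}_n$). Start from a deterministic $\mathbf{X}_1\in\mathbb{R}^{m\times n}$, $\mathbf{M}_0=\mathbf{0}$, $\mathbf{L}_0=\mathbf{0}$, $\mathbf{R}_0=\mathbf{0}$. For $k=1,\dots,K$: obtain a random stochastic gradient $\mathbf{G}_k\in\mathbb{R}^{m\times n}$ at $\mathbf{X}_k$ and set $\mathbf{M}_k=\theta\mathbf{M}_{k-1}+(1-\theta)\mathbf{G}_k$, $\mathbf{L}_k=\beta\mathbf{L}_{k-1}+(1-\beta)\mathbf{G}_k\mathbf{G}_k^T$, $\mathbf{R}_k=\beta\mathbf{R}_{k-1}+(1-\beta)\mathbf{G}_k^T\mathbf{G}_k$,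 $\mathbf{L}_{k,\varepsilon}=\mathbf{L}_k+\varepsilon\mathbf{I}_m$, $\mathbf{R}_{k,\varepsilon}=\mathbf{R}_k+\varepsilon\mathbf{I}_n$, $\mathbf{X}_{k+1}=(1-\lambda\eta)\mathbf{X}_k-\eta\,\mathbf{L}_{k,\varepsilon}^{-\frac1{2p}}\mathbf{M}_k\mathbf{R}_{k,\varepsilon}^{-\frac1{2q}}$. $\mathcal{F}_k=\sigma(\mathbf{G}_1,\dots,\mathbf{G}_k)$ is the sigma-algebra generated by the stochastic gradients up to $k$ ($\mathcal{F}_0$ trivial), $\mathbb{E}_k[\cdot|\mathcal{F}_{k-1}]$ is conditional expectation given $\mathcal{F}_{k-1}$, $\mathbb{E}$ is total expectation. Assumption 1 (smoothness): $\|\nabla f(\mathbf{Y})-\nabla f(\mathbf{X})\|_F\le L\|\mathbf{Y}-\mathbf{X}\|_F$ for all $\mathbf{X},\mathbf{Y}$, with $L>0$. Assumption 2 (unbiasedness): $\mathbb{E}_k[\mathbf{G}_k|\mathcal{F}_{k-1}]=\nabla f(\mathbf{X}_k)$ for every $k$. Assumption 3: for some (deterministic) symmetric positive semidefinite $\Sigma_L\in\mathbb{R}^{m\times m}$, $\Sigma_R\in\mathbb{R}^{n\times n}$ and every $k$, $\mathbb{E}_k[(\mathbf{G}_k-\nabla f(\mathbf{X}_k))(\mathbf{G}_k-\nabla f(\mathbf{X}_k))^T|\mathcal{F}_{k-1}]\preceq\Sigma_L$ and $\mathbb{E}_k[(\mathbf{G}_k-\nabla f(\mathbf{X}_k))^T(\mathbf{G}_k-\nabla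 f(\mathbf{X}_k))|\mathcal{F}_{k-1}]\preceq\Sigma_R$. Set $\sigma^2=\frac{\operatorname{tr}(\Sigma_L)+\operatorname{tr}(\Sigma_R)}{2}$ and $\sigma=\sqrt{\sigma^2}$, $\hat\sigma=\sqrt{\hat\sigma^2}$. $f^*$ is a finite real number with $f(\mathbf{X})\ge f^*$ for all $\mathbf{X}$. *)

theory Defs
  imports "HOL-Probability.Probability"
begin

section \<open>Powers, singular values and the Loewner order\<close>

text \<open>
  Matrices live in \<open>real^'n^'m\<close> (\<open>m = CARD('m)\<close> rows, \<open>n = CARD('n)\<close> columns). On this type the
  library's \<open>norm\<close> and inner product are the Frobenius norm and the Frobenius inner product.
\<close>

definition diag_mat :: "real^'n \<Rightarrow> real^'n^'n" where
  "diag_mat d = (\<chi> i j. if i = j then d $ i else 0)"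

definition is_eigendecomposition :: "real^'n^'n \<Rightarrow> real^'n^'n \<Rightarrow> real^'n \<Rightarrow> bool" where
  "is_eigendecomposition A U d \<longleftrightarrow>
     orthogonal_matrix U \<and> A = U ** diag_mat d ** transpose U"

text \<open>
  For symmetric positive semidefinite \<open>A\<close> an eigendecomposition exists and the result does not
  depend on its choice. Since \<open>0 powr 0 = 0\<close>, the exponent \<open>0\<close> yields the identity matrix only
  for positive definite \<open>A\<close>.
\<close>

definition mat_powr :: "real^'n^'n \<Rightarrow> real \<Rightarrow> real^'n^'n" where
  "mat_powr A s =
     (THE B. \<exists>U d. is_eigendecomposition A U d \<and>
        B = U ** diag_mat (\<chi> i. (d $ i) powr s) ** transpose U)"

definition mat_abs :: "real^'n^'m \<Rightarrow> real^'n^'n" where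
  "mat_abs A = mat_powr (transpose A ** A) (1/2)"

text \<open>
  Singular values with multiplicity, as square roots of the eigenvalues of \<open>A\<^sup>T A\<close>. There are
  \<open>n\<close> of them rather than \<open>min m n\<close>; the surplus ones are zero and do not affect the nuclear norm.
\<close>

definition singular_values :: "real^'n^'m \<Rightarrow> real multiset" where
  "singular_values A =
     (THE S. \<exists>U d. is_eigendecomposition (transpose A ** A) U d \<and>
        S = image_mset (\<lambda>i. sqrt (d $ i)) (mset_set UNIV))"

definition nuclear_norm :: "real^'n^'m \<Rightarrow> real" where
  "nuclear_norm A = \<Sum>\<^sub># (singular_values A)"

definition pos_semidef :: "real^'n^'n \<Rightarrow> bool" where
  "pos_semidef A \<longleftrightarrow> transpose A = A \<and> (\<forall>v. 0 \<le> v \<bullet> (A *v v))"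

definition loewner_le :: "real^'n^'n \<Rightarrow> real^'n^'n \<Rightarrow> bool"  (infix "\<preceq>\<^sub>L" 50) where
  "A \<preceq>\<^sub>L B \<longleftrightarrow> pos_semidef (B - A)"


section \<open>Shampoo with decoupled weight decay\<close>

text \<open>
  The argument \<open>g\<close> is a realised sequence \<open>g 1, g 2, \<dots>\<close> of stochastic gradients; \<open>g 0\<close> is
  never used.
\<close>

primrec shampoo_M :: "real \<Rightarrow> (nat \<Rightarrow> real^'n^'m) \<Rightarrow> nat \<Rightarrow> real^'n^'m" where
  "shampoo_M \<theta> g 0 = 0"
| "shampoo_M \<theta> g (Suc k) = \<theta> *\<^sub>R shampoo_M \<theta> g k + (1 - \<theta>) *\<^sub>R g (Suc k)"

primrec shampoo_L :: "real \<Rightarrow> (nat \<Rightarrow> real^'n^'m) \<Rightarrow> nat \<Rightarrow> real^'m^'m" where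
  "shampoo_L \<beta> g 0 = 0"
| "shampoo_L \<beta> g (Suc k) =
     \<beta> *\<^sub>R shampoo_L \<beta> g k + (1 - \<beta>) *\<^sub>R (g (Suc k) ** transpose (g (Suc k)))"

primrec shampoo_R :: "real \<Rightarrow> (nat \<Rightarrow> real^'n^'m) \<Rightarrow> nat \<Rightarrow> real^'n^'n" where
  "shampoo_R \<beta> g 0 = 0"
| "shampoo_R \<beta> g (Suc k) =
     \<beta> *\<^sub>R shampoo_R \<beta> g k + (1 - \<beta>) *\<^sub>R (transpose (g (Suc k)) ** g (Suc k))"

definition shampoo_L_eps :: "real \<Rightarrow> real \<Rightarrow> (nat \<Rightarrow> real^'n^'m) \<Rightarrow> nat \<Rightarrow> real^'m^'m" where
  "shampoo_L_eps \<beta> \<epsilon> g k = shampoo_L \<beta> g k + \<epsilon> *\<^sub>R mat 1"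

definition shampoo_R_eps :: "real \<Rightarrow> real \<Rightarrow> (nat \<Rightarrow> real^'n^'m) \<Rightarrow> nat \<Rightarrow> real^'n^'n" where
  "shampoo_R_eps \<beta> \<epsilon> g k = shampoo_R \<beta> g k + \<epsilon> *\<^sub>R mat 1"

text \<open>
  In \<open>ereal\<close>, \<open>1 / (2 * \<infinity>) = 0\<close>. For \<open>\<epsilon> > 0\<close> the regularised matrices are positive definite, so
  exponent \<open>0\<close> then gives the identity matrix, as the convention for \<open>p = \<infinity>\<close> or \<open>q = \<infinity>\<close> demands.
  The iterates are numbered from 1; the value at index 0 is a dummy.
\<close>

primrec shampoo_X ::
  "real \<Rightarrow> real \<Rightarrow> real \<Rightarrow> real \<Rightarrow> real \<Rightarrow> ereal \<Rightarrow> ereal \<Rightarrow> real^'n^'m \<Rightarrow>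
   (nat \<Rightarrow> real^'n^'m) \<Rightarrow> nat \<Rightarrow> real^'n^'m" where
  "shampoo_X \<eta> \<theta> \<beta> wd \<epsilon> p q X1 g 0 = X1"
| "shampoo_X \<eta> \<theta> \<beta> wd \<epsilon> p q X1 g (Suc k) =
     (if k = 0 then X1
      else (1 - wd * \<eta>) *\<^sub>R shampoo_X \<eta> \<theta> \<beta> wd \<epsilon> p q X1 g k
           - \<eta> *\<^sub>R (mat_powr (shampoo_L_eps \<beta> \<epsilon> g k) (- real_of_ereal (1 / (2 * p)))
                  ** shampoo_M \<theta> g k
                  ** mat_powr (shampoo_R_eps \<beta> \<epsilon> g k) (- real_of_ereal (1 / (2 * q)))))"


section \<open>Filtration and conditional expectation\<close>

definition grad_filtration ::
  "'a measure \<Rightarrow> (nat \<Rightarrow> 'a \<Rightarrow> real^'n^'m) \<Rightarrow> nat \<Rightarrow> 'a measure" where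
  "grad_filtration M G k =
     sigma (space M) {G j -` A \<inter> space M | j A. j \<in> {1..k} \<and> A \<in> sets borel}"

text \<open>Entrywise conditional expectation; meaningful only for integrable \<open>Z\<close>.\<close>

definition mat_cond_exp ::
  "'a measure \<Rightarrow> 'a measure \<Rightarrow> ('a \<Rightarrow> real^'n^'m) \<Rightarrow> 'a \<Rightarrow> real^'n^'m" where
  "mat_cond_exp M F Z x = (\<chi> i j. real_cond_exp M F (\<lambda>y. Z y $ i $ j) x)"

end

theory Submission
  imports Defs
begin

text \<open>
  Put \<open>s = \<omega> / 2\<close>. Let \<open>A\<close> be the gradient at an iterate, \<open>L\<close> and \<open>R\<close> the regularised preconditioners
  there, and \<open>a = L powr (-1/4p) A R powr (-1/4q)\<close>. The descent lemma and the recursion for the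
  momentum error bound the average of \<open>E \<parallel>a\<parallel>\<^sup>2\<close> by some \<open>Z\<close> of order \<open>K powr (-1/2)\<close>. Hoelder's
  inequality for Schatten quasi-norms gives
  \<open>tr (A\<^sup>T A)\<^sup>s \<le> (tr L\<^sup>s) powr (1/2p) * (tr R\<^sup>s) powr (1/2q) * \<parallel>a\<parallel> powr (2s)\<close>. Conversely
  \<open>tr (_)\<^sup>s\<close> is subadditive on positive semidefinite matrices, so the averages of \<open>E (tr L\<^sup>s)\<close> and
  \<open>E (tr R\<^sup>s)\<close> are at most \<open>T + x * P\<close>, where \<open>P\<close> is the average to be estimated. Hence
  \<open>P \<le> (T + x * P) powr (1 - s) * Z powr s\<close>, and Young's inequality solves this for \<open>P\<close>.

  Hoelder's inequality in expectation is replaced by its tangent (Young) form along each trajectory, with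
  deterministic weights that involve \<open>P\<close> itself. Everything is then linear in quantities known to be
  integrable, and neither \<open>tr L\<^sup>s\<close> nor \<open>\<parallel>a\<parallel>\<^sup>2\<close> has to be integrated.
\<close>

text \<open>The tangent form loses nothing on average:
  \<open>T powr (1 - s) * Z powr s * ((1 - s) / T * q + s / Z * a)\<close> has mean at most
  \<open>T powr (1 - s) * Z powr s\<close> once the means of \<open>q\<close> and \<open>a\<close>
  are at most \<open>T\<close> and \<open>Z\<close>. As \<open>P\<close> is a finite number before
  any useful bound on it is known, it may occur inside \<open>T\<close>. Two obstacles shape the
  argument. For small \<open>s\<close> the Schatten quantities are not norms, so Hoelder's
  inequality is derived from Rayleigh quotients along orthogonal families instead of duality. And
  the preconditioner depends on the same stochastic gradient as the step it scales; the descent is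
  therefore pathwise, and each stochastic gradient inside the preconditioner is split into true
  gradient, which feeds \<open>P\<close> back, and noise, of which only the second moment is known.
  The descent keeps a negative multiple of the squared step length; it pays for the drift of the
  gradient in the momentum recursion. The constant 7 is 4 (initial gap) + 2 (first gradient) + 1
  (noise); the 3 in the trace bound is 1 (regularisation) + 2 (noise, doubled by the
  splitting).\<close>

declare transpose_matrix_vector [simp del]

section \<open>Orthonormal bases and the spectral theorem\<close>

lemma inner_matrix_vector_mult:
  fixes A :: "real^'n^'m"
  shows "x \<bullet> (A *v y) = (transpose A *v x) \<bullet> y"
  by (metis dot_lmul_matrix transpose_matrix_vector transpose_transpose)

text \<open>Families are indexed by the coordinate type itself, so orthonormality already forces
  completeness.\<close>

definition onb :: "('n::finite \<Rightarrow> real^'n) \<Rightarrow> bool" where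
  "onb u \<longleftrightarrow> (\<forall>i j. u i \<bullet> u j = (if i = j then 1 else 0))"

definition basis_matrix :: "('n::finite \<Rightarrow> real^'n) \<Rightarrow> real^'n^'n" where
  "basis_matrix u = (\<chi> a b. u b $ a)"

lemma column_basis_matrix [simp]: "column i (basis_matrix u) = u i"
  by (simp add: column_def basis_matrix_def)

lemma orthogonal_matrix_iff_onb: "orthogonal_matrix U \<longleftrightarrow> onb (\<lambda>i. column i U)"
  unfolding orthogonal_matrix onb_def
  by (simp add: matrix_matrix_mult_def transpose_def column_def inner_vec_def mat_def vec_eq_iff)

lemma onb_expand:
  assumes "onb u"
  shows "x = (\<Sum>i\<in>UNIV. (u i \<bullet> x) *\<^sub>R u i)"
proof -
  let ?U = "basis_matrix u"
  have "orthogonal_matrix ?U" using assms by (simp add: orthogonal_matrix_iff_onb)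
  then have "x = ?U *v (transpose ?U *v x)"
    by (simp add: matrix_vector_mul_assoc orthogonal_matrix_def)
  also have "\<dots> = (\<Sum>i\<in>UNIV. (u i \<bullet> x) *\<^sub>R u i)"
    by (simp add: vec_eq_iff matrix_vector_mult_def transpose_def basis_matrix_def inner_vec_def
        mult.commute)
  finally show ?thesis .
qed

lemma onb_parseval:
  assumes "onb u"
  shows "x \<bullet> y = (\<Sum>i\<in>UNIV. (u i \<bullet> x) * (u i \<bullet> y))"
  by (subst onb_expand[OF assms, of x]) (simp add: inner_sum_left)

lemma onb_norm:
  assumes "onb u"
  shows "(norm x)\<^sup>2 = (\<Sum>i\<in>UNIV. (u i \<bullet> x)\<^sup>2)"
  using onb_parseval[OF assms, of x x] by (simp add: dot_square_norm power2_eq_square)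

lemma onb_self [simp]: "onb u \<Longrightarrow> u i \<bullet> u i = 1"
  by (simp add: onb_def)

lemma onb_norm_1: "onb u \<Longrightarrow> norm (u i) = 1"
  by (simp add: norm_eq_sqrt_inner)

lemma onb_axis: "onb (\<lambda>i. axis i 1)"
  by (simp add: onb_def inner_axis_axis)

lemma onb_matrix_eqI:
  fixes A B :: "real^'n^'m"
  assumes "onb u" "\<And>i. A *v u i = B *v u i"
  shows "A = B"
proof -
  have "A *v x = B *v x" for x
    by (subst (1 2) onb_expand[OF assms(1), of x])
      (simp add: linear_sum[OF matrix_vector_mul_linear] matrix_vector_mult_scaleR assms(2))
  then show ?thesis by (simp add: matrix_eq)
qed

lemma onb_matrix_eqI2:
  fixes A B :: "real^'n^'m"
  assumes "onb u" "onb v" "\<And>i j. v j \<bullet> (A *v u i) = v j \<bullet> (B *v u i)"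
  shows "A = B"
proof (rule onb_matrix_eqI[OF assms(1)])
  fix i
  show "A *v u i = B *v u i"
    by (subst (1 2) onb_expand[OF assms(2), of "_ *v u i"]) (simp only: assms(3))
qed

lemma trace_onb:
  fixes A :: "real^'n^'n"
  assumes "onb u"
  shows "trace A = (\<Sum>i\<in>UNIV. u i \<bullet> (A *v u i))"
proof -
  let ?U = "basis_matrix u"
  have "orthogonal_matrix ?U" using assms by (simp add: orthogonal_matrix_iff_onb)
  then have "trace A = trace (A ** (?U ** transpose ?U))"
    by (simp add: orthogonal_matrix_def)
  also have "\<dots> = trace (transpose ?U ** (A ** ?U))"
    by (metis matrix_mul_assoc trace_mul_sym)
  also have "\<dots> = (\<Sum>i\<in>UNIV. u i \<bullet> (A *v u i))"
    by (simp add: trace_def matrix_matrix_mult_def transpose_def basis_matrix_def inner_vec_def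
        matrix_vector_mult_def)
  finally show ?thesis .
qed

lemma inner_matrix_onb:
  fixes A B :: "real^'n^'m"
  assumes "onb u"
  shows "A \<bullet> B = (\<Sum>i\<in>UNIV. (A *v u i) \<bullet> (B *v u i))"
proof -
  have "A \<bullet> B = (\<Sum>j\<in>UNIV. \<Sum>i\<in>UNIV. (u i \<bullet> A $ j) * (u i \<bullet> B $ j))"
    unfolding inner_vec_def[of A B] by (intro sum.cong refl) (rule onb_parseval[OF assms])
  also have "\<dots> = (\<Sum>i\<in>UNIV. \<Sum>j\<in>UNIV. (u i \<bullet> A $ j) * (u i \<bullet> B $ j))"
    by (rule sum.swap)
  also have "\<dots> = (\<Sum>i\<in>UNIV. (A *v u i) \<bullet> (B *v u i))"
    by (simp add: inner_vec_def[of "_ *v _"] matrix_vector_mul_component inner_commute)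
  finally show ?thesis .
qed

lemma norm_matrix_onb:
  fixes A :: "real^'n^'m"
  assumes "onb u"
  shows "(norm A)\<^sup>2 = (\<Sum>i\<in>UNIV. (norm (A *v u i))\<^sup>2)"
  using inner_matrix_onb[OF assms, of A A] by (simp add: dot_square_norm)

lemma norm_transpose [simp]: "norm (transpose A) = norm (A :: real^'n^'m)"
proof -
  have "transpose A \<bullet> transpose A = A \<bullet> A"
    unfolding inner_vec_def transpose_def by (simp add: inner_vec_def) (rule sum.swap)
  then show ?thesis by (simp add: norm_eq_sqrt_inner)
qed

lemma trace_mult_transpose:
  fixes A :: "real^'n^'m"
  shows "trace (A ** transpose A) = (norm A)\<^sup>2" "trace (transpose A ** A) = (norm A)\<^sup>2"
proof -
  have *: "trace (A ** transpose A) = (norm A)\<^sup>2" for A :: "real^'n^'m"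
    by (simp add: power2_norm_eq_inner trace_def matrix_matrix_mult_def transpose_def inner_vec_def)
  show "trace (A ** transpose A) = (norm A)\<^sup>2" by (rule *)
  show "trace (transpose A ** A) = (norm A)\<^sup>2"
    using * by (metis trace_mul_sym)
qed

lemma inner_matrix_mult_left:
  fixes A :: "real^'n^'m" and B :: "real^'k^'n" and C :: "real^'k^'m"
  shows "(A ** B) \<bullet> C = B \<bullet> (transpose A ** C)"
proof -
  have "(A *v (B *v x)) \<bullet> (C *v x) = (B *v x) \<bullet> (transpose A *v (C *v x))" for x
    using inner_matrix_vector_mult[of "B *v x" "transpose A" "C *v x"] by simp
  then show ?thesis
    by (simp add: inner_matrix_onb[OF onb_axis] matrix_vector_mul_assoc[symmetric])
qed

lemma inner_transpose:
  fixes A B :: "real^'n^'m"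
  shows "transpose A \<bullet> transpose B = A \<bullet> B"
  unfolding inner_vec_def transpose_def by (simp add: inner_vec_def) (rule sum.swap)

lemma inner_matrix_mult_right:
  fixes A :: "real^'n^'m" and B :: "real^'k^'n" and C :: "real^'k^'m"
  shows "(A ** B) \<bullet> C = A \<bullet> (C ** transpose B)"
proof -
  have "(A ** B) \<bullet> C = (transpose B ** transpose A) \<bullet> transpose C"
    by (simp add: inner_transpose flip: matrix_transpose_mul)
  also have "\<dots> = transpose A \<bullet> transpose (C ** transpose B)"
    by (simp add: inner_matrix_mult_left matrix_transpose_mul)
  finally show ?thesis by (simp add: inner_transpose)
qed

text \<open>The relational form of an eigendecomposition. Arguments about powers work with such a
  basis; the definite descriptions are opened only in \<open>mat_powr_eigbasis\<close> and
  \<open>nuclear_norm_eigbasis\<close>.\<close>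

definition eigbasis :: "real^'n^'n \<Rightarrow> ('n \<Rightarrow> real^'n) \<Rightarrow> ('n \<Rightarrow> real) \<Rightarrow> bool" where
  "eigbasis A u d \<longleftrightarrow> onb u \<and> (\<forall>i. A *v u i = d i *\<^sub>R u i)"

lemma eigbasisD: "eigbasis A u d \<Longrightarrow> onb u" "eigbasis A u d \<Longrightarrow> A *v u i = d i *\<^sub>R u i"
  by (auto simp: eigbasis_def)

lemma eigbasis_sym:
  assumes "eigbasis A u d"
  shows "transpose A = A"
proof -
  have "u j \<bullet> (transpose A *v u i) = u j \<bullet> (A *v u i)" for i j
  proof -
    have "u j \<bullet> (transpose A *v u i) = (A *v u j) \<bullet> u i"
      using inner_matrix_vector_mult[of "u j" "transpose A" "u i"] by (simp only: transpose_transpose)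
    also have "\<dots> = u j \<bullet> (A *v u i)"
      using eigbasisD(1)[OF assms] by (simp add: eigbasisD(2)[OF assms] onb_def)
    finally show ?thesis .
  qed
  then show ?thesis
    by (rule onb_matrix_eqI2[OF eigbasisD(1)[OF assms] eigbasisD(1)[OF assms]])
qed

lemma inner_sym:
  fixes A :: "real^'n^'n"
  assumes "transpose A = A"
  shows "(A *v x) \<bullet> y = x \<bullet> (A *v y)"
  by (simp add: inner_matrix_vector_mult assms)

text \<open>Maximise the quadratic form over the unit sphere of \<open>S\<close>. With
  \<open>l\<close> the maximum, \<open>g\<close> is nonnegative on \<open>S\<close> and vanishes at
  the maximiser \<open>x\<close>, so its first-order term along the residual
  \<open>l *\<^sub>R x - A *v x\<close> must vanish. Invariance of \<open>S\<close> keeps the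
  residual inside \<open>S\<close>.\<close>

lemma symmetric_has_eigenvector:
  fixes A :: "real^'n^'n"
  assumes sym: "transpose A = A" and S: "subspace S" "\<And>x. x \<in> S \<Longrightarrow> A *v x \<in> S"
    and x0: "x0 \<in> S" "x0 \<noteq> 0"
  obtains x l where "x \<in> S" "norm x = 1" "A *v x = l *\<^sub>R x"
proof -
  let ?T = "sphere 0 1 \<inter> S"
  have "compact ?T"
    by (intro compact_Int_closed compact_sphere closed_subspace S)
  moreover have "x0 /\<^sub>R norm x0 \<in> ?T"
    using x0 S(1) by (simp add: subspace_scale)
  moreover have "continuous_on ?T (\<lambda>x. x \<bullet> (A *v x))"
    by (intro continuous_intros)
  ultimately obtain x where x: "x \<in> ?T" and mx: "\<And>y. y \<in> ?T \<Longrightarrow> y \<bullet> (A *v y) \<le> x \<bullet> (A *v x)"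
    using continuous_attains_sup[of ?T "\<lambda>x. x \<bullet> (A *v x)"] by blast
  define l where "l = x \<bullet> (A *v x)"
  have nx: "norm x = 1" and xS: "x \<in> S" using x by auto
  define g where "g y = l * (y \<bullet> y) - y \<bullet> (A *v y)" for y
  have g0: "0 \<le> g y" if "y \<in> S" for y
  proof (cases "y = 0")
    case False
    have "(y /\<^sub>R norm y) \<bullet> (A *v (y /\<^sub>R norm y)) \<le> l"
      unfolding l_def by (rule mx) (use False that S(1) in \<open>simp add: subspace_scale\<close>)
    then have "(y \<bullet> (A *v y)) / (norm y)\<^sup>2 \<le> l"
      by (simp add: matrix_vector_mult_scaleR power2_eq_square divide_inverse mult_ac)
    then show ?thesis using False by (simp add: g_def power2_norm_eq_inner divide_le_eq)
  qed (simp add: g_def)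
  have gx: "g x = 0" using nx by (simp add: g_def l_def dot_square_norm)
  define y where "y = l *\<^sub>R x - A *v x"
  have yS: "y \<in> S" unfolding y_def using xS S by (simp add: subspace_diff subspace_scale)
  have expand: "g (x + t *\<^sub>R y) = 2 * t * (y \<bullet> y) + t\<^sup>2 * g y" for t
  proof -
    have "x \<bullet> (A *v y) = y \<bullet> (A *v x)" using inner_sym[OF sym] by (metis inner_commute)
    then have "g (x + t *\<^sub>R y) = g x + 2 * t * (y \<bullet> (l *\<^sub>R x - A *v x)) + t\<^sup>2 * g y"
      by (simp add: g_def matrix_vector_right_distrib matrix_vector_mult_scaleR inner_add_left
          inner_add_right inner_diff_right inner_commute[of x y] power2_eq_square algebra_simps)
    then show ?thesis by (simp add: gx y_def[symmetric])
  qed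
  have "y \<bullet> y = 0"
  proof (rule ccontr)
    assume "y \<bullet> y \<noteq> 0"
    then have pos: "0 < y \<bullet> y" by (simp add: order_less_le)
    have gy: "0 \<le> g y" by (rule g0[OF yS])
    \<comment> \<open>A negative step so short that \<open>t * g y \<ge> - (y \<bullet> y)\<close>:
      the bracket above stays positive and its product with \<open>t\<close> is negative. The
      \<open>+ 1\<close> guards against \<open>g y = 0\<close>.\<close>
    define t where "t = - (y \<bullet> y) / (g y + 1)"
    have "0 \<le> g (x + t *\<^sub>R y)" by (rule g0) (use xS yS S in \<open>simp add: subspace_add subspace_scale\<close>)
    then have "0 \<le> t * (2 * (y \<bullet> y) + t * g y)"
      unfolding expand by (simp add: power2_eq_square algebra_simps)
    moreover have "t < 0" unfolding t_def using pos gy by (simp add: divide_neg_pos)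
    moreover have "- (y \<bullet> y) \<le> t * g y"
      using gy pos unfolding t_def by (simp add: field_simps)
    ultimately show False using pos by (smt (verit) mult_neg_pos)
  qed
  then have "A *v x = l *\<^sub>R x" by (simp add: y_def)
  with xS nx that show thesis by blast
qed

text \<open>Take an orthonormal set of eigenvectors of greatest cardinality. If it did not span, its
  orthogonal complement would be a nonzero invariant subspace and would supply one more
  eigenvector.\<close>

lemma symmetric_eigbasis_exists:
  fixes A :: "real^'n^'n"
  assumes sym: "transpose A = A"
  obtains u d where "eigbasis A u d"
proof -
  define P where "P B \<longleftrightarrow> pairwise orthogonal B \<and> (\<forall>b\<in>B. norm b = 1 \<and> (\<exists>l. A *v b = l *\<^sub>R b))"
    for B :: "(real^'n) set"
  have indep: "independent B" if "P B" for B
  proof (rule pairwise_orthogonal_independent)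
    show "pairwise orthogonal B" "0 \<notin> B" using that by (auto simp: P_def)
  qed
  have "P {}" by (simp add: P_def)
  moreover have bound: "finite B \<and> card B \<le> CARD('n)" if "P B" for B
    using independent_bound[OF indep[OF that]] by simp
  then have "\<forall>B. P B \<longrightarrow> card B < Suc CARD('n)"
    by (simp add: less_Suc_eq_le)
  ultimately have "\<exists>B. P B \<and> (\<forall>B'. P B' \<longrightarrow> card B' \<le> card B)"
    by (rule ex_has_greatest_nat)
  then obtain B where B: "P B" and mx: "\<And>B'. P B' \<Longrightarrow> card B' \<le> card B"
    by blast
  have fin: "finite B" using bound[OF B] by blast
  have card: "card B = CARD('n)"
  proof (rule ccontr)
    assume "card B \<noteq> CARD('n)"
    moreover have "card B \<le> CARD('n)" using bound[OF B] by blast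
    ultimately have "dim B < DIM(real^'n)"
      using dim_eq_card_independent[OF indep[OF B]] by simp
    then obtain x0 where x0: "x0 \<noteq> 0" "\<And>y. y \<in> span B \<Longrightarrow> orthogonal x0 y"
      using orthogonal_to_subspace_exists by blast
    define S where "S = {y. \<forall>b\<in>B. b \<bullet> y = 0}"
    have "subspace S" by (auto simp: S_def subspace_def inner_add_right)
    moreover have "A *v x \<in> S" if "x \<in> S" for x
      using that B inner_sym[OF sym, symmetric] unfolding S_def P_def by fastforce
    moreover have "x0 \<in> S" using x0(2) by (auto simp: S_def orthogonal_def inner_commute span_base)
    ultimately obtain x l where x: "x \<in> S" "norm x = 1" "A *v x = l *\<^sub>R x"
      using symmetric_has_eigenvector[OF sym _ _ _ x0(1)] by blast
    have "x \<notin> B" using x(1,2) unfolding S_def by force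
    moreover have "P (insert x B)"
      using B x unfolding P_def S_def
      by (auto simp: pairwise_insert orthogonal_def inner_commute)
    ultimately show False using mx[of "insert x B"] fin by simp
  qed
  then obtain u where u: "bij_betw u (UNIV :: 'n set) B"
    using fin finite_same_card_bij[of "UNIV :: 'n set" B] by auto
  have "\<forall>i. \<exists>l. A *v u i = l *\<^sub>R u i" using B u unfolding P_def by (metis UNIV_I bij_betwE)
  then obtain d where d: "\<And>i. A *v u i = d i *\<^sub>R u i" by metis
  have "onb u"
    unfolding onb_def
  proof (intro allI)
    fix i j
    have uB: "u i \<in> B" "u j \<in> B" using u by (auto simp: bij_betw_def)
    show "u i \<bullet> u j = (if i = j then 1 else 0)"
    proof (cases "i = j")
      case True
      then show ?thesis using B uB by (simp add: P_def dot_square_norm)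
    next
      case False
      then have "u i \<noteq> u j" using u by (metis UNIV_I bij_betw_def inj_onD)
      then show ?thesis using B uB False unfolding P_def pairwise_def orthogonal_def by simp
    qed
  qed
  then show thesis using d that[of u d] by (simp add: eigbasis_def)
qed

lemma pos_semidef_eigbasis:
  assumes "pos_semidef A"
  obtains u d where "eigbasis A u d" "\<And>i. 0 \<le> d i"
proof -
  obtain u d where e: "eigbasis A u d"
    using symmetric_eigbasis_exists assms unfolding pos_semidef_def by blast
  have "0 \<le> d i" for i
    using assms eigbasisD[OF e] unfolding pos_semidef_def
    by (metis inner_scaleR_right mult.right_neutral onb_self)
  with e that show thesis by blast
qed

section \<open>Functions of symmetric matrices\<close>

lemma eigbasis_inner_eq:
  assumes "eigbasis A u d" "eigbasis A v e"
  shows "(u i \<bullet> v j) * (d i - e j) = 0"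
proof -
  have "(A *v u i) \<bullet> v j = u i \<bullet> (A *v v j)" by (rule inner_sym[OF eigbasis_sym[OF assms(1)]])
  then show ?thesis using assms by (simp add: eigbasis_def algebra_simps)
qed

text \<open>Between \<open>v j\<close> and \<open>u i\<close> the two matrices have entries
  \<open>g (d i)\<close> and \<open>g (e j)\<close> times the overlap of the vectors, and the
  overlap vanishes unless \<open>d i = e j\<close>.\<close>

lemma eigbasis_function_unique:
  assumes A: "eigbasis A u d" "eigbasis A v e"
    and B: "eigbasis B u (\<lambda>i. g (d i))" and B': "eigbasis B' v (\<lambda>i. g (e i))"
  shows "B = B'"
proof (rule onb_matrix_eqI2[OF eigbasisD(1)[OF A(1)] eigbasisD(1)[OF A(2)]])
  fix i j
  have "v j \<bullet> (B' *v u i) = (B' *v v j) \<bullet> u i" by (simp add: inner_sym[OF eigbasis_sym[OF B']])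
  then show "v j \<bullet> (B *v u i) = v j \<bullet> (B' *v u i)"
    using eigbasis_inner_eq[OF A, of i j]
    by (auto simp: eigbasisD(2)[OF B] eigbasisD(2)[OF B'] inner_commute)
qed

text \<open>Double counting: the squared overlaps \<open>w i j\<close> are doubly stochastic and
  supported on pairs with \<open>d i = e j\<close>, so both multiplicities of \<open>t\<close> equal
  the same total weight.\<close>

lemma eigbasis_mset_unique:
  assumes "eigbasis A u d" "eigbasis A v e"
  shows "image_mset d (mset_set UNIV) = image_mset e (mset_set UNIV)"
proof (rule multiset_eqI)
  fix t
  have ou: "onb u" and ov: "onb v" using assms by (auto simp: eigbasis_def)
  define w where "w i j = (u i \<bullet> v j)\<^sup>2" for i j
  have r: "(\<Sum>j\<in>UNIV. w i j) = 1" for i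
    using onb_norm[OF ov, of "u i"] onb_norm_1[OF ou] by (simp add: w_def inner_commute)
  have c: "(\<Sum>i\<in>UNIV. w i j) = 1" for j
    using onb_norm[OF ou, of "v j"] onb_norm_1[OF ov] by (simp add: w_def)
  have eq: "(if d i = t then w i j else 0) = (if e j = t then w i j else 0)" for i j
    using eigbasis_inner_eq[OF assms, of i j] by (auto simp: w_def)
  have "real (count (image_mset d (mset_set UNIV)) t) = (\<Sum>i\<in>UNIV. if d i = t then 1 else 0)"
    by (simp add: count_image_mset sum.If_cases vimage_def Collect_conj_eq)
  also have "\<dots> = (\<Sum>i\<in>UNIV. \<Sum>j\<in>UNIV. if d i = t then w i j else 0)"
    by (intro sum.cong refl) (simp add: r)
  also have "\<dots> = (\<Sum>j\<in>UNIV. \<Sum>i\<in>UNIV. if e j = t then w i j else 0)"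
    unfolding eq by (rule sum.swap)
  also have "\<dots> = (\<Sum>j\<in>UNIV. if e j = t then 1 else 0)"
    by (intro sum.cong refl) (simp add: c)
  also have "\<dots> = real (count (image_mset e (mset_set UNIV)) t)"
    by (simp add: count_image_mset sum.If_cases vimage_def Collect_conj_eq)
  finally show "count (image_mset d (mset_set UNIV)) t = count (image_mset e (mset_set UNIV)) t"
    by linarith
qed

lemma is_eigendecomposition_iff:
  "is_eigendecomposition A U d \<longleftrightarrow> eigbasis A (\<lambda>i. column i U) (\<lambda>i. d $ i)"
proof -
  have "A = U ** diag_mat d ** transpose U \<longleftrightarrow> (\<forall>i. A *v column i U = (d $ i) *\<^sub>R column i U)"
    if o: "orthogonal_matrix U"
  proof -
    have U: "transpose U ** U = mat 1" "U ** transpose U = mat 1"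
      using o by (auto simp: orthogonal_matrix_def)
    have "A = U ** diag_mat d ** transpose U \<longleftrightarrow> A ** U = U ** diag_mat d"
    proof
      assume "A = U ** diag_mat d ** transpose U"
      then show "A ** U = U ** diag_mat d"
        by (simp add: matrix_mul_assoc[symmetric] U)
    next
      assume *: "A ** U = U ** diag_mat d"
      have "A = (A ** U) ** transpose U" by (simp add: matrix_mul_assoc[symmetric] U)
      then show "A = U ** diag_mat d ** transpose U" by (simp only: *)
    qed
    also have "\<dots> \<longleftrightarrow> (\<forall>a i. (A ** U) $ a $ i = (U ** diag_mat d) $ a $ i)"
      by (simp add: vec_eq_iff)
    also have "\<dots> \<longleftrightarrow> (\<forall>a i. (A *v column i U) $ a = ((d $ i) *\<^sub>R column i U) $ a)"
      by (simp add: matrix_matrix_mult_def diag_mat_def column_def matrix_vector_mult_def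
          if_distrib[of "(*) _"] mult.commute cong: if_cong)
    also have "\<dots> \<longleftrightarrow> (\<forall>i. A *v column i U = (d $ i) *\<^sub>R column i U)"
      unfolding vec_eq_iff by blast
    finally show ?thesis .
  qed
  then show ?thesis
    unfolding is_eigendecomposition_def eigbasis_def orthogonal_matrix_iff_onb by blast
qed

lemma eigbasis_imp_is_eigendecomposition:
  "eigbasis A u d \<Longrightarrow> is_eigendecomposition A (basis_matrix u) (\<chi> i. d i)"
  by (simp add: is_eigendecomposition_iff)

lemma mat_powr_eigbasis:
  assumes "eigbasis A u d"
  shows "eigbasis (mat_powr A s) u (\<lambda>i. d i powr s)"
proof -
  let ?P = "\<lambda>B. \<exists>U d. is_eigendecomposition A U d \<and>
        B = U ** diag_mat (\<chi> i. (d $ i) powr s) ** transpose U"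
  define B where "B = basis_matrix u ** diag_mat (\<chi> i. ((\<chi> i. d i) $ i) powr s) ** transpose (basis_matrix u)"
  have o: "orthogonal_matrix (basis_matrix u)"
    using assms by (simp add: orthogonal_matrix_iff_onb eigbasis_def)
  then have "is_eigendecomposition B (basis_matrix u) (\<chi> i. ((\<chi> i. d i) $ i) powr s)"
    unfolding is_eigendecomposition_def B_def by simp
  then have B: "eigbasis B u (\<lambda>i. d i powr s)" by (simp add: is_eigendecomposition_iff)
  have "mat_powr A s = B"
    unfolding mat_powr_def
  proof (rule the_equality)
    show "?P B"
      using eigbasis_imp_is_eigendecomposition[OF assms] B_def
      by (intro exI[of _ "basis_matrix u"] exI[of _ "\<chi> i. d i"]) simp
  next
    fix C assume "?P C"
    then obtain U e where e: "is_eigendecomposition A U e"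
      and C: "C = U ** diag_mat (\<chi> i. (e $ i) powr s) ** transpose U" by blast
    from e have "is_eigendecomposition C U (\<chi> i. (e $ i) powr s)"
      unfolding is_eigendecomposition_def C by simp
    then have C': "eigbasis C (\<lambda>i. column i U) (\<lambda>i. (e $ i) powr s)"
      by (simp add: is_eigendecomposition_iff)
    show "C = B"
      using eigbasis_function_unique[OF e[unfolded is_eigendecomposition_iff] assms, of C "\<lambda>x. x powr s" B]
        C' B by simp
  qed
  with B show ?thesis by simp
qed

text \<open>At \<open>transpose A ** A\<close> this is the \<open>2 * s\<close>-th power of the
  Schatten quasi-norm of \<open>A\<close> with index \<open>2 * s\<close>.\<close>

definition trpow :: "real^'n^'n \<Rightarrow> real \<Rightarrow> real" where
  "trpow A s = trace (mat_powr A s)"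

lemma trace_eigbasis:
  assumes "eigbasis A u d"
  shows "trace A = (\<Sum>i\<in>UNIV. d i)"
  using trace_onb[OF eigbasisD(1)[OF assms], of A] eigbasisD[OF assms] by simp

lemma trpow_eigbasis:
  assumes "eigbasis A u d"
  shows "trpow A s = (\<Sum>i\<in>UNIV. d i powr s)"
  unfolding trpow_def by (rule trace_eigbasis[OF mat_powr_eigbasis[OF assms]])

lemma pos_semidef_transpose_mult: "pos_semidef (transpose A ** (A :: real^'n^'m))"
  unfolding pos_semidef_def
proof (intro conjI allI)
  fix v
  have "v \<bullet> (transpose A *v (A *v v)) = (A *v v) \<bullet> (A *v v)"
    using inner_matrix_vector_mult[of v "transpose A" "A *v v"] by simp
  then show "0 \<le> v \<bullet> (transpose A ** A *v v)"
    by (simp add: matrix_vector_mul_assoc[symmetric])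
qed (simp add: matrix_transpose_mul)

lemma pos_semidef_mult_transpose: "pos_semidef (A ** transpose (A :: real^'n^'m))"
  using pos_semidef_transpose_mult[of "transpose A"] by simp

lemma eigbasis_square:
  assumes "eigbasis A u d"
  shows "eigbasis (transpose A ** A) u (\<lambda>i. (d i)\<^sup>2)"
  using assms eigbasis_sym[OF assms] unfolding eigbasis_def
  by (simp add: matrix_vector_mul_assoc[symmetric] matrix_vector_mult_scaleR power2_eq_square)

lemma nuclear_norm_eigbasis:
  fixes A :: "real^'n^'m"
  assumes "eigbasis (transpose A ** A) u d"
  shows "nuclear_norm A = (\<Sum>i\<in>UNIV. sqrt (d i))"
proof -
  let ?P = "\<lambda>S. \<exists>U d. is_eigendecomposition (transpose A ** A) U d \<and>
        S = image_mset (\<lambda>i. sqrt (d $ i)) (mset_set UNIV)"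
  define S where "S = image_mset (\<lambda>i. sqrt (d i)) (mset_set UNIV)"
  have "singular_values A = S"
    unfolding singular_values_def
  proof (rule the_equality)
    show "?P S"
      by (intro exI[of _ "basis_matrix u"] exI[of _ "\<chi> i. d i"])
        (simp add: eigbasis_imp_is_eigendecomposition[OF assms] S_def)
  next
    fix C assume "?P C"
    then obtain U e where e: "is_eigendecomposition (transpose A ** A) U e"
      and C: "C = image_mset (\<lambda>i. sqrt (e $ i)) (mset_set UNIV)" by blast
    have "image_mset sqrt (image_mset (\<lambda>i. e $ i) (mset_set UNIV))
        = image_mset sqrt (image_mset d (mset_set UNIV))"
      using eigbasis_mset_unique[OF e[unfolded is_eigendecomposition_iff] assms] by simp
    then show "C = S"
      by (simp add: C S_def image_mset.compositionality comp_def)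
  qed
  then show ?thesis by (simp add: nuclear_norm_def S_def sum_unfold_sum_mset)
qed

lemma nuclear_norm_mat_abs_powr:
  fixes A :: "real^'n^'m"
  shows "nuclear_norm (mat_powr (mat_abs A) w) = trpow (transpose A ** A) (w/2)"
proof -
  obtain u d where e: "eigbasis (transpose A ** A) u d" and d: "\<And>i. 0 \<le> d i"
    using pos_semidef_eigbasis[OF pos_semidef_transpose_mult] by blast
  have "eigbasis (mat_powr (mat_abs A) w) u (\<lambda>i. (d i powr (1/2)) powr w)"
    unfolding mat_abs_def by (intro mat_powr_eigbasis e)
  from nuclear_norm_eigbasis[OF eigbasis_square[OF this]] show ?thesis
    by (simp add: trpow_eigbasis[OF e] powr_powr)
qed

section \<open>Trace inequalities for matrix powers\<close>

text \<open>Young's inequality for the normalised sequences. The exponents may be 0;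
  \<open>0 powr 0 = 0\<close> does no harm, because a vanishing sum on the right makes the left-hand
  side vanish too.\<close>

lemma Hoelder_sum_powr:
  fixes x y :: "'i \<Rightarrow> real"
  assumes "finite I" and x: "\<And>i. i \<in> I \<Longrightarrow> 0 \<le> x i" and y: "\<And>i. i \<in> I \<Longrightarrow> 0 \<le> y i"
    and ab: "0 \<le> a" "0 \<le> b" "a + b = 1"
  shows "(\<Sum>i\<in>I. x i powr a * y i powr b) \<le> (\<Sum>i\<in>I. x i) powr a * (\<Sum>i\<in>I. y i) powr b"
proof (cases "(\<Sum>i\<in>I. x i) = 0 \<or> (\<Sum>i\<in>I. y i) = 0")
  case True
  then have "(\<forall>i\<in>I. x i = 0) \<or> (\<forall>i\<in>I. y i = 0)"
    using assms by (simp add: sum_nonneg_eq_0_iff)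
  then have "(\<Sum>i\<in>I. x i powr a * y i powr b) = 0"
    by (intro sum.neutral) auto
  then show ?thesis by simp
next
  case False
  define S T where "S = (\<Sum>i\<in>I. x i)" and "T = (\<Sum>i\<in>I. y i)"
  have ST: "0 < S" "0 < T" using False assms unfolding S_def T_def
    by (simp_all add: order_less_le sum_nonneg)
  have le: "x i powr a * y i powr b \<le> S powr a * T powr b * (a * (x i / S) + b * (y i / T))"
    if "i \<in> I" for i
  proof (cases "x i = 0 \<or> y i = 0")
    case True
    then show ?thesis using x[OF that] y[OF that] ST ab by auto
  next
    case False
    then have pos: "0 < x i" "0 < y i" using x[OF that] y[OF that] by auto
    have "(x i / S) powr a * (y i / T) powr b \<le> a * (x i / S) + b * (y i / T)"
      by (rule Youngs_inequality_0) (use ab pos ST in auto)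
    then show ?thesis using pos ST by (simp add: powr_divide field_simps)
  qed
  have "(\<Sum>i\<in>I. x i powr a * y i powr b)
      \<le> (\<Sum>i\<in>I. S powr a * T powr b * (a * (x i / S) + b * (y i / T)))"
    by (rule sum_mono) (rule le)
  also have "\<dots> = S powr a * T powr b * (a * (S / S) + b * (T / T))"
    by (simp add: S_def T_def sum_distrib_left[symmetric] sum.distrib sum_divide_distrib[symmetric])
  also have "\<dots> = S powr a * T powr b" using ST ab by simp
  finally show ?thesis by (simp add: S_def T_def)
qed

lemma Jensen_sum_powr:
  fixes x c :: "'i \<Rightarrow> real"
  assumes "finite I" "\<And>i. i \<in> I \<Longrightarrow> 0 \<le> x i" "\<And>i. i \<in> I \<Longrightarrow> 0 \<le> c i"
    and c: "(\<Sum>i\<in>I. c i) = 1" and s: "0 \<le> s" "s \<le> 1"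
  shows "(\<Sum>i\<in>I. c i * x i powr s) \<le> (\<Sum>i\<in>I. c i * x i) powr s"
proof -
  have "c i * x i powr s = (c i * x i) powr s * c i powr (1 - s)" if "i \<in> I" for i
    using assms(2,3)[OF that] by (cases "c i = 0") (simp_all add: powr_mult powr_diff)
  then have "(\<Sum>i\<in>I. c i * x i powr s) = (\<Sum>i\<in>I. (c i * x i) powr s * c i powr (1 - s))"
    by simp
  also have "\<dots> \<le> (\<Sum>i\<in>I. c i * x i) powr s * (\<Sum>i\<in>I. c i) powr (1 - s)"
    by (rule Hoelder_sum_powr) (use assms in auto)
  finally show ?thesis by (simp add: c)
qed

text \<open>With a deterministic \<open>t\<close>, the power of a random quantity is replaced by an
  affine function of it, whose expectation is accessible.\<close>

lemma powr_concave_tangent: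
  fixes x t s :: real
  assumes "0 \<le> x" "0 < t" "0 \<le> s" "s \<le> 1"
  shows "x powr s \<le> s * t powr (s - 1) * x + (1 - s) * t powr s"
proof (cases "x = 0")
  case False
  have "(x / t) powr s * 1 powr (1 - s) \<le> s * (x / t) + (1 - s) * 1"
    by (rule Youngs_inequality_0) (use assms False in auto)
  then have "x powr s \<le> t powr s * (s * (x / t) + (1 - s))"
    using assms by (simp add: powr_divide field_simps)
  then show ?thesis using assms by (simp add: powr_diff field_simps)
qed (use assms in simp)

text \<open>The tangent at \<open>m\<close>, obtained from \<open>ln z \<le> z - 1\<close> and
  \<open>1 + z \<le> exp z\<close>, uniformly in \<open>w\<close>.\<close>

lemma powr_minus_convex_tangent:
  fixes x m w :: real
  assumes "0 < x" "0 < m" "0 \<le> w"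
  shows "m powr (-w) * (1 - w * (x / m - 1)) \<le> x powr (-w)"
proof -
  have "ln (x / m) \<le> x / m - 1" by (rule ln_le_minus_one) (use assms in simp)
  then have "1 - w * (x / m - 1) \<le> 1 + - w * ln (x / m)"
    using assms(3) mult_left_mono by fastforce
  also have "\<dots> \<le> exp (- w * ln (x / m))" by (rule exp_ge_add_one_self)
  also have "\<dots> = (x / m) powr (-w)" using assms by (simp add: powr_def)
  finally have "m powr (-w) * (1 - w * (x / m - 1)) \<le> m powr (-w) * (x / m) powr (-w)"
    by (rule mult_left_mono) simp
  then show ?thesis using assms by (simp add: powr_divide)
qed

section \<open>Comparison of trace powers through diagonal entries\<close>

lemma quadratic_form_eigbasis:
  assumes "eigbasis A v e"
  shows "x \<bullet> (A *v x) = (\<Sum>j\<in>UNIV. e j * (v j \<bullet> x)\<^sup>2)"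
proof -
  note o = eigbasisD(1)[OF assms]
  have "v j \<bullet> (A *v x) = e j * (v j \<bullet> x)" for j
    using inner_sym[OF eigbasis_sym[OF assms], of "v j" x] by (simp add: eigbasisD(2)[OF assms])
  then show ?thesis
    using onb_parseval[OF o, of x "A *v x"] by (simp add: power2_eq_square mult_ac)
qed

lemma bilinear_form_eigbasis:
  assumes "eigbasis A v e"
  shows "x \<bullet> (A *v y) = (\<Sum>j\<in>UNIV. e j * (v j \<bullet> x) * (v j \<bullet> y))"
proof -
  note o = eigbasisD(1)[OF assms]
  have "v j \<bullet> (A *v y) = e j * (v j \<bullet> y)" for j
    using inner_sym[OF eigbasis_sym[OF assms], of "v j" y] by (simp add: eigbasisD(2)[OF assms])
  then show ?thesis
    using onb_parseval[OF o, of x "A *v y"] by (simp add: mult_ac)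
qed

lemma onb_sum_sq:
  assumes "onb u" "onb v"
  shows "(\<Sum>j\<in>UNIV. (v j \<bullet> u i)\<^sup>2) = 1" "(\<Sum>j\<in>UNIV. (u i \<bullet> v j)\<^sup>2) = 1"
  using onb_norm[OF assms(2), of "u i"] onb_norm_1[OF assms(1)] by (simp_all add: inner_commute)

lemma pos_semidef_inner_nonneg: "pos_semidef A \<Longrightarrow> 0 \<le> x \<bullet> (A *v x)"
  by (simp add: pos_semidef_def)

lemma transpose_add: "transpose (A + B) = transpose A + transpose (B :: real^'n^'m)"
  by (simp add: vec_eq_iff transpose_def)

lemma transpose_diff: "transpose (A - B) = transpose A - transpose (B :: real^'n^'m)"
  by (simp add: vec_eq_iff transpose_def)

text \<open>Each diagonal entry is an average of eigenvalues with squared overlaps as weights. The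
  weights are doubly stochastic: sums in one index make Jensen applicable, sums in the other
  reassemble the trace.\<close>

lemma Peierls:
  assumes A: "pos_semidef A" and u: "onb u" and s: "0 \<le> s" "s \<le> 1"
  shows "trpow A s \<le> (\<Sum>i\<in>UNIV. (u i \<bullet> (A *v u i)) powr s)"
proof -
  obtain v e where e: "eigbasis A v e" and e0: "\<And>i. 0 \<le> e i"
    using pos_semidef_eigbasis[OF A] by blast
  note v = eigbasisD(1)[OF e]
  have "trpow A s = (\<Sum>j\<in>UNIV. (\<Sum>i\<in>UNIV. (v j \<bullet> u i)\<^sup>2) * e j powr s)"
    by (simp add: trpow_eigbasis[OF e] onb_sum_sq[OF v u])
  also have "\<dots> = (\<Sum>i\<in>UNIV. \<Sum>j\<in>UNIV. (v j \<bullet> u i)\<^sup>2 * e j powr s)"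
    by (simp add: sum_distrib_right) (rule sum.swap)
  also have "\<dots> \<le> (\<Sum>i\<in>UNIV. (\<Sum>j\<in>UNIV. (v j \<bullet> u i)\<^sup>2 * e j) powr s)"
    by (intro sum_mono Jensen_sum_powr) (auto simp: e0 s onb_sum_sq[OF u v])
  also have "\<dots> = (\<Sum>i\<in>UNIV. (u i \<bullet> (A *v u i)) powr s)"
    by (simp add: quadratic_form_eigbasis[OF e] mult.commute)
  finally show ?thesis .
qed

text \<open>In an eigenbasis of \<open>B\<close> the diagonal entries of \<open>B\<close> are its
  eigenvalues, while those of \<open>A\<close> are smaller and bound \<open>trpow A s\<close> from
  above by \<open>Peierls\<close>.\<close>

lemma trpow_mono:
  assumes A: "pos_semidef A" and AB: "A \<preceq>\<^sub>L B" and s: "0 \<le> s" "s \<le> 1"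
  shows "trpow A s \<le> trpow B s"
proof -
  have le: "x \<bullet> (A *v x) \<le> x \<bullet> (B *v x)" for x
    using AB unfolding loewner_le_def pos_semidef_def
    by (auto simp: matrix_vector_mult_diff_rdistrib inner_diff_right)
  have "transpose B = B"
    using A AB by (auto simp: loewner_le_def pos_semidef_def transpose_diff)
  then obtain u d where u: "eigbasis B u d" using symmetric_eigbasis_exists by blast
  have "trpow A s \<le> (\<Sum>i\<in>UNIV. (u i \<bullet> (A *v u i)) powr s)"
    by (rule Peierls[OF A eigbasisD(1)[OF u] s])
  also have "\<dots> \<le> (\<Sum>i\<in>UNIV. (u i \<bullet> (B *v u i)) powr s)"
    by (intro sum_mono powr_mono2 le s pos_semidef_inner_nonneg[OF A])
  also have "\<dots> = trpow B s"
    using eigbasisD(1)[OF u] by (simp add: trpow_eigbasis[OF u] eigbasisD(2)[OF u])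
  finally show ?thesis .
qed

lemma trpow_le_trace:
  fixes A :: "real^'n^'n"
  assumes A: "pos_semidef A" and s: "0 \<le> s" "s \<le> 1"
  shows "trpow A s \<le> real CARD('n) powr (1 - s) * trace A powr s"
proof -
  obtain v e where e: "eigbasis A v e" and e0: "\<And>i. 0 \<le> e i"
    using pos_semidef_eigbasis[OF A] by blast
  have "(\<Sum>j\<in>UNIV. e j powr s * 1 powr (1 - s))
      \<le> (\<Sum>j\<in>UNIV. e j) powr s * (\<Sum>j\<in>(UNIV :: 'n set). 1) powr (1 - s)"
    by (rule Hoelder_sum_powr) (use e0 s in auto)
  then show ?thesis by (simp add: trpow_eigbasis[OF e] trace_eigbasis[OF e] mult.commute)
qed

lemma trpow_nonneg: "pos_semidef A \<Longrightarrow> 0 \<le> trpow A s"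
  by (erule pos_semidef_eigbasis) (simp add: trpow_eigbasis sum_nonneg)

lemma trpow_1: "pos_semidef A \<Longrightarrow> trpow A 1 = trace A"
  by (erule pos_semidef_eigbasis) (simp add: trpow_eigbasis trace_eigbasis)

lemma trpow_scaleR:
  assumes A: "pos_semidef A" and c: "0 \<le> c"
  shows "trpow (c *\<^sub>R A) s = c powr s * trpow A s"
proof -
  obtain v e where e: "eigbasis A v e" and e0: "\<And>i. 0 \<le> e i"
    using pos_semidef_eigbasis[OF A] by blast
  then have "eigbasis (c *\<^sub>R A) v (\<lambda>i. c * e i)"
    by (simp add: eigbasis_def scaleR_matrix_vector_assoc[symmetric])
  then show ?thesis by (simp add: trpow_eigbasis[OF e] trpow_eigbasis powr_mult e0 c sum_distrib_left)
qed

lemma loewner_le_inner: "A \<preceq>\<^sub>L B \<Longrightarrow> x \<bullet> (A *v x) \<le> x \<bullet> (B *v x)"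
  unfolding loewner_le_def pos_semidef_def
  by (auto simp: matrix_vector_mult_diff_rdistrib inner_diff_right)

lemma loewner_le_eigenvalue:
  assumes "c *\<^sub>R mat 1 \<preceq>\<^sub>L A" "eigbasis A u d"
  shows "c \<le> d i"
  using loewner_le_inner[OF assms(1), of "u i"] eigbasisD(1)[OF assms(2)]
  by (simp add: eigbasisD(2)[OF assms(2)] scaleR_matrix_vector_assoc[symmetric])

lemma loewner_le_pos_semidef:
  fixes A :: "real^'n^'n"
  assumes "c *\<^sub>R mat 1 \<preceq>\<^sub>L A" "0 \<le> c"
  shows "pos_semidef A"
proof -
  have "transpose (c *\<^sub>R mat 1 :: real^'n^'n) = c *\<^sub>R mat 1"
    by (simp add: vec_eq_iff transpose_def mat_def)
  then have "transpose A = A"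
    using assms(1) unfolding loewner_le_def pos_semidef_def by (simp add: transpose_diff)
  moreover have "0 \<le> x \<bullet> (A *v x)" for x
  proof -
    have "0 \<le> c * (x \<bullet> x)" using assms(2) by simp
    also have "\<dots> \<le> x \<bullet> (A *v x)"
      using loewner_le_inner[OF assms(1), of x] by (simp add: scaleR_matrix_vector_assoc[symmetric])
    finally show ?thesis .
  qed
  ultimately show ?thesis by (simp add: pos_semidef_def)
qed

text \<open>
  The left-hand side is \<open>tr (A C powr (s - 1))\<close>; it is additive in \<open>A\<close>, so taking \<open>C = A + B\<close> yields the
  subadditivity of \<open>tr (_)\<^sup>s\<close>.
\<close>

lemma trace_powr_sub_le:
  assumes A: "pos_semidef A" and AC: "A \<preceq>\<^sub>L C" and C: "eigbasis C u c" "\<And>i. 0 < c i"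
    and s: "0 < s" "s \<le> 1"
  shows "(\<Sum>i\<in>UNIV. c i powr (s - 1) * (u i \<bullet> (A *v u i))) \<le> trpow A s"
proof -
  obtain v a where e: "eigbasis A v a" and a0: "\<And>i. 0 \<le> a i"
    using pos_semidef_eigbasis[OF A] by blast
  note v = eigbasisD(1)[OF e] and u = eigbasisD(1)[OF C(1)]
  have le: "a j * (\<Sum>i\<in>UNIV. (v j \<bullet> u i)\<^sup>2 * c i powr (s - 1)) \<le> a j powr s" for j
  proof (cases "a j = 0")
    case False
    then have aj: "0 < a j" using a0[of j] by simp
    \<comment> \<open>\<open>x\<close> is the inverse of \<open>C\<close> applied to
      \<open>v j\<close>, and \<open>T\<close> is \<open>v j \<bullet> x\<close>. Testing
      \<open>A \<preceq>\<^sub>L C\<close> on \<open>x\<close> gives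
      \<open>a j * T^2 \<le> T\<close>, a bound on the inverse of \<open>C\<close> without inverting
      the order.\<close>
    define T where "T = (\<Sum>i\<in>UNIV. (v j \<bullet> u i)\<^sup>2 * (1 / c i))"
    define x where "x = (\<Sum>i\<in>UNIV. ((v j \<bullet> u i) / c i) *\<^sub>R u i)"
    have ux: "u i \<bullet> x = (v j \<bullet> u i) / c i" for i
      using u unfolding x_def onb_def by (simp add: inner_sum_right if_distrib[of "(*) _"] cong: if_cong)
    have vx: "v j \<bullet> x = T"
      unfolding onb_parseval[OF u, of "v j" x] T_def ux
      by (simp add: power2_eq_square inner_commute)
    have "x \<bullet> (C *v x) = T"
      unfolding T_def quadratic_form_eigbasis[OF C(1)] ux
      by (rule sum.cong) (use C(2) in \<open>simp_all add: power2_eq_square less_imp_neq[symmetric] field_simps\<close>)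
    moreover have "a j * T\<^sup>2 \<le> x \<bullet> (A *v x)"
      unfolding quadratic_form_eigbasis[OF e] vx[symmetric]
      by (rule member_le_sum) (simp_all add: a0)
    ultimately have aT: "a j * T\<^sup>2 \<le> T" using loewner_le_inner[OF AC, of x] by simp
    have T0: "0 \<le> T" unfolding T_def using C(2) by (intro sum_nonneg) (simp add: less_imp_le)
    have T1: "T \<le> 1 / a j"
    proof (cases "T = 0")
      case False
      then show ?thesis using aT T0 aj by (simp add: power2_eq_square field_simps)
    qed (use aj in simp)
    \<comment> \<open>In the reciprocals of \<open>c i\<close> the negative exponent
      \<open>s - 1\<close> becomes the concave exponent \<open>1 - s\<close>, so Jensen points in
      the right direction.\<close>
    have "(\<Sum>i\<in>UNIV. (v j \<bullet> u i)\<^sup>2 * c i powr (s - 1))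
        = (\<Sum>i\<in>UNIV. (v j \<bullet> u i)\<^sup>2 * (1 / c i) powr (1 - s))"
      by (intro sum.cong refl) (use C(2) in \<open>simp add: powr_divide powr_diff field_simps less_imp_le\<close>)
    also have "\<dots> \<le> T powr (1 - s)"
      unfolding T_def by (rule Jensen_sum_powr) (use C(2) s in \<open>auto simp: onb_sum_sq[OF v u] less_imp_le\<close>)
    also have "\<dots> \<le> (1 / a j) powr (1 - s)"
      by (rule powr_mono2) (use s T0 T1 in auto)
    finally have "a j * (\<Sum>i\<in>UNIV. (v j \<bullet> u i)\<^sup>2 * c i powr (s - 1)) \<le> a j * (1 / a j) powr (1 - s)"
      using aj by simp
    also have "\<dots> = a j powr s" using aj by (simp add: powr_divide powr_diff)
    finally show ?thesis .
  qed simp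
  have "(\<Sum>i\<in>UNIV. c i powr (s - 1) * (u i \<bullet> (A *v u i)))
      = (\<Sum>i\<in>UNIV. \<Sum>j\<in>UNIV. a j * ((v j \<bullet> u i)\<^sup>2 * c i powr (s - 1)))"
    by (simp add: quadratic_form_eigbasis[OF e] sum_distrib_left mult_ac)
  also have "\<dots> = (\<Sum>j\<in>UNIV. \<Sum>i\<in>UNIV. a j * ((v j \<bullet> u i)\<^sup>2 * c i powr (s - 1)))"
    by (rule sum.swap)
  also have "\<dots> \<le> (\<Sum>j\<in>UNIV. a j powr s)"
    by (simp add: sum_distrib_left[symmetric] sum_mono le)
  finally show ?thesis by (simp add: trpow_eigbasis[OF e])
qed

lemma pos_semidef_add: "pos_semidef A \<Longrightarrow> pos_semidef B \<Longrightarrow> pos_semidef (A + B)"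
  unfolding pos_semidef_def
  by (simp add: matrix_vector_mult_add_rdistrib inner_add_right vec_eq_iff transpose_def)

lemma trpow_add_le:
  assumes A: "pos_semidef A" and B: "pos_semidef B" and C: "c *\<^sub>R mat 1 \<preceq>\<^sub>L A + B" "0 < c"
    and s: "0 < s" "s \<le> 1"
  shows "trpow (A + B) s \<le> trpow A s + trpow B s"
proof -
  obtain u d where d: "eigbasis (A + B) u d"
    using pos_semidef_eigbasis[OF pos_semidef_add[OF A B]] by blast
  have pos: "0 < d i" for i using loewner_le_eigenvalue[OF C(1) d, of i] C(2) by linarith
  have le: "A \<preceq>\<^sub>L A + B" "B \<preceq>\<^sub>L A + B" using A B by (simp_all add: loewner_le_def)
  have "d i powr s = d i powr (s - 1) * (u i \<bullet> ((A + B) *v u i))" for i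
    using eigbasisD(1)[OF d] pos[of i] by (simp add: eigbasisD(2)[OF d] powr_diff)
  then have "trpow (A + B) s = (\<Sum>i\<in>UNIV. d i powr (s - 1) * (u i \<bullet> ((A + B) *v u i)))"
    unfolding trpow_eigbasis[OF d] by simp
  also have "\<dots> = (\<Sum>i\<in>UNIV. d i powr (s - 1) * (u i \<bullet> (A *v u i)))
      + (\<Sum>i\<in>UNIV. d i powr (s - 1) * (u i \<bullet> (B *v u i)))"
    by (simp add: matrix_vector_mult_add_rdistrib inner_add_right algebra_simps sum.distrib)
  also have "\<dots> \<le> trpow A s + trpow B s"
    by (intro add_mono trace_powr_sub_le[OF _ _ d pos] A B le s)
  finally show ?thesis .
qed

section \<open>Lower bounds for trace powers along orthogonal families\<close>

lemma Bessel:
  fixes w :: "'k \<Rightarrow> 'v::real_inner"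
  assumes "finite J" and w: "\<And>k l. k \<in> J \<Longrightarrow> l \<in> J \<Longrightarrow> w k \<bullet> w l = (if k = l then 1 else 0)"
  shows "(\<Sum>k\<in>J. (w k \<bullet> x)\<^sup>2) \<le> (norm x)\<^sup>2"
proof -
  define y where "y = (\<Sum>k\<in>J. (w k \<bullet> x) *\<^sub>R w k)"
  have wy: "w k \<bullet> y = w k \<bullet> x" if "k \<in> J" for k
  proof -
    have "w k \<bullet> y = (\<Sum>l\<in>J. if k = l then w l \<bullet> x else 0)"
      unfolding y_def inner_sum_right by (intro sum.cong refl) (simp add: w that)
    also have "\<dots> = w k \<bullet> x" using assms(1) that by simp
    finally show ?thesis .
  qed
  have xy: "x \<bullet> y = (\<Sum>k\<in>J. (w k \<bullet> x)\<^sup>2)"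
    by (simp add: y_def inner_sum_right power2_eq_square inner_commute)
  have yy: "y \<bullet> y = (\<Sum>k\<in>J. (w k \<bullet> x)\<^sup>2)"
    by (subst (1) y_def) (simp add: inner_sum_left power2_eq_square wy)
  have "0 \<le> (x - y) \<bullet> (x - y)" by simp
  then show ?thesis using xy yy
    by (simp add: inner_diff_left inner_diff_right power2_norm_eq_inner inner_commute)
qed

text \<open>
  The vectors \<open>Z powr (1/2) f k\<close> are orthogonal. With \<open>c k j\<close> the squared coordinates of their
  normalisations in an eigenbasis of \<open>Z\<close>, each quotient is at most \<open>1 / (\<Sum>j. c k j / z j)\<close>, and convexity
  of \<open>t powr (-w)\<close> works for every \<open>w > 0\<close>, in particular in the quasi-norm range \<open>w < 1\<close>.
\<close>

lemma trpow_ge_orthogonal: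
  fixes f :: "'k::finite \<Rightarrow> real^'n"
  assumes Z: "pos_semidef Z" and f: "\<And>j k. f j \<bullet> (Z *v f k) = (if j = k then a k else 0)"
    and w: "0 < w"
  shows "(\<Sum>k\<in>UNIV. (a k / (norm (f k))\<^sup>2) powr w) \<le> trpow Z w"
proof -
  obtain q z where e: "eigbasis Z q z" and z0: "\<And>i. 0 \<le> z i"
    using pos_semidef_eigbasis[OF Z] by blast
  note q = eigbasisD(1)[OF e]
  have a0: "0 \<le> a k" for k using f[of k k] pos_semidef_inner_nonneg[OF Z, of "f k"] by simp
  \<comment> \<open>Indices with \<open>a k = 0\<close> contribute 0 to the sum, as
    \<open>w > 0\<close>, and their vectors cannot be normalised.\<close>
  define J where "J = {k. 0 < a k}"
  define c where "c k j = z j * (q j \<bullet> f k)\<^sup>2 / a k" for k j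
  \<comment> \<open>The normalised vectors \<open>Z powr (1/2) f k\<close>. They need not form a
    complete family, hence Bessel and only \<open>\<le> 1\<close> for the column sums of
    \<open>c\<close>.\<close>
  define g where "g k = (\<Sum>j\<in>UNIV. (sqrt (z j) * (q j \<bullet> f k) / sqrt (a k)) *\<^sub>R q j)" for k
  have gq: "g k \<bullet> q j = sqrt (z j) * (q j \<bullet> f k) / sqrt (a k)" for k j
    using q unfolding g_def onb_def
    by (simp add: inner_sum_left if_distrib[of "(*) _"] cong: if_cong)
  have gg: "g k \<bullet> g l = (if k = l then 1 else 0)" if "k \<in> J" "l \<in> J" for k l
  proof -
    have "g k \<bullet> g l = (\<Sum>j\<in>UNIV. z j * (q j \<bullet> f k) * (q j \<bullet> f l)) / (sqrt (a k) * sqrt (a l))"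
      unfolding onb_parseval[OF q, of "g k"] sum_divide_distrib
      by (intro sum.cong refl) (simp add: inner_commute[of "q _" "g _"] gq z0 field_simps)
    also have "\<dots> = (if k = l then 1 else 0)"
      using that f[of k l] unfolding bilinear_form_eigbasis[OF e, symmetric] J_def by auto
    finally show ?thesis .
  qed
  have c_col: "(\<Sum>k\<in>J. c k j) \<le> 1" for j
  proof -
    have "(\<Sum>k\<in>J. c k j) = (\<Sum>k\<in>J. (g k \<bullet> q j)\<^sup>2)"
      by (intro sum.cong refl) (simp add: c_def gq power_divide power_mult_distrib z0 a0)
    also have "\<dots> \<le> (norm (q j))\<^sup>2" by (rule Bessel) (simp_all add: gg)
    finally show ?thesis using onb_norm_1[OF q] by simp
  qed
  have row: "(a k / (norm (f k))\<^sup>2) powr w \<le> (\<Sum>j\<in>UNIV. c k j * z j powr w)" if "k \<in> J" for k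
  proof -
    have ak: "0 < a k" using that by (simp add: J_def)
    define S where "S = (\<Sum>j\<in>UNIV. c k j * (1 / z j))"
    have c1: "(\<Sum>j\<in>UNIV. c k j) = 1"
      using f[of k k] ak unfolding quadratic_form_eigbasis[OF e] c_def
      by (simp add: sum_divide_distrib[symmetric])
    have c0: "0 \<le> c k j" for j using z0 ak by (simp add: c_def)
    \<comment> \<open>An inequality only: coordinates in the kernel of \<open>Z\<close> drop out
      because \<open>1 / 0 = 0\<close>.\<close>
    have cz: "c k j * (1 / z j) \<le> (q j \<bullet> f k)\<^sup>2 / a k" for j
      using ak by (simp add: c_def)
    have S_le: "S \<le> (norm (f k))\<^sup>2 / a k"
      unfolding S_def onb_norm[OF q] sum_divide_distrib by (rule sum_mono) (rule cz)
    have S0: "0 < S"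
    proof -
      obtain j where j: "c k j \<noteq> 0" using c1 by (metis sum.neutral zero_neq_one)
      then have "0 < c k j" "z j \<noteq> 0" using c0[of j] by (auto simp: c_def order_less_le)
      then have "0 < c k j * (1 / z j)" using z0[of j] by (simp add: order_less_le)
      also have "\<dots> \<le> S" unfolding S_def by (rule member_le_sum) (simp_all add: c0 z0)
      finally show ?thesis .
    qed
    \<comment> \<open>Tangent at \<open>S\<close>, the mean of \<open>1 / z j\<close> under the
      weights \<open>c k j\<close>, so that the linear part cancels on summation. Where
      \<open>z j = 0\<close> the weight is 0 as well.\<close>
    have t: "c k j * (S powr (-w) * (1 - w * ((1 / z j) / S - 1))) \<le> c k j * z j powr w" for j
    proof (cases "z j = 0")
      case False
      then have "0 < z j" using z0[of j] by simp
      then have "S powr (-w) * (1 - w * ((1 / z j) / S - 1)) \<le> (1 / z j) powr (-w)"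
        by (intro powr_minus_convex_tangent) (use S0 w in auto)
      also have "\<dots> = z j powr w" using \<open>0 < z j\<close> by (simp add: powr_divide powr_minus)
      finally show ?thesis by (rule mult_left_mono) (rule c0)
    qed (simp add: c_def)
    have "(a k / (norm (f k))\<^sup>2) powr w \<le> (1 / S) powr w"
    proof (rule powr_mono2)
      have "0 < (norm (f k))\<^sup>2 / a k" using S_le S0 by linarith
      then have "0 < (norm (f k))\<^sup>2" using ak by (simp add: zero_less_divide_iff)
      then show "a k / (norm (f k))\<^sup>2 \<le> 1 / S" using S_le S0 ak by (simp add: field_simps)
    qed (use w ak in auto)
    also have "\<dots> = S powr (-w)" using S0 by (simp add: powr_divide powr_minus_divide)
    also have "\<dots> = S powr (-w) * ((\<Sum>j\<in>UNIV. c k j) - w * (S / S - (\<Sum>j\<in>UNIV. c k j)))"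
      using S0 by (simp add: c1)
    also have "\<dots> = (\<Sum>j\<in>UNIV. c k j * (S powr (-w) * (1 - w * ((1 / z j) / S - 1))))"
    proof -
      have "S / S = (\<Sum>j\<in>UNIV. c k j * ((1 / z j) / S))"
        by (subst (1) S_def) (simp add: sum_divide_distrib)
      then show ?thesis
        by (simp only: sum_distrib_left sum_subtractf[symmetric])
          (intro sum.cong refl, simp add: algebra_simps)
    qed
    also have "\<dots> \<le> (\<Sum>j\<in>UNIV. c k j * z j powr w)" by (rule sum_mono) (rule t)
    finally show ?thesis .
  qed
  have "(\<Sum>k\<in>UNIV. (a k / (norm (f k))\<^sup>2) powr w) = (\<Sum>k\<in>J. (a k / (norm (f k))\<^sup>2) powr w)"
    by (rule sum.mono_neutral_right) (use a0 in \<open>auto simp: J_def order_less_le\<close>)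
  also have "\<dots> \<le> (\<Sum>k\<in>J. \<Sum>j\<in>UNIV. c k j * z j powr w)" by (rule sum_mono) (rule row)
  also have "\<dots> = (\<Sum>j\<in>UNIV. (\<Sum>k\<in>J. c k j) * z j powr w)"
    by (subst sum.swap) (simp add: sum_distrib_right)
  also have "\<dots> \<le> (\<Sum>j\<in>UNIV. 1 * z j powr w)"
    by (intro sum_mono mult_right_mono c_col) simp
  finally show ?thesis by (simp add: trpow_eigbasis[OF e])
qed

text \<open>The images \<open>A *v u k\<close> of eigenvectors are orthogonal for the form of
  \<open>A ** transpose A\<close>, with Rayleigh quotients \<open>(d k)^2 / d k = d k\<close>;
  division by zero gives the correct value at vanishing eigenvalues. No matching of the two
  dimensions is involved.\<close>

lemma trpow_transpose_mult_le:
  fixes A :: "real^'n^'m"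
  assumes s: "0 < s"
  shows "trpow (transpose A ** A) s \<le> trpow (A ** transpose A) s"
proof -
  obtain u d where e: "eigbasis (transpose A ** A) u d" and d: "\<And>i. 0 \<le> d i"
    using pos_semidef_eigbasis[OF pos_semidef_transpose_mult] by blast
  note o = eigbasisD(1)[OF e]
  have AA: "(A *v x) \<bullet> (A *v y) = x \<bullet> ((transpose A ** A) *v y)" for x y
    using inner_matrix_vector_mult[of x "transpose A" "A *v y"]
    by (simp add: matrix_vector_mul_assoc[symmetric])
  have n: "(norm (A *v u i))\<^sup>2 = d i" for i
    unfolding power2_norm_eq_inner AA eigbasisD(2)[OF e] by (simp add: o)
  have "(A *v u j) \<bullet> ((A ** transpose A) *v (A *v u k)) = (if j = k then (d k)\<^sup>2 else 0)" for j k
  proof -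
    have "(A *v u j) \<bullet> ((A ** transpose A) *v (A *v u k))
        = (A *v u j) \<bullet> (A *v ((transpose A ** A) *v u k))"
      by (simp add: matrix_vector_mul_assoc matrix_mul_assoc)
    also have "\<dots> = d k * (u j \<bullet> ((transpose A ** A) *v u k))"
      by (simp add: eigbasisD(2)[OF e] matrix_vector_mult_scaleR AA)
    also have "\<dots> = (if j = k then (d k)\<^sup>2 else 0)"
      using o by (simp add: eigbasisD(2)[OF e] onb_def power2_eq_square)
    finally show ?thesis .
  qed
  from trpow_ge_orthogonal[OF pos_semidef_mult_transpose this s]
  have "(\<Sum>k\<in>UNIV. ((d k)\<^sup>2 / d k) powr s) \<le> trpow (A ** transpose A) s"
    unfolding n .
  then show ?thesis by (simp add: trpow_eigbasis[OF e] power2_eq_square)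
qed

text \<open>The Gram matrices may differ in size; for \<open>s > 0\<close> the surplus zero
  eigenvalues of the larger one contribute nothing.\<close>

lemma trpow_transpose_mult:
  fixes A :: "real^'n^'m"
  assumes s: "0 < s"
  shows "trpow (transpose A ** A) s = trpow (A ** transpose A) s"
  using trpow_transpose_mult_le[OF s, of A] trpow_transpose_mult_le[OF s, of "transpose A"]
  by simp

section \<open>Hoelder's inequality for matrix powers\<close>

lemma mat_powr_sym: "transpose A = A \<Longrightarrow> transpose (mat_powr A s) = mat_powr A s"
  by (erule symmetric_eigbasis_exists) (blast intro: eigbasis_sym mat_powr_eigbasis)

lemma mat_powr_add:
  assumes "transpose A = A"
  shows "mat_powr A s ** mat_powr A t = mat_powr A (s + t)"
proof -
  obtain u d where e: "eigbasis A u d" using symmetric_eigbasis_exists[OF assms] by blast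
  show ?thesis
    by (rule onb_matrix_eqI[OF eigbasisD(1)[OF e]])
      (simp add: matrix_vector_mul_assoc[symmetric] matrix_vector_mult_scaleR powr_add mult.commute
        eigbasisD(2)[OF mat_powr_eigbasis[OF e]])
qed

lemma mat_powr_0:
  assumes "c *\<^sub>R mat 1 \<preceq>\<^sub>L A" "0 < c"
  shows "mat_powr A 0 = mat 1"
proof -
  obtain u d where e: "eigbasis A u d"
    using pos_semidef_eigbasis[OF loewner_le_pos_semidef[OF assms(1)]] assms(2) by (metis less_imp_le)
  have "d i \<noteq> 0" for i using loewner_le_eigenvalue[OF assms(1) e, of i] assms(2) by linarith
  then show ?thesis
    by (intro onb_matrix_eqI[OF eigbasisD(1)[OF e]]) (simp add: eigbasisD(2)[OF mat_powr_eigbasis[OF e]])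
qed

lemma pos_semidef_congruence:
  assumes "pos_semidef Z" "transpose P = P"
  shows "pos_semidef (P ** Z ** P)"
  unfolding pos_semidef_def
proof (intro conjI allI)
  show "transpose (P ** Z ** P) = P ** Z ** P"
    using assms by (simp add: matrix_transpose_mul matrix_mul_assoc pos_semidef_def)
  fix x
  have "x \<bullet> ((P ** Z ** P) *v x) = (P *v x) \<bullet> (Z *v (P *v x))"
    by (simp add: matrix_vector_mul_assoc[symmetric] inner_sym[OF assms(2)])
  then show "0 \<le> x \<bullet> ((P ** Z ** P) *v x)" using pos_semidef_inner_nonneg[OF assms(1)] by simp
qed

text \<open>In an eigenbasis \<open>e\<close> of the product, with \<open>f k = P *v e k\<close>,
  each eigenvalue factors as \<open>a k = r k * (norm (f k))^2\<close>. The Rayleigh quotients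
  \<open>r k\<close> are controlled by \<open>trpow_ge_orthogonal\<close>. Jensen, which requires
  \<open>y \<le> 1\<close>, bounds the squared norms by \<open>g k powr y\<close>, and the
  \<open>g k\<close> sum to \<open>trpow L s\<close>. Scalar Hoelder with exponents
  \<open>u / w\<close> and \<open>u * y\<close> joins the two.\<close>

lemma trpow_Hoelder_step:
  fixes L Z :: "real^'n^'n"
  assumes Z: "pos_semidef Z" and L: "pos_semidef L"
    and y: "0 \<le> y" "y \<le> 1" and uw: "0 < u" "0 < w" "1 / u = 1 / w + y"
  shows "trpow (mat_powr L (s * y / 2) ** Z ** mat_powr L (s * y / 2)) u
    \<le> trpow Z w powr (u / w) * trpow L s powr (u * y)"
proof -
  define P where "P = mat_powr L (s * y / 2)"
  obtain v l where v: "eigbasis L v l" and l: "\<And>i. 0 \<le> l i"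
    using pos_semidef_eigbasis[OF L] by blast
  have P: "eigbasis P v (\<lambda>i. l i powr (s * y / 2))" unfolding P_def by (rule mat_powr_eigbasis[OF v])
  have symP: "transpose P = P" by (rule eigbasis_sym[OF P])
  obtain e a where e: "eigbasis (P ** Z ** P) e a" and a: "\<And>i. 0 \<le> a i"
    using pos_semidef_eigbasis[OF pos_semidef_congruence[OF Z symP]] by blast
  note ov = eigbasisD(1)[OF v] and oe = eigbasisD(1)[OF e]
  define f where "f k = P *v e k" for k
  have f: "f j \<bullet> (Z *v f k) = (if j = k then a k else 0)" for j k
  proof -
    have "f j \<bullet> (Z *v f k) = e j \<bullet> ((P ** Z ** P) *v e k)"
      unfolding f_def by (simp add: matrix_vector_mul_assoc[symmetric] inner_sym[OF symP])
    then show ?thesis using oe by (simp add: eigbasisD(2)[OF e] onb_def)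
  qed
  define r where "r k = a k / (norm (f k))\<^sup>2" for k
  define g where "g k = (\<Sum>i\<in>UNIV. (v i \<bullet> e k)\<^sup>2 * l i powr s)" for k
  have g0: "0 \<le> g k" for k by (simp add: g_def sum_nonneg)
  have r0: "0 \<le> r k" for k by (simp add: r_def a)
  have nf: "(norm (f k))\<^sup>2 \<le> g k powr y" for k
  proof -
    have "v i \<bullet> f k = l i powr (s * y / 2) * (v i \<bullet> e k)" for i
      unfolding f_def inner_sym[OF symP, symmetric] eigbasisD(2)[OF P] by simp
    then have "(norm (f k))\<^sup>2 = (\<Sum>i\<in>UNIV. (v i \<bullet> e k)\<^sup>2 * (l i powr s) powr y)"
      unfolding onb_norm[OF ov, of "f k"]
      by (simp add: power_mult_distrib powr_powr power2_eq_square mult_ac flip: powr_add)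
    also have "\<dots> \<le> g k powr y" unfolding g_def
      by (rule Jensen_sum_powr) (use y in \<open>auto simp: onb_sum_sq[OF oe ov]\<close>)
    finally show ?thesis .
  qed
  have a_le: "a k powr u \<le> (r k powr w) powr (u / w) * g k powr (u * y)" for k
  proof -
    \<comment> \<open>If \<open>f k = 0\<close>, the quotient \<open>r k\<close> is 0 by convention,
      and \<open>a k\<close> vanishes too.\<close>
    have "a k = r k * (norm (f k))\<^sup>2"
      using f[of k k] by (cases "f k = 0") (auto simp: r_def)
    also have "\<dots> \<le> r k * g k powr y" by (intro mult_left_mono nf r0)
    finally have "a k powr u \<le> (r k * g k powr y) powr u"
      using uw by (intro powr_mono2) (auto simp: a)
    also have "\<dots> = (r k powr w) powr (u / w) * g k powr (u * y)"
      using uw by (simp add: powr_mult r0 powr_powr mult.commute)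
    finally show ?thesis .
  qed
  have "trpow (P ** Z ** P) u \<le> (\<Sum>k\<in>UNIV. (r k powr w) powr (u / w) * g k powr (u * y))"
    unfolding trpow_eigbasis[OF e] by (intro sum_mono a_le)
  also have "\<dots> \<le> (\<Sum>k\<in>UNIV. r k powr w) powr (u / w) * (\<Sum>k\<in>UNIV. g k) powr (u * y)"
  proof (rule Hoelder_sum_powr)
    have "u * (1 / u) = u * (1 / w + y)" using uw(3) by simp
    then show "u / w + u * y = 1" using uw(1,2) by (simp only: distrib_left) simp
  qed (use uw y g0 in auto)
  also have "(\<Sum>k\<in>UNIV. g k) = trpow L s"
  proof -
    have "(\<Sum>k\<in>UNIV. g k) = (\<Sum>i\<in>UNIV. (\<Sum>k\<in>UNIV. (v i \<bullet> e k)\<^sup>2) * l i powr s)"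
      unfolding g_def by (subst sum.swap) (simp add: sum_distrib_right)
    then show ?thesis by (simp add: onb_sum_sq[OF ov oe] trpow_eigbasis[OF v])
  qed
  also have "(\<Sum>k\<in>UNIV. r k powr w) powr (u / w) \<le> trpow Z w powr (u / w)"
    by (intro powr_mono2 sum_nonneg) (use uw trpow_ge_orthogonal[OF Z f uw(2)] in \<open>auto simp: r_def\<close>)
  finally show ?thesis by (simp add: P_def mult_right_mono)
qed

text \<open>
  Exponents \<open>y > 1\<close>, which occur for \<open>s < 1/2\<close>, are reached by splitting the power of \<open>L\<close> into \<open>N\<close> equal
  factors that satisfy the restriction \<open>y \<le> 1\<close> of the single step.
\<close>

lemma trpow_Hoelder_iterate:
  fixes L Z :: "real^'n^'n"
  assumes Z: "pos_semidef Z" and L: "c *\<^sub>R mat 1 \<preceq>\<^sub>L L" "0 < c"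
    and y: "0 \<le> y" "y \<le> 1" and w: "0 < w"
  shows "0 < u \<Longrightarrow> 1 / u = 1 / w + real N * y \<Longrightarrow>
    trpow (mat_powr L (s * (real N * y) / 2) ** Z ** mat_powr L (s * (real N * y) / 2)) u
    \<le> trpow Z w powr (u / w) * trpow L s powr (u * (real N * y))"
proof (induction N arbitrary: u)
  case 0
  then have "u = w" using w by simp
  \<comment> \<open>Positivity turns the factor with exponent 0 into 1; at base 0 it would be
    0.\<close>
  moreover have "0 < trpow L s"
  proof -
    obtain v l where v: "eigbasis L v l"
      using pos_semidef_eigbasis[OF loewner_le_pos_semidef[OF L(1)]] L(2) by (metis less_imp_le)
    have "0 < l i" for i using loewner_le_eigenvalue[OF L(1) v, of i] L(2) by linarith
    then show ?thesis by (auto simp: trpow_eigbasis[OF v] less_imp_neq[symmetric] intro!: sum_pos)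
  qed
  ultimately show ?case using w mat_powr_0[OF L] trpow_nonneg[OF Z] by simp
next
  case (Suc N)
  have psd: "pos_semidef L" using loewner_le_pos_semidef[OF L(1)] L(2) by simp
  then have sym: "transpose L = L" by (simp add: pos_semidef_def)
  define Q where "Q = mat_powr L (s * (real N * y) / 2)"
  define P where "P = mat_powr L (s * y / 2)"
  define Z' where "Z' = Q ** Z ** Q"
  have psd': "pos_semidef Z'"
    unfolding Z'_def Q_def by (rule pos_semidef_congruence[OF Z mat_powr_sym[OF sym]])
  define u' where "u' = 1 / (1 / w + real N * y)"
  have u': "0 < u'" "1 / u' = 1 / w + real N * y"
    unfolding u'_def using w y by (auto intro!: add_pos_nonneg)
  have IH: "trpow Z' u' \<le> trpow Z w powr (u' / w) * trpow L s powr (u' * (real N * y))"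
    unfolding Z'_def Q_def by (rule Suc.IH[OF u'])
  have split: "mat_powr L (s * (real (Suc N) * y) / 2) = P ** Q"
    "mat_powr L (s * (real (Suc N) * y) / 2) = Q ** P"
    unfolding P_def Q_def mat_powr_add[OF sym] by (simp_all add: algebra_simps add_divide_distrib)
  have "trpow (mat_powr L (s * (real (Suc N) * y) / 2) ** Z ** mat_powr L (s * (real (Suc N) * y) / 2)) u
      = trpow (P ** Z' ** P) u"
    by (subst split(1), subst split(2)) (simp add: Z'_def matrix_mul_assoc)
  also have "\<dots> \<le> trpow Z' u' powr (u / u') * trpow L s powr (u * y)"
    unfolding P_def
    by (rule trpow_Hoelder_step[OF psd' psd y Suc.prems(1) u'(1)])
      (use Suc.prems(2) u'(2) in \<open>simp add: algebra_simps\<close>)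
  also have "\<dots> \<le> (trpow Z w powr (u' / w) * trpow L s powr (u' * (real N * y))) powr (u / u')
      * trpow L s powr (u * y)"
    by (intro mult_right_mono powr_mono2 IH trpow_nonneg psd') (use u' Suc.prems in auto)
  also have "\<dots> = trpow Z w powr (u / w) * trpow L s powr (u * (real (Suc N) * y))"
    using u'(1) by (simp add: powr_mult powr_powr algebra_simps powr_add)
  finally show ?case .
qed

lemma trpow_Hoelder:
  fixes L Z :: "real^'n^'n"
  assumes Z: "pos_semidef Z" and L: "c *\<^sub>R mat 1 \<preceq>\<^sub>L L" "0 < c"
    and y: "0 \<le> y" and uw: "0 < u" "0 < w" "1 / u = 1 / w + y"
  shows "trpow (mat_powr L (s * y / 2) ** Z ** mat_powr L (s * y / 2)) u
    \<le> trpow Z w powr (u / w) * trpow L s powr (u * y)"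
proof -
  obtain N :: nat where N: "max 1 y \<le> real N" using real_arch_simple by blast
  then have "0 < real N" by linarith
  then have "real N * (y / real N) = y" "y / real N \<le> 1" using N by auto
  then show ?thesis
    using trpow_Hoelder_iterate[OF Z L, of "y / real N" w u N s] y uw by simp
qed

text \<open>The preconditioners act on opposite sides and are peeled off in turn: \<open>R\<close>
  from \<open>transpose Y ** Y\<close>, then \<open>L\<close> from \<open>Y ** transpose Y\<close>,
  with \<open>trpow_transpose_mult\<close> switching between the Gram matrices.\<close>

lemma trpow_Hoelder_two_sided:
  fixes B :: "real^'n^'m"
  assumes L: "c *\<^sub>R mat 1 \<preceq>\<^sub>L L" and R: "c *\<^sub>R mat 1 \<preceq>\<^sub>L R" and c: "0 < c"
    and k: "0 \<le> k1" "0 \<le> k2" "k1 + k2 = 1 - s" and s: "0 < s"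
    and A: "A = mat_powr L (k1 / 2) ** B ** mat_powr R (k2 / 2)"
  shows "trpow (transpose A ** A) s
    \<le> trpow L s powr k1 * trpow R s powr k2 * ((norm B)\<^sup>2) powr s"
proof -
  have sym: "transpose L = L" "transpose R = R"
    using loewner_le_pos_semidef[OF L] loewner_le_pos_semidef[OF R] c by (auto simp: pos_semidef_def)
  define P where "P = mat_powr L (k1 / 2)"
  define Q where "Q = mat_powr R (k2 / 2)"
  have tP: "transpose P = P" and tQ: "transpose Q = Q"
    unfolding P_def Q_def by (simp_all add: mat_powr_sym sym)
  \<comment> \<open>The intermediate exponent. Starting from exponent 1, where the trace is the
    squared Frobenius norm of \<open>B\<close>, the factor from \<open>R\<close> raises the
    reciprocal by \<open>k2 / s\<close>; the factor from \<open>L\<close> adds \<open>k1 / s\<close>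
    and lands on \<open>1 / s\<close>.\<close>
  define t where "t = 1 / (1 + k2 / s)"
  have t: "0 < t" "1 / t = 1 / 1 + k2 / s" unfolding t_def using k s by (auto intro!: add_pos_nonneg)
  define Y where "Y = B ** Q"
  have "trpow (Y ** transpose Y) t = trpow (transpose Y ** Y) t"
    by (rule trpow_transpose_mult[OF t(1), symmetric])
  also have "transpose Y ** Y = Q ** (transpose B ** B) ** Q"
    by (simp add: Y_def matrix_transpose_mul tQ matrix_mul_assoc)
  also have "trpow \<dots> t \<le> trpow (transpose B ** B) 1 powr (t / 1) * trpow R s powr (t * (k2 / s))"
    using trpow_Hoelder[OF pos_semidef_transpose_mult R c, of "k2 / s" t 1 s] t k s
    by (simp add: Q_def)
  also have "trpow (transpose B ** B) 1 = (norm B)\<^sup>2"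
    by (simp add: trpow_1 pos_semidef_transpose_mult trace_mult_transpose)
  finally have YY: "trpow (Y ** transpose Y) t \<le> ((norm B)\<^sup>2) powr t * trpow R s powr (t * (k2 / s))"
    by simp
  have "1 / s = 1 / t + k1 / s"
  proof -
    have "1 / t + k1 / s = 1 + (k1 + k2) / s" unfolding t(2) by (simp add: add_divide_distrib)
    also have "\<dots> = 1 / s" unfolding k(3) using s by (simp add: diff_divide_distrib)
    finally show ?thesis by simp
  qed
  then have H: "trpow (P ** (Y ** transpose Y) ** P) s
      \<le> trpow (Y ** transpose Y) t powr (s / t) * trpow L s powr (s * (k1 / s))"
    using trpow_Hoelder[OF pos_semidef_mult_transpose L c, of "k1 / s" s t s] t k s
    by (simp add: P_def)
  have "trpow (transpose A ** A) s = trpow (A ** transpose A) s" by (rule trpow_transpose_mult[OF s])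
  also have "A ** transpose A = P ** (Y ** transpose Y) ** P"
    unfolding A P_def[symmetric] Q_def[symmetric] Y_def
    by (simp add: matrix_transpose_mul tP tQ matrix_mul_assoc)
  also note H
  also have "trpow (Y ** transpose Y) t powr (s / t) * trpow L s powr (s * (k1 / s))
      \<le> (((norm B)\<^sup>2) powr t * trpow R s powr (t * (k2 / s))) powr (s / t) * trpow L s powr (s * (k1 / s))"
    by (intro mult_right_mono powr_mono2 YY trpow_nonneg pos_semidef_mult_transpose) (use s t in auto)
  also have "\<dots> = trpow L s powr k1 * trpow R s powr k2 * ((norm B)\<^sup>2) powr s"
    using s t(1) by (simp add: powr_mult powr_powr)
  finally show ?thesis .
qed

section \<open>Norm bounds, continuity and measurability\<close>

lemma norm_mat_powr_mult_le:
  fixes A :: "real^'n^'n" and Y :: "real^'k^'n"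
  assumes A: "c *\<^sub>R mat 1 \<preceq>\<^sub>L A" "0 < c" and a: "0 \<le> a"
  shows "norm (mat_powr A (- a) ** Y) \<le> c powr (- a) * norm Y"
proof -
  obtain u d where e: "eigbasis A u d"
    using pos_semidef_eigbasis[OF loewner_le_pos_semidef[OF A(1)]] A(2) by (metis less_imp_le)
  note P = mat_powr_eigbasis[OF e, of "- a"] and o = eigbasisD(1)[OF e]
  have le: "(norm (mat_powr A (- a) *v x))\<^sup>2 \<le> (c powr (- a))\<^sup>2 * (norm x)\<^sup>2" for x
  proof -
    have ux: "u i \<bullet> (mat_powr A (- a) *v x) = d i powr (- a) * (u i \<bullet> x)" for i
      unfolding inner_sym[OF eigbasis_sym[OF P], symmetric] eigbasisD(2)[OF P] by simp
    have "(norm (mat_powr A (- a) *v x))\<^sup>2 = (\<Sum>i\<in>UNIV. (d i powr (- a))\<^sup>2 * (u i \<bullet> x)\<^sup>2)"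
      unfolding onb_norm[OF o] ux by (simp add: power_mult_distrib)
    also have "\<dots> \<le> (\<Sum>i\<in>UNIV. (c powr (- a))\<^sup>2 * (u i \<bullet> x)\<^sup>2)"
      using loewner_le_eigenvalue[OF A(1) e] A(2) a
      by (intro sum_mono mult_right_mono power_mono powr_mono2') auto
    finally show ?thesis by (simp add: onb_norm[OF o, of x] sum_distrib_left)
  qed
  have "(norm (mat_powr A (- a) ** Y))\<^sup>2 \<le> (c powr (- a) * norm Y)\<^sup>2"
    by (simp add: norm_matrix_onb[OF onb_axis] matrix_vector_mul_assoc[symmetric]
        power_mult_distrib sum_distrib_left sum_mono le)
  then show ?thesis by (rule power2_le_imp_le) simp
qed

lemma norm_mult_mat_powr_le:
  fixes A :: "real^'n^'n" and Y :: "real^'n^'k"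
  assumes A: "c *\<^sub>R mat 1 \<preceq>\<^sub>L A" "0 < c" and a: "0 \<le> a"
  shows "norm (Y ** mat_powr A (- a)) \<le> c powr (- a) * norm Y"
proof -
  have "transpose A = A"
    using loewner_le_pos_semidef[OF A(1)] A(2) by (simp add: pos_semidef_def)
  then have "transpose (Y ** mat_powr A (- a)) = mat_powr A (- a) ** transpose Y"
    by (simp add: matrix_transpose_mul mat_powr_sym)
  then show ?thesis
    using norm_mat_powr_mult_le[OF A a, of "transpose Y"]
    by (metis norm_transpose)
qed

lemma norm_two_sided_le:
  fixes L :: "real^'m^'m" and R :: "real^'n^'n" and Y :: "real^'n^'m"
  assumes L: "c *\<^sub>R mat 1 \<preceq>\<^sub>L L" and R: "c *\<^sub>R mat 1 \<preceq>\<^sub>L R" and c: "0 < c"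
    and ab: "0 \<le> a" "0 \<le> b"
  shows "norm (mat_powr L (- a) ** Y ** mat_powr R (- b)) \<le> c powr (- (a + b)) * norm Y"
proof -
  have "norm (mat_powr L (- a) ** Y ** mat_powr R (- b)) \<le> c powr (- b) * norm (mat_powr L (- a) ** Y)"
    by (rule norm_mult_mat_powr_le[OF R c ab(2)])
  also have "\<dots> \<le> c powr (- b) * (c powr (- a) * norm Y)"
    by (intro mult_left_mono norm_mat_powr_mult_le[OF L c ab(1)]) simp
  also have "\<dots> = c powr (- (a + b)) * norm Y"
    using powr_add[of c "- b" "- a"] by (simp add: add.commute)
  finally show ?thesis .
qed

text \<open>In mixed bases the entries of \<open>A' - B'\<close> and \<open>A - B\<close> are
  \<open>a' i - b' j\<close> and \<open>a i - b j\<close> times the same overlap, so a scalar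
  Lipschitz bound passes to the Frobenius norm. This yields continuity, hence measurability, of
  \<open>mat_powr\<close>.\<close>

lemma norm_function_diff_le:
  assumes A: "eigbasis A u a" "eigbasis A' u a'" and B: "eigbasis B v b" "eigbasis B' v b'"
    and le: "\<And>i j. \<bar>a' i - b' j\<bar> \<le> C * \<bar>a i - b j\<bar>" and C: "0 \<le> C"
  shows "norm (A' - B') \<le> C * norm (A - B)"
proof -
  note u = eigbasisD(1)[OF A(1)] and v = eigbasisD(1)[OF B(1)]
  have *: "v j \<bullet> ((X - Y) *v u i) = (x i - y j) * (v j \<bullet> u i)"
    if "eigbasis X u x" "eigbasis Y v y" for X Y x y i j
    using inner_sym[OF eigbasis_sym[OF that(2)], of "v j" "u i"]
    by (simp add: matrix_vector_mult_diff_rdistrib inner_diff_right eigbasisD(2)[OF that(1)]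
        eigbasisD(2)[OF that(2)] algebra_simps)
  have "(norm (A' - B'))\<^sup>2 = (\<Sum>i\<in>UNIV. \<Sum>j\<in>UNIV. (a' i - b' j)\<^sup>2 * (v j \<bullet> u i)\<^sup>2)"
    unfolding norm_matrix_onb[OF u] onb_norm[OF v] *[OF A(2) B(2)] by (simp add: power_mult_distrib)
  also have "\<dots> \<le> (\<Sum>i\<in>UNIV. \<Sum>j\<in>UNIV. C\<^sup>2 * ((a i - b j)\<^sup>2 * (v j \<bullet> u i)\<^sup>2))"
  proof (intro sum_mono)
    fix i j
    have "(a' i - b' j)\<^sup>2 \<le> (C * \<bar>a i - b j\<bar>)\<^sup>2"
      using le[of i j] by (metis abs_ge_zero power2_abs power_mono)
    then show "(a' i - b' j)\<^sup>2 * (v j \<bullet> u i)\<^sup>2 \<le> C\<^sup>2 * ((a i - b j)\<^sup>2 * (v j \<bullet> u i)\<^sup>2)"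
      by (simp add: power_mult_distrib mult_right_mono flip: mult.assoc)
  qed
  also have "\<dots> = (C * norm (A - B))\<^sup>2"
    unfolding power_mult_distrib norm_matrix_onb[OF u] onb_norm[OF v] *[OF A(1) B(1)]
    by (simp add: power_mult_distrib sum_distrib_left)
  finally show ?thesis by (rule power2_le_imp_le) (simp add: C)
qed

lemma powr_Lipschitz:
  fixes x y c r :: real
  assumes "0 < c" "c \<le> x" "c \<le> y" "r \<le> 1"
  shows "\<bar>x powr r - y powr r\<bar> \<le> \<bar>r\<bar> * c powr (r - 1) * \<bar>x - y\<bar>"
proof -
  have "norm (x powr r - y powr r) \<le> (\<bar>r\<bar> * c powr (r - 1)) * norm (x - y)"
  proof (rule field_differentiable_bound[where S = "{c..}" and f' = "\<lambda>z. r * z powr (r - 1)"])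
    fix z assume z: "z \<in> {c..}"
    then show "((\<lambda>z. z powr r) has_field_derivative r * z powr (r - 1)) (at z within {c..})"
      using assms(1) has_real_derivative_powr[of z r] has_field_derivative_at_within by auto
    have "z powr (r - 1) \<le> c powr (r - 1)"
      using z assms by (intro powr_mono2') auto
    then show "norm (r * z powr (r - 1)) \<le> \<bar>r\<bar> * c powr (r - 1)"
      by (simp add: abs_mult mult_left_mono)
  qed (use assms in auto)
  then show ?thesis by simp
qed

lemma continuous_on_mat_powr:
  assumes c: "0 < c" and r: "r \<le> 1"
  shows "continuous_on {A :: real^'n^'n. c *\<^sub>R mat 1 \<preceq>\<^sub>L A} (\<lambda>A. mat_powr A r)"
proof (rule lipschitz_on_continuous_on)
  show "(\<bar>r\<bar> * c powr (r - 1))-lipschitz_on {A :: real^'n^'n. c *\<^sub>R mat 1 \<preceq>\<^sub>L A} (\<lambda>A. mat_powr A r)"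
  proof (rule lipschitz_onI)
    fix A B :: "real^'n^'n"
    assume "A \<in> {A. c *\<^sub>R mat 1 \<preceq>\<^sub>L A}" "B \<in> {A. c *\<^sub>R mat 1 \<preceq>\<^sub>L A}"
    then have A: "c *\<^sub>R mat 1 \<preceq>\<^sub>L A" and B: "c *\<^sub>R mat 1 \<preceq>\<^sub>L B" by auto
    obtain u a where u: "eigbasis A u a"
      using pos_semidef_eigbasis[OF loewner_le_pos_semidef[OF A]] c by (metis less_imp_le)
    obtain v b where v: "eigbasis B v b"
      using pos_semidef_eigbasis[OF loewner_le_pos_semidef[OF B]] c by (metis less_imp_le)
    show "dist (mat_powr A r) (mat_powr B r) \<le> \<bar>r\<bar> * c powr (r - 1) * dist A B"
      unfolding dist_norm
      by (rule norm_function_diff_le[OF u mat_powr_eigbasis[OF u] v mat_powr_eigbasis[OF v]])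
        (auto intro!: powr_Lipschitz loewner_le_eigenvalue[OF A u] loewner_le_eigenvalue[OF B v] c r)
  qed simp
qed

section \<open>Measurability of matrix operations\<close>

lemma bounded_bilinear_matrix_mult:
  "bounded_bilinear ((**) :: real^'n^'m \<Rightarrow> real^'k^'n \<Rightarrow> real^'k^'m)"
proof -
  have "bilinear ((**) :: real^'n^'m \<Rightarrow> real^'k^'n \<Rightarrow> real^'k^'m)"
    unfolding bilinear_def linear_iff
    by (simp add: vec_eq_iff matrix_matrix_mult_def distrib_left distrib_right sum.distrib
        sum_distrib_left mult_ac)
  then show ?thesis by (simp add: bilinear_conv_bounded_bilinear)
qed

lemmas continuous_on_matrix_mult [continuous_intros] =
  bounded_bilinear.continuous_on[OF bounded_bilinear_matrix_mult]

lemma linear_transpose: "linear (transpose :: real^'n^'m \<Rightarrow> real^'m^'n)"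
  by (simp add: linear_iff vec_eq_iff transpose_def)

lemma continuous_on_transpose [continuous_intros]:
  fixes f :: "_ \<Rightarrow> real^'n^'m"
  shows "continuous_on S f \<Longrightarrow> continuous_on S (\<lambda>x. transpose (f x))"
  using linear_transpose[unfolded linear_conv_bounded_linear] by (rule bounded_linear.continuous_on)

lemma borel_measurable_matrix_mult:
  fixes A :: "'a \<Rightarrow> real^'n^'m" and B :: "'a \<Rightarrow> real^'k^'n"
  assumes "A \<in> borel_measurable F" "B \<in> borel_measurable F"
  shows "(\<lambda>x. A x ** B x) \<in> borel_measurable F"
  by (rule borel_measurable_continuous_Pair[OF assms]) (intro continuous_intros)

lemma borel_measurable_transpose:
  fixes A :: "'a \<Rightarrow> real^'n^'m"
  assumes "A \<in> borel_measurable F"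
  shows "(\<lambda>x. transpose (A x)) \<in> borel_measurable F"
  by (rule borel_measurable_continuous_on[OF _ assms]) (intro continuous_intros)

lemma borel_measurable_mat_powr:
  fixes A :: "'a \<Rightarrow> real^'n^'n"
  assumes "A \<in> borel_measurable F" and c: "0 < c" "r \<le> 1" "\<And>x. c *\<^sub>R mat 1 \<preceq>\<^sub>L A x"
  shows "(\<lambda>x. mat_powr (A x) r) \<in> borel_measurable F"
proof -
  let ?S = "{A :: real^'n^'n. c *\<^sub>R mat 1 \<preceq>\<^sub>L A}"
  have "A \<in> measurable F (restrict_space borel ?S)"
    by (rule measurable_restrict_space2) (use assms in auto)
  from measurable_compose[OF this borel_measurable_continuous_on_restrict[OF continuous_on_mat_powr[OF c(1,2)]]]
  show ?thesis .
qed

lemma loewner_le_add_scaleR: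
  assumes "pos_semidef A"
  shows "c *\<^sub>R mat 1 \<preceq>\<^sub>L A + c *\<^sub>R mat 1"
  using assms by (simp add: loewner_le_def)

lemma eigbasis_add_scaleR:
  assumes "eigbasis A u d"
  shows "eigbasis (A + c *\<^sub>R mat 1) u (\<lambda>i. d i + c)"
  using assms by (simp add: eigbasis_def matrix_vector_mult_add_rdistrib scaleR_matrix_vector_assoc[symmetric]
      scaleR_add_left)

text \<open>Continuity of \<open>mat_powr\<close> is available only away from singular matrices, so
  the trace is taken as a pointwise limit over positive shifts.\<close>

lemma borel_measurable_trpow:
  fixes A :: "'a \<Rightarrow> real^'n^'n"
  assumes A: "A \<in> borel_measurable F" "\<And>x. pos_semidef (A x)" and s: "0 < s" "s \<le> 1"
  shows "(\<lambda>x. trpow (A x) s) \<in> borel_measurable F"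
proof (rule borel_measurable_LIMSEQ_real)
  define \<delta> where "\<delta> i = 1 / real (Suc i)" for i
  have \<delta>: "0 < \<delta> i" "\<delta> \<longlonglongrightarrow> 0" for i
    unfolding \<delta>_def using LIMSEQ_inverse_real_of_nat by (simp_all add: inverse_eq_divide)
  show "(\<lambda>x. trpow (A x + \<delta> i *\<^sub>R mat 1) s) \<in> borel_measurable F" for i
  proof -
    have "(\<lambda>x. mat_powr (A x + \<delta> i *\<^sub>R mat 1) s) \<in> borel_measurable F"
      by (rule borel_measurable_mat_powr[where c = "\<delta> i"])
        (use A \<delta>(1) s in \<open>auto intro: loewner_le_add_scaleR\<close>)
    moreover have "continuous_on UNIV (trace :: real^'n^'n \<Rightarrow> real)"
      unfolding trace_def by (intro continuous_intros)
    ultimately show ?thesis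
      unfolding trpow_def by (rule borel_measurable_continuous_on[rotated])
  qed
  show "(\<lambda>i. trpow (A x + \<delta> i *\<^sub>R mat 1) s) \<longlonglongrightarrow> trpow (A x) s" for x
  proof -
    obtain u d where u: "eigbasis (A x) u d" "\<And>i. 0 \<le> d i"
      using pos_semidef_eigbasis[OF A(2)] by blast
    have "(\<lambda>k. (d i + \<delta> k) powr s) \<longlonglongrightarrow> (d i + 0) powr s" for i
      by (intro tendsto_powr' tendsto_intros \<delta>(2)) (use u(2) \<delta>(1) s in \<open>auto simp: less_imp_le\<close>)
    then show ?thesis
      unfolding trpow_eigbasis[OF u(1)] trpow_eigbasis[OF eigbasis_add_scaleR[OF u(1)]]
      by (intro tendsto_sum) simp
  qed
qed

section \<open>The preconditioners\<close>

lemma pos_semidef_scaleR: "pos_semidef A \<Longrightarrow> 0 \<le> c \<Longrightarrow> pos_semidef (c *\<^sub>R A)"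
  unfolding pos_semidef_def by (simp add: scaleR_matrix_vector_assoc[symmetric] vec_eq_iff transpose_def)

lemma pos_semidef_0: "pos_semidef 0"
  by (simp add: pos_semidef_def vec_eq_iff transpose_def)

lemma pos_semidef_sum: "(\<And>j. j \<in> J \<Longrightarrow> pos_semidef (A j)) \<Longrightarrow> pos_semidef (\<Sum>j\<in>J. A j)"
  by (induction J rule: infinite_finite_induct) (auto simp: pos_semidef_0 pos_semidef_add)

lemma shampoo_L_sum:
  "shampoo_L \<beta> g k = (\<Sum>j\<in>{1..k}. ((1 - \<beta>) * \<beta> ^ (k - j)) *\<^sub>R (g j ** transpose (g j)))"
proof (induction k)
  case (Suc k)
  have "\<beta> *\<^sub>R shampoo_L \<beta> g k
      = (\<Sum>j\<in>{1..k}. ((1 - \<beta>) * \<beta> ^ (Suc k - j)) *\<^sub>R (g j ** transpose (g j)))"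
    unfolding Suc.IH scaleR_sum_right by (intro sum.cong refl) (simp add: Suc_diff_le mult_ac)
  then show ?case by simp
qed simp

text \<open>Lets every bound for the left preconditioner serve for the right one, applied to
  transposed gradients.\<close>

lemma shampoo_R_eq: "shampoo_R \<beta> g k = shampoo_L \<beta> (\<lambda>j. transpose (g j)) k"
  by (induction k) simp_all

lemma shampoo_R_eps_eq: "shampoo_R_eps \<beta> \<epsilon> g k = shampoo_L_eps \<beta> \<epsilon> (\<lambda>j. transpose (g j)) k"
  by (simp add: shampoo_R_eps_def shampoo_L_eps_def shampoo_R_eq)

lemma pos_semidef_shampoo_L: "0 \<le> \<beta> \<Longrightarrow> \<beta> \<le> 1 \<Longrightarrow> pos_semidef (shampoo_L \<beta> g k)"
  unfolding shampoo_L_sum by (intro pos_semidef_sum pos_semidef_scaleR pos_semidef_mult_transpose) auto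

lemma shampoo_L_eps_ge: "0 \<le> \<beta> \<Longrightarrow> \<beta> \<le> 1 \<Longrightarrow> \<epsilon> *\<^sub>R mat 1 \<preceq>\<^sub>L shampoo_L_eps \<beta> \<epsilon> g k"
  unfolding shampoo_L_eps_def by (intro loewner_le_add_scaleR pos_semidef_shampoo_L)

lemma shampoo_R_eps_ge: "0 \<le> \<beta> \<Longrightarrow> \<beta> \<le> 1 \<Longrightarrow> \<epsilon> *\<^sub>R mat 1 \<preceq>\<^sub>L shampoo_R_eps \<beta> \<epsilon> g k"
  unfolding shampoo_R_eps_eq by (rule shampoo_L_eps_ge)

text \<open>The summand \<open>c *\<^sub>R mat 1\<close> is split off first, so that every partial
  sum has the positive lower bound demanded by \<open>trpow_add_le\<close>.\<close>

lemma trpow_sum_le: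
  fixes C :: "real^'n^'n"
  assumes "finite J" and A: "\<And>j. j \<in> J \<Longrightarrow> pos_semidef (A j)"
    and C: "pos_semidef C" "0 < c" and s: "0 < s" "s \<le> 1"
  shows "trpow ((C + c *\<^sub>R mat 1) + (\<Sum>j\<in>J. A j)) s \<le> trpow (C + c *\<^sub>R mat 1) s + (\<Sum>j\<in>J. trpow (A j) s)"
  using assms(1,2)
proof (induction J)
  case (insert j J)
  let ?S = "(C + c *\<^sub>R mat 1) + (\<Sum>j\<in>J. A j)"
  have psd: "pos_semidef (C + (\<Sum>j\<in>J. A j))" "pos_semidef (A j)"
    using insert.prems by (auto intro!: pos_semidef_add C(1) pos_semidef_sum)
  have eq: "?S = (C + (\<Sum>j\<in>J. A j)) + c *\<^sub>R mat 1" by simp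
  have "trpow (?S + A j) s \<le> trpow ?S s + trpow (A j) s"
  proof (rule trpow_add_le[OF _ psd(2) _ C(2) s])
    show "pos_semidef ?S"
      unfolding eq using loewner_le_pos_semidef[OF loewner_le_add_scaleR[OF psd(1)]] C(2) by simp
    have "c *\<^sub>R mat 1 \<preceq>\<^sub>L (C + (\<Sum>j\<in>J. A j) + A j) + c *\<^sub>R mat 1"
      by (intro loewner_le_add_scaleR pos_semidef_add psd)
    then show "c *\<^sub>R mat 1 \<preceq>\<^sub>L ?S + A j" by (simp add: algebra_simps)
  qed
  moreover have "trpow ?S s \<le> trpow (C + c *\<^sub>R mat 1) s + (\<Sum>j\<in>J. trpow (A j) s)"
    using insert by simp
  ultimately show ?case using insert.hyps by (simp add: algebra_simps)
qed simp

lemma trace_scaleR: "trace (c *\<^sub>R A :: real^'n^'n) = c * trace A"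
  by (simp add: trace_def sum_distrib_left)

lemma trace_sum: "trace (\<Sum>j\<in>J. A j :: real^'n^'n) = (\<Sum>j\<in>J. trace (A j))"
  unfolding trace_def by (simp add: sum_component sum.swap[of _ UNIV])

text \<open>A parallelogram identity; its right-hand side is positive semidefinite, which separates
  gradient and noise at the price of a factor 2.\<close>

lemma mult_transpose_add:
  fixes D N :: "real^'n^'m"
  shows "2 *\<^sub>R (D ** transpose D) + 2 *\<^sub>R (N ** transpose N) - (D + N) ** transpose (D + N)
    = (D - N) ** transpose (D - N)"
proof -
  note bb = bounded_bilinear_matrix_mult
  have "transpose (D + N) = transpose D + transpose N" "transpose (D - N) = transpose D - transpose N"
    by (simp_all add: vec_eq_iff transpose_def)
  then show ?thesis
    by (simp add: bounded_bilinear.add_left[OF bb] bounded_bilinear.add_right[OF bb]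
        bounded_bilinear.diff_left[OF bb] bounded_bilinear.diff_right[OF bb] scaleR_2)
qed

text \<open>The two parts are treated differently. Noise and regularisation stay together under one
  trace, which needs only second moments; the gradient part is split by subadditivity, so that the
  target quantity itself reappears.\<close>

lemma trpow_shampoo_L_eps_le:
  fixes D N :: "nat \<Rightarrow> real^'n^'m"
  assumes \<beta>: "0 \<le> \<beta>" "\<beta> \<le> 1" and \<epsilon>: "0 < \<epsilon>" and s: "0 < s" "s \<le> 1"
    and g: "\<And>j. j \<in> {1..k} \<Longrightarrow> g j = D j + N j"
  shows "trpow (shampoo_L_eps \<beta> \<epsilon> g k) s
    \<le> real CARD('m) powr (1 - s)
        * (real CARD('m) * \<epsilon> + 2 * (\<Sum>j\<in>{1..k}. (1 - \<beta>) * \<beta> ^ (k - j) * (norm (N j))\<^sup>2)) powr s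
      + (\<Sum>j\<in>{1..k}. (2 * ((1 - \<beta>) * \<beta> ^ (k - j))) powr s * trpow (transpose (D j) ** D j) s)"
proof -
  define w where "w j = (1 - \<beta>) * \<beta> ^ (k - j)" for j
  have w0: "0 \<le> w j" for j using \<beta> by (simp add: w_def)
  define B where "B = (\<Sum>j\<in>{1..k}. (2 * w j) *\<^sub>R (N j ** transpose (N j)))"
  define E where "E = (\<Sum>j\<in>{1..k}. (2 * w j) *\<^sub>R (D j ** transpose (D j)))"
  have psd: "pos_semidef B" unfolding B_def
    by (intro pos_semidef_sum pos_semidef_scaleR pos_semidef_mult_transpose) (simp add: w0)
  have psd': "pos_semidef (B + \<epsilon> *\<^sub>R mat 1)"
    using loewner_le_pos_semidef[OF loewner_le_add_scaleR[OF psd]] \<epsilon> by simp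
  have eq: "(B + \<epsilon> *\<^sub>R mat 1) + E - shampoo_L_eps \<beta> \<epsilon> g k
      = (\<Sum>j\<in>{1..k}. w j *\<^sub>R ((D j - N j) ** transpose (D j - N j)))"
  proof -
    have "(B + \<epsilon> *\<^sub>R mat 1) + E - shampoo_L_eps \<beta> \<epsilon> g k
        = (\<Sum>j\<in>{1..k}. (2 * w j) *\<^sub>R (D j ** transpose (D j)) + (2 * w j) *\<^sub>R (N j ** transpose (N j))
            - w j *\<^sub>R (g j ** transpose (g j)))"
      unfolding B_def E_def shampoo_L_eps_def shampoo_L_sum w_def[symmetric]
      by (simp add: sum.distrib sum_subtractf)
    also have "\<dots> = (\<Sum>j\<in>{1..k}. w j *\<^sub>R ((D j - N j) ** transpose (D j - N j)))"
      by (intro sum.cong refl)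
        (simp add: g mult_transpose_add[symmetric] scaleR_diff_right scaleR_add_right mult.commute)
    finally show ?thesis .
  qed
  have "trpow (shampoo_L_eps \<beta> \<epsilon> g k) s \<le> trpow ((B + \<epsilon> *\<^sub>R mat 1) + E) s"
  proof (rule trpow_mono)
    show "pos_semidef (shampoo_L_eps \<beta> \<epsilon> g k)"
      using loewner_le_pos_semidef[OF shampoo_L_eps_ge[OF \<beta>, of \<epsilon> g k]] \<epsilon> by simp
    show "shampoo_L_eps \<beta> \<epsilon> g k \<preceq>\<^sub>L (B + \<epsilon> *\<^sub>R mat 1) + E"
      unfolding loewner_le_def eq
      by (intro pos_semidef_sum pos_semidef_scaleR pos_semidef_mult_transpose w0)
  qed (use s in auto)
  also have "\<dots> \<le> trpow (B + \<epsilon> *\<^sub>R mat 1) s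
      + (\<Sum>j\<in>{1..k}. trpow ((2 * w j) *\<^sub>R (D j ** transpose (D j))) s)"
    unfolding E_def
    by (rule trpow_sum_le[OF _ _ psd \<epsilon> s])
      (auto intro!: pos_semidef_scaleR pos_semidef_mult_transpose simp: w0)
  also have "(\<Sum>j\<in>{1..k}. trpow ((2 * w j) *\<^sub>R (D j ** transpose (D j))) s)
      = (\<Sum>j\<in>{1..k}. (2 * w j) powr s * trpow (transpose (D j) ** D j) s)"
    by (intro sum.cong refl)
      (simp add: trpow_scaleR pos_semidef_mult_transpose w0 trpow_transpose_mult[OF s(1)])
  also have "trpow (B + \<epsilon> *\<^sub>R mat 1) s \<le> real CARD('m) powr (1 - s) * trace (B + \<epsilon> *\<^sub>R mat 1) powr s"
    by (rule trpow_le_trace[OF psd']) (use s in auto)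
  also have "trace (B + \<epsilon> *\<^sub>R mat 1)
      = real CARD('m) * \<epsilon> + 2 * (\<Sum>j\<in>{1..k}. w j * (norm (N j))\<^sup>2)"
    by (simp add: trace_add B_def trace_sum trace_scaleR trace_mult_transpose trace_I sum_distrib_left
        mult_ac)
  finally show ?thesis by (simp add: w_def)
qed

section \<open>Descent along one trajectory\<close>

lemma descent_lemma:
  fixes f :: "'v::real_inner \<Rightarrow> real"
  assumes grad: "\<And>Y. GDERIV f Y :> gradf Y"
    and smooth: "\<And>Y Z. norm (gradf Z - gradf Y) \<le> L * norm (Z - Y)"
  shows "f Z \<le> f Y + gradf Y \<bullet> (Z - Y) + L / 2 * (norm (Z - Y))\<^sup>2"
proof -
  define v where "v = Z - Y"
  \<comment> \<open>The excess of \<open>f\<close> over the quadratic model along the segment; the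
    Lipschitz bound makes its derivative nonpositive.\<close>
  define \<phi> where "\<phi> t = f (Y + t *\<^sub>R v) - t * (gradf Y \<bullet> v) - L / 2 * t\<^sup>2 * (norm v)\<^sup>2" for t
  have "\<phi> 1 \<le> \<phi> 0"
  proof (rule DERIV_nonpos_imp_nonincreasing[where f = \<phi> and a = 0 and b = 1])
    fix t :: real assume t: "0 \<le> t" "t \<le> 1"
    have "(f has_derivative (\<lambda>h. h \<bullet> gradf (Y + t *\<^sub>R v))) (at (Y + t *\<^sub>R v))"
      using grad[of "Y + t *\<^sub>R v"] by (simp add: gderiv_def)
    moreover have "((\<lambda>t. Y + t *\<^sub>R v) has_derivative (\<lambda>h. h *\<^sub>R v)) (at t)"
      by (auto intro!: derivative_eq_intros)
    ultimately have "((\<lambda>t. f (Y + t *\<^sub>R v)) has_derivative (\<lambda>h. (h *\<^sub>R v) \<bullet> gradf (Y + t *\<^sub>R v))) (at t)"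
      by (rule has_derivative_compose[rotated])
    then have "((\<lambda>t. f (Y + t *\<^sub>R v)) has_real_derivative (v \<bullet> gradf (Y + t *\<^sub>R v))) (at t)"
      unfolding has_field_derivative_def by (simp add: mult_commute_abs)
    then have d: "(\<phi> has_real_derivative
        (v \<bullet> gradf (Y + t *\<^sub>R v) - gradf Y \<bullet> v - L * t * (norm v)\<^sup>2)) (at t)"
      unfolding \<phi>_def by (auto intro!: derivative_eq_intros)
    have "v \<bullet> gradf (Y + t *\<^sub>R v) - gradf Y \<bullet> v = v \<bullet> (gradf (Y + t *\<^sub>R v) - gradf Y)"
      by (simp add: inner_diff_right inner_commute)
    also have "\<dots> \<le> norm v * norm (gradf (Y + t *\<^sub>R v) - gradf Y)" by (rule norm_cauchy_schwarz)
    also have "\<dots> \<le> norm v * (L * norm (Y + t *\<^sub>R v - Y))" by (intro mult_left_mono smooth) simp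
    also have "\<dots> = L * t * (norm v)\<^sup>2" using t by (simp add: power2_eq_square)
    finally show "\<exists>y. (\<phi> has_real_derivative y) (at t) \<and> y \<le> 0" using d by force
  qed simp
  then show ?thesis by (simp add: \<phi>_def v_def)
qed

text \<open>A gradient step of length \<open>1 / L\<close> still ends above \<open>fstar\<close>.
  This controls the momentum error of the first iterate.\<close>

lemma norm_gradient_sq_le:
  fixes f :: "'v::real_inner \<Rightarrow> real"
  assumes grad: "\<And>Y. GDERIV f Y :> gradf Y"
    and smooth: "\<And>Y Z. norm (gradf Z - gradf Y) \<le> L * norm (Z - Y)"
    and lower: "\<And>Y. fstar \<le> f Y" and L: "0 < L"
  shows "(norm (gradf Y))\<^sup>2 \<le> 2 * L * (f Y - fstar)"
proof -
  define Z where "Z = Y - (1 / L) *\<^sub>R gradf Y"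
  have "fstar \<le> f Y + gradf Y \<bullet> (Z - Y) + L / 2 * (norm (Z - Y))\<^sup>2"
    using lower[of Z] descent_lemma[OF grad smooth, of Z Y] by linarith
  also have "\<dots> = f Y - (norm (gradf Y))\<^sup>2 / (2 * L)"
    using L by (simp add: Z_def dot_square_norm power_divide power2_eq_square field_simps)
  finally show ?thesis using L by (simp add: field_simps)
qed

text \<open>With half of each preconditioner on either factor, gradient times direction becomes
  \<open>a \<bullet> b\<close>, which polarisation splits into squares. Since
  \<open>C * (norm D)^2 \<le> (norm b)^2\<close> and \<open>L * \<eta> \<le> C / 2\<close>, half of
  the gain from \<open>b\<close> absorbs the smoothness term and the other half survives as the
  negative step-length term.\<close>

lemma preconditioned_descent_step:
  fixes f :: "real^'n^'m \<Rightarrow> real" and P :: "real^'m^'m" and Q :: "real^'n^'n"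
  assumes grad: "\<And>Y. GDERIV f Y :> gradf Y"
    and smooth: "\<And>Y Z. norm (gradf Z - gradf Y) \<le> L * norm (Z - Y)"
    and P: "c *\<^sub>R mat 1 \<preceq>\<^sub>L P" and Q: "c *\<^sub>R mat 1 \<preceq>\<^sub>L Q" and c: "0 < c"
    and k: "0 \<le> k1" "0 \<le> k2" "k1 + k2 = r" and \<eta>: "0 < \<eta>" "L * \<eta> \<le> c powr r / 2"
    and Y: "Y = X - \<eta> *\<^sub>R (mat_powr P (- k1) ** M ** mat_powr Q (- k2))"
  shows "f Y \<le> f X - \<eta> / 2 * (norm (mat_powr P (- k1 / 2) ** gradf X ** mat_powr Q (- k2 / 2)))\<^sup>2
    - c powr r / (4 * \<eta>) * (norm (Y - X))\<^sup>2 + \<eta> / (2 * c powr r) * (norm (gradf X - M))\<^sup>2"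
proof -
  have sym: "transpose P = P" "transpose Q = Q"
    using loewner_le_pos_semidef[OF P] loewner_le_pos_semidef[OF Q] c by (auto simp: pos_semidef_def)
  define p q where "p = mat_powr P (- (k1 / 2))" and "q = mat_powr Q (- (k2 / 2))"
  have pp: "mat_powr P (- k1) = p ** p" and qq: "mat_powr Q (- k2) = q ** q"
    unfolding p_def q_def by (simp_all add: mat_powr_add sym)
  have tp: "transpose p = p" and tq: "transpose q = q"
    unfolding p_def q_def by (simp_all add: mat_powr_sym sym)
  define a b D where "a = p ** gradf X ** q" and "b = p ** M ** q" and "D = p ** b ** q"
  define C where "C = c powr r"
  have C: "0 < C" using c by (simp add: C_def)
  have Ysub: "Y - X = - (\<eta> *\<^sub>R D)"
    unfolding Y D_def b_def pp qq by (simp add: matrix_mul_assoc)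
  have inner: "gradf X \<bullet> D = a \<bullet> b"
  proof -
    have "a \<bullet> b = (p ** gradf X) \<bullet> (b ** q)"
      unfolding a_def by (simp add: inner_matrix_mult_right tq)
    also have "\<dots> = gradf X \<bullet> (p ** (b ** q))" by (simp add: inner_matrix_mult_left tp)
    finally show ?thesis by (simp add: D_def matrix_mul_assoc)
  qed
  have sq: "C * (norm (p ** V ** q))\<^sup>2 \<le> (norm V)\<^sup>2" for V :: "real^'n^'m"
  proof -
    have "norm (p ** V ** q) \<le> c powr (- (k1 / 2 + k2 / 2)) * norm V"
      unfolding p_def q_def by (rule norm_two_sided_le[OF P Q c]) (use k in auto)
    then have "(norm (p ** V ** q))\<^sup>2 \<le> (c powr (- (k1 / 2 + k2 / 2)) * norm V)\<^sup>2"
      by (rule power_mono) simp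
    also have "\<dots> = c powr (- r) * (norm V)\<^sup>2"
      by (simp add: power_mult_distrib power2_eq_square[of "c powr _"] k(3)[symmetric]
          add_divide_distrib[symmetric] flip: powr_add)
    finally have "C * (norm (p ** V ** q))\<^sup>2 \<le> C * (c powr (- r) * (norm V)\<^sup>2)"
      using C by simp
    then show ?thesis using c by (simp add: C_def mult.assoc[symmetric] flip: powr_add)
  qed
  have "a - b = p ** (gradf X - M) ** q"
    unfolding a_def b_def using bounded_bilinear_matrix_mult
    by (simp add: bounded_bilinear.diff_left[OF bounded_bilinear_matrix_mult]
        bounded_bilinear.diff_right[OF bounded_bilinear_matrix_mult])
  then have ab: "C * (norm (a - b))\<^sup>2 \<le> (norm (gradf X - M))\<^sup>2" using sq by simp
  have Db: "C * (norm D)\<^sup>2 \<le> (norm b)\<^sup>2" unfolding D_def by (rule sq)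
  have two: "2 * (a \<bullet> b) = (norm a)\<^sup>2 + (norm b)\<^sup>2 - (norm (a - b))\<^sup>2"
    by (simp add: power2_norm_eq_inner inner_diff_left inner_diff_right inner_commute)
  have "f Y \<le> f X + gradf X \<bullet> (Y - X) + L / 2 * (norm (Y - X))\<^sup>2"
    by (rule descent_lemma[OF grad smooth])
  also have "\<dots> = f X - \<eta> * (a \<bullet> b) + (L * \<eta>) * (\<eta> / 2 * (norm D)\<^sup>2)"
    using \<eta>(1) unfolding Ysub by (simp add: inner power_mult_distrib power2_eq_square)
  also have "\<dots> \<le> f X - \<eta> * (a \<bullet> b) + (C / 2) * (\<eta> / 2 * (norm D)\<^sup>2)"
    using \<eta> unfolding C_def by (intro add_left_mono mult_right_mono) auto
  also have "\<dots> = f X - \<eta> / 2 * (norm a)\<^sup>2 - \<eta> / 2 * ((norm b)\<^sup>2 - C * (norm D)\<^sup>2)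
      - \<eta> * C / 4 * (norm D)\<^sup>2 + \<eta> / 2 * (norm (a - b))\<^sup>2"
  proof -
    have "a \<bullet> b = ((norm a)\<^sup>2 + (norm b)\<^sup>2 - (norm (a - b))\<^sup>2) / 2" using two by simp
    show ?thesis unfolding \<open>a \<bullet> b = _\<close> by (simp add: field_simps)
  qed
  also have "\<dots> \<le> f X - \<eta> / 2 * (norm a)\<^sup>2 - 0 - \<eta> * C / 4 * (norm D)\<^sup>2
      + \<eta> / 2 * ((norm (gradf X - M))\<^sup>2 / C)"
    using Db ab \<eta>(1) C by (intro add_mono diff_mono mult_left_mono) (auto simp: field_simps)
  also have "\<eta> * C / 4 * (norm D)\<^sup>2 = C / (4 * \<eta>) * (norm (Y - X))\<^sup>2"
    using \<eta>(1) unfolding Ysub by (simp add: power_mult_distrib power2_eq_square)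
  finally show ?thesis by (simp add: a_def p_def q_def C_def)
qed

lemma Young_three:
  fixes x y z :: real
  assumes "0 \<le> x" "0 \<le> y" "0 \<le> z" and k: "0 \<le> a" "0 \<le> b" "0 \<le> c" "a + b + c = 1"
  shows "x powr a * y powr b * z powr c \<le> a * x + b * y + c * z"
proof (cases "x = 0 \<or> y = 0 \<or> z = 0")
  case False
  then have pos: "0 < x" "0 < y" "0 < z" using assms by auto
  define P where "P = x powr a * y powr b * z powr c"
  have P: "0 < P" using pos by (simp add: P_def)
  have lnP: "ln P = a * ln x + b * ln y + c * ln z"
    using pos by (simp add: P_def ln_mult ln_powr)
  have le: "t * (ln v - ln P) \<le> t * (v / P - 1)" if "0 < v" "0 \<le> t" for t v
    using ln_le_minus_one[of "v / P"] that P by (intro mult_left_mono) (auto simp: ln_div)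
  have "0 = a * (ln x - ln P) + b * (ln y - ln P) + c * (ln z - ln P)"
  proof -
    have "a * (ln x - ln P) + b * (ln y - ln P) + c * (ln z - ln P)
      = (a * ln x + b * ln y + c * ln z) - (a + b + c) * ln P" by (simp add: algebra_simps)
    then show ?thesis using k(4) lnP by simp
  qed
  also have "\<dots> \<le> a * (x / P - 1) + b * (y / P - 1) + c * (z / P - 1)"
    by (intro add_mono le pos k)
  also have "\<dots> = (a * x + b * y + c * z) / P - (a + b + c)"
    by (simp add: algebra_simps add_divide_distrib)
  finally have "1 \<le> (a * x + b * y + c * z) / P" using k(4) by simp
  then show ?thesis using P by (simp add: P_def[symmetric])
qed (use assms in auto)

lemma mat_powr_cancel:
  assumes P: "c *\<^sub>R mat 1 \<preceq>\<^sub>L P" and c: "0 < c"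
  shows "mat_powr P k ** mat_powr P (- k) = mat 1" "mat_powr P (- k) ** mat_powr P k = mat 1"
proof -
  have "transpose P = P" using loewner_le_pos_semidef[OF P] c by (auto simp: pos_semidef_def)
  then show "mat_powr P k ** mat_powr P (- k) = mat 1" "mat_powr P (- k) ** mat_powr P k = mat 1"
    by (simp_all add: mat_powr_add mat_powr_0[OF P c])
qed

text \<open>\<open>trpow_Hoelder_two_sided\<close> followed by weighted Young. The result is affine
  in \<open>q\<close> and in the squared norm, and sharp at \<open>q = T\<close> with squared norm
  \<open>Z\<close>.\<close>

lemma trpow_le_linearised:
  fixes A :: "real^'n^'m" and P :: "real^'m^'m" and Q :: "real^'n^'n"
  assumes P: "c *\<^sub>R mat 1 \<preceq>\<^sub>L P" and Q: "c *\<^sub>R mat 1 \<preceq>\<^sub>L Q" and c: "0 < c"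
    and k: "0 \<le> k1" "0 \<le> k2" "k1 + k2 = 1 - s" and s: "0 < s"
    and q: "trpow P s \<le> q" "trpow Q s \<le> q" and TZ: "0 < T" "0 < Z"
  shows "trpow (transpose A ** A) s \<le> T powr (1 - s) * Z powr s
    * ((1 - s) / T * q + s / Z * (norm (mat_powr P (- k1 / 2) ** A ** mat_powr Q (- k2 / 2)))\<^sup>2)"
proof -
  define B where "B = mat_powr P (- k1 / 2) ** A ** mat_powr Q (- k2 / 2)"
  have PQ: "pos_semidef P" "pos_semidef Q"
    using loewner_le_pos_semidef[OF P] loewner_le_pos_semidef[OF Q] c by auto
  have "mat_powr P (k1 / 2) ** B ** mat_powr Q (k2 / 2)
      = (mat_powr P (k1 / 2) ** mat_powr P (- (k1 / 2))) ** A ** (mat_powr Q (- (k2 / 2)) ** mat_powr Q (k2 / 2))"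
    by (simp add: B_def matrix_mul_assoc)
  then have A: "A = mat_powr P (k1 / 2) ** B ** mat_powr Q (k2 / 2)"
    by (simp add: mat_powr_cancel[OF P c] mat_powr_cancel[OF Q c])
  have "trpow (transpose A ** A) s \<le> trpow P s powr k1 * trpow Q s powr k2 * ((norm B)\<^sup>2) powr s"
    by (rule trpow_Hoelder_two_sided[OF P Q c k s A])
  also have "\<dots> = T powr (1 - s) * Z powr s
      * ((trpow P s / T) powr k1 * (trpow Q s / T) powr k2 * ((norm B)\<^sup>2 / Z) powr s)"
    using TZ trpow_nonneg[OF PQ(1)] trpow_nonneg[OF PQ(2)]
    by (simp add: powr_divide k(3)[symmetric] powr_add)
  also have "\<dots> \<le> T powr (1 - s) * Z powr s
      * (k1 * (trpow P s / T) + k2 * (trpow Q s / T) + s * ((norm B)\<^sup>2 / Z))"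
    using TZ trpow_nonneg[OF PQ(1)] trpow_nonneg[OF PQ(2)] k s
    by (intro mult_left_mono Young_three) auto
  also have "\<dots> \<le> T powr (1 - s) * Z powr s
      * (k1 * (q / T) + k2 * (q / T) + s * ((norm B)\<^sup>2 / Z))"
    using q TZ k s by (intro mult_left_mono add_mono divide_right_mono order_refl) auto
  also have "k1 * (q / T) + k2 * (q / T) + s * ((norm B)\<^sup>2 / Z) = (1 - s) / T * q + s / Z * (norm B)\<^sup>2"
    unfolding k(3)[symmetric] by (simp add: algebra_simps add_divide_distrib)
  finally show ?thesis by (simp add: B_def)
qed

text \<open>A deterministic statement, to be applied sample by sample. The majorant \<open>q\<close>
  stands in for the traces of the preconditioners so that an integrable expression can be
  inserted.\<close>

lemma shampoo_trajectory_bound: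
  fixes f :: "real^'n^'m \<Rightarrow> real" and P :: "nat \<Rightarrow> real^'m^'m" and Q :: "nat \<Rightarrow> real^'n^'n"
  assumes grad: "\<And>Y. GDERIV f Y :> gradf Y"
    and smooth: "\<And>Y Z. norm (gradf Z - gradf Y) \<le> L * norm (Z - Y)"
    and lower: "\<And>Y. fstar \<le> f Y"
    and P: "\<And>k. k \<in> {1..K} \<Longrightarrow> c *\<^sub>R mat 1 \<preceq>\<^sub>L P k"
    and Q: "\<And>k. k \<in> {1..K} \<Longrightarrow> c *\<^sub>R mat 1 \<preceq>\<^sub>L Q k" and c: "0 < c"
    and k: "0 \<le> k1" "0 \<le> k2" "k1 + k2 = 1 - s" and s: "0 < s"
    and \<eta>: "0 < \<eta>" "L * \<eta> \<le> c powr (1 - s) / 2"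
    and X: "\<And>k. k \<in> {1..K} \<Longrightarrow>
      X (Suc k) = X k - \<eta> *\<^sub>R (mat_powr (P k) (- k1) ** M k ** mat_powr (Q k) (- k2))"
    and q: "\<And>k. k \<in> {1..K} \<Longrightarrow> trpow (P k) s \<le> q k" "\<And>k. k \<in> {1..K} \<Longrightarrow> trpow (Q k) s \<le> q k"
    and TZ: "0 < T" "0 < Z"
  shows "(\<Sum>k\<in>{1..K}. trpow (transpose (gradf (X k)) ** gradf (X k)) s)
    \<le> T powr (1 - s) * Z powr s * ((1 - s) / T * (\<Sum>k\<in>{1..K}. q k) + s / Z * (2 / \<eta> *
        (f (X 1) - fstar - c powr (1 - s) / (4 * \<eta>) * (\<Sum>k\<in>{1..K}. (norm (X (Suc k) - X k))\<^sup>2)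
          + \<eta> / (2 * c powr (1 - s)) * (\<Sum>k\<in>{1..K}. (norm (M k - gradf (X k)))\<^sup>2))))"
proof -
  define a where "a k = (norm (mat_powr (P k) (- k1 / 2) ** gradf (X k) ** mat_powr (Q k) (- k2 / 2)))\<^sup>2" for k
  have step: "\<eta> / 2 * a k \<le> f (X k) - f (X (Suc k)) - c powr (1 - s) / (4 * \<eta>) * (norm (X (Suc k) - X k))\<^sup>2
      + \<eta> / (2 * c powr (1 - s)) * (norm (M k - gradf (X k)))\<^sup>2" if "k \<in> {1..K}" for k
    using preconditioned_descent_step[OF grad smooth P[OF that] Q[OF that] c k \<eta> X[OF that]]
    by (simp add: a_def norm_minus_commute)
  have tele: "(\<Sum>k\<in>{1..K}. f (X k) - f (X (Suc k))) = f (X 1) - f (X (Suc K))"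
    by (induction K) auto
  have "\<eta> / 2 * (\<Sum>k\<in>{1..K}. a k) \<le> (\<Sum>k\<in>{1..K}. f (X k) - f (X (Suc k))
      - c powr (1 - s) / (4 * \<eta>) * (norm (X (Suc k) - X k))\<^sup>2
      + \<eta> / (2 * c powr (1 - s)) * (norm (M k - gradf (X k)))\<^sup>2)"
    unfolding sum_distrib_left by (rule sum_mono) (rule step)
  also have "\<dots> = f (X 1) - f (X (Suc K))
      - c powr (1 - s) / (4 * \<eta>) * (\<Sum>k\<in>{1..K}. (norm (X (Suc k) - X k))\<^sup>2)
      + \<eta> / (2 * c powr (1 - s)) * (\<Sum>k\<in>{1..K}. (norm (M k - gradf (X k)))\<^sup>2)"
    using tele by (simp add: sum.distrib sum_subtractf sum_distrib_left)
  also have "\<dots> \<le> f (X 1) - fstar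
      - c powr (1 - s) / (4 * \<eta>) * (\<Sum>k\<in>{1..K}. (norm (X (Suc k) - X k))\<^sup>2)
      + \<eta> / (2 * c powr (1 - s)) * (\<Sum>k\<in>{1..K}. (norm (M k - gradf (X k)))\<^sup>2)" (is "_ \<le> ?D")
    using lower[of "X (Suc K)"] by simp
  finally have "\<eta> / 2 * (\<Sum>k\<in>{1..K}. a k) \<le> ?D" .
  then have a_le: "(\<Sum>k\<in>{1..K}. a k) \<le> 2 / \<eta> * ?D" using \<eta>(1) by (simp add: field_simps)
  have "(\<Sum>k\<in>{1..K}. trpow (transpose (gradf (X k)) ** gradf (X k)) s)
      \<le> (\<Sum>k\<in>{1..K}. T powr (1 - s) * Z powr s * ((1 - s) / T * q k + s / Z * a k))"
    unfolding a_def by (intro sum_mono trpow_le_linearised[where c = c] P Q c k s q TZ)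
  also have "\<dots> = T powr (1 - s) * Z powr s * ((1 - s) / T * (\<Sum>k\<in>{1..K}. q k) + s / Z * (\<Sum>k\<in>{1..K}. a k))"
    unfolding sum_distrib_left[symmetric] sum.distrib by (simp only: sum_distrib_left[symmetric])
  also have "\<dots> \<le> T powr (1 - s) * Z powr s * ((1 - s) / T * (\<Sum>k\<in>{1..K}. q k) + s / Z * (2 / \<eta> * ?D))"
    using s TZ by (intro mult_left_mono add_left_mono a_le) auto
  finally show ?thesis .
qed

section \<open>Scalar recursions\<close>

lemma momentum_sum_bound:
  fixes e d :: "nat \<Rightarrow> real"
  assumes \<theta>: "0 \<le> \<theta>" "\<theta> < 1" and K: "1 \<le> K"
    and base: "e 1 \<le> A + B"
    and step: "\<And>k. 1 \<le> k \<Longrightarrow> k < K \<Longrightarrow> e (Suc k) \<le> \<theta> * e k + C * d k + B"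
    and nonneg: "0 \<le> e K" "0 \<le> C" "0 \<le> d K"
  shows "(1 - \<theta>) * (\<Sum>k\<in>{1..K}. e k) \<le> A + real K * B + C * (\<Sum>k\<in>{1..K}. d k)"
proof -
  \<comment> \<open>The term \<open>\<theta> * e n\<close> on the left is exactly what the recursion
    consumes at the next step. The increments \<open>d\<close> run only to \<open>n - 1\<close>; the
    last one is added afterwards by nonnegativity.\<close>
  have "1 \<le> n \<Longrightarrow> n \<le> K \<Longrightarrow>
      (1 - \<theta>) * (\<Sum>k\<in>{1..n}. e k) + \<theta> * e n \<le> A + real n * B + C * (\<Sum>k\<in>{1..<n}. d k)" for n
  proof (induction n rule: nat_induct_at_least)
    case base
    then show ?case using assms(4) by (simp add: algebra_simps)
  next
    case (Suc n)
    then have IH: "(1 - \<theta>) * (\<Sum>k\<in>{1..n}. e k) + \<theta> * e n \<le> A + real n * B + C * (\<Sum>k\<in>{1..<n}. d k)"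
      by simp
    have "e (Suc n) \<le> \<theta> * e n + C * d n + B" using Suc by (intro step) auto
    moreover have "(\<Sum>k\<in>{1..<Suc n}. d k) = (\<Sum>k\<in>{1..<n}. d k) + d n" using Suc by simp
    ultimately show ?case using IH by (simp add: algebra_simps)
  qed
  from this[OF K order_refl]
  have "(1 - \<theta>) * (\<Sum>k\<in>{1..K}. e k) + \<theta> * e K \<le> A + real K * B + C * (\<Sum>k\<in>{1..<K}. d k)" .
  moreover have "(\<Sum>k\<in>{1..K}. d k) = (\<Sum>k\<in>{1..<K}. d k) + d K"
    using K by (simp add: sum.last_plus add.commute)
  moreover have "0 \<le> \<theta> * e K" "0 \<le> C * d K" using \<theta> nonneg by auto
  ultimately show ?thesis by (simp add: algebra_simps)
qed

text \<open>Young's inequality weighted so that the contraction \<open>\<theta>^2\<close> loosens to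
  \<open>\<theta>\<close>. Keeping the factor \<open>\<theta>^2\<close> on the left covers
  \<open>\<theta> = 0\<close>.\<close>

lemma norm_momentum_split:
  fixes x y :: "'v::real_inner"
  assumes \<theta>: "0 \<le> \<theta>" "\<theta> < 1"
  shows "\<theta>\<^sup>2 * (norm (x + y))\<^sup>2 \<le> \<theta> * (norm x)\<^sup>2 + \<theta>\<^sup>2 / (1 - \<theta>) * (norm y)\<^sup>2"
proof -
  define t where "t = 1 - \<theta>"
  have "0 \<le> (norm (t *\<^sub>R x - \<theta> *\<^sub>R y))\<^sup>2" by simp
  also have "\<dots> = t\<^sup>2 * (norm x)\<^sup>2 - 2 * (t * \<theta>) * (x \<bullet> y) + \<theta>\<^sup>2 * (norm y)\<^sup>2"
    unfolding power2_norm_eq_inner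
    by (simp add: inner_diff_left inner_diff_right inner_commute[of y x] power2_eq_square algebra_simps)
  finally have *: "0 \<le> (1 - \<theta>)\<^sup>2 * (norm x)\<^sup>2 - 2 * ((1 - \<theta>) * \<theta>) * (x \<bullet> y) + \<theta>\<^sup>2 * (norm y)\<^sup>2"
    by (simp add: t_def)
  have "(1 - \<theta>) * (\<theta> * (norm (x + y))\<^sup>2) \<le> (1 - \<theta>) * (norm x)\<^sup>2 + \<theta> * (norm y)\<^sup>2"
    using * unfolding power2_norm_eq_inner
    by (simp add: inner_add_left inner_add_right inner_commute[of y x] power2_eq_square algebra_simps)
  then have "\<theta> * (norm (x + y))\<^sup>2 \<le> (norm x)\<^sup>2 + \<theta> / (1 - \<theta>) * (norm y)\<^sup>2"
    using \<theta> by (simp add: field_simps)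
  then have "\<theta> * (\<theta> * (norm (x + y))\<^sup>2) \<le> \<theta> * ((norm x)\<^sup>2 + \<theta> / (1 - \<theta>) * (norm y)\<^sup>2)"
    using \<theta> by (intro mult_left_mono) auto
  then show ?thesis by (simp add: power2_eq_square algebra_simps)
qed

lemma powr_add_le:
  fixes a b r :: real
  assumes "0 < a" "0 \<le> b" "0 \<le> r" "r \<le> 1"
  shows "(a + b) powr r \<le> a powr r + b powr r"
proof (cases "b = 0")
  case False
  then have b: "0 < b" using assms by simp
  have *: "x / (a + b) \<le> (x / (a + b)) powr r" if "0 < x" "x \<le> a + b" for x
    using that assms powr_mono'[of r 1 "x / (a + b)"] by simp
  have "1 = a / (a + b) + b / (a + b)" using assms b by (simp add: add_divide_distrib[symmetric])
  also have "\<dots> \<le> (a / (a + b)) powr r + (b / (a + b)) powr r"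
    using assms b by (intro add_mono *) auto
  also have "\<dots> = (a powr r + b powr r) / (a + b) powr r"
    using assms by (simp add: powr_divide add_divide_distrib)
  finally show ?thesis using assms by (simp add: field_simps)
qed (use assms in simp)

text \<open>\<open>W\<close> is chosen so that the feedback term equals
  \<open>p powr (1 - s) * W powr s\<close>. Young turns it into \<open>(1 - s) * p + s * W\<close>;
  absorbing the first part leaves \<open>s * p\<close> on the left, whence the division by
  \<open>s\<close>.\<close>

lemma self_bounding_solve:
  fixes p T x Z s :: real
  assumes p: "0 \<le> p" "p \<le> (T + x * p) powr (1 - s) * Z powr s"
    and pos: "0 < T" "0 < x" "0 < Z" and s: "0 < s" "s \<le> 1"
  shows "p \<le> T powr (1 - s) * Z powr s / s + x powr ((1 - s) / s) * Z"
proof (cases "p = 0")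
  case False
  then have p0: "0 < p" using p by simp
  define W where "W = x powr ((1 - s) / s) * Z"
  have W: "0 < W" using pos by (simp add: W_def)
  have "(T + x * p) powr (1 - s) * Z powr s \<le> (T powr (1 - s) + (x * p) powr (1 - s)) * Z powr s"
    using pos p0 s by (intro mult_right_mono powr_add_le) auto
  also have "\<dots> = T powr (1 - s) * Z powr s + p powr (1 - s) * W powr s"
  proof -
    have "W powr s = x powr (1 - s) * Z powr s"
      using pos s by (simp add: W_def powr_mult powr_powr)
    then show ?thesis using pos p0 by (simp add: powr_mult ring_distribs mult_ac)
  qed
  also have "\<dots> \<le> T powr (1 - s) * Z powr s + ((1 - s) * p + s * W)"
    using p0 W s by (intro add_left_mono Youngs_inequality_0) auto
  finally have "s * p \<le> T powr (1 - s) * Z powr s + s * W" using p(2) by (simp add: algebra_simps)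
  then show ?thesis using s by (simp add: W_def field_simps)
qed (use pos s in simp)

lemma sum_geometric_weights_le:
  fixes \<beta> :: real
  assumes "0 \<le> \<beta>" "\<beta> < 1"
  shows "(\<Sum>j\<in>{1..k}. (1 - \<beta>) * \<beta> ^ (k - j)) \<le> 1"
proof -
  have "(\<Sum>j\<in>{1..k}. (1 - \<beta>) * \<beta> ^ (k - j)) = 1 - \<beta> ^ k"
  proof (induction k)
    case (Suc k)
    have "(\<Sum>j\<in>{1..k}. (1 - \<beta>) * \<beta> ^ (Suc k - j)) = \<beta> * (\<Sum>j\<in>{1..k}. (1 - \<beta>) * \<beta> ^ (k - j))"
      unfolding sum_distrib_left by (intro sum.cong refl) (simp add: Suc_diff_le)
    then have "(\<Sum>j\<in>{1..Suc k}. (1 - \<beta>) * \<beta> ^ (Suc k - j)) = \<beta> * (1 - \<beta> ^ k) + (1 - \<beta>)"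
      unfolding Suc.IH by simp
    then show ?case by (simp add: algebra_simps)
  qed simp
  then show ?thesis using assms by simp
qed

lemma sum_powr_weights_le:
  fixes \<beta> s :: real and p :: "nat \<Rightarrow> real"
  assumes \<beta>: "0 < \<beta>" "\<beta> < 1" and s: "0 < s" and p: "\<And>j. 0 \<le> p j"
  shows "(\<Sum>k\<in>{1..K}. \<Sum>j\<in>{1..k}. (2 * ((1 - \<beta>) * \<beta> ^ (k - j))) powr s * p j)
    \<le> 2 powr s * ((1 - \<beta>) powr s / (1 - \<beta> powr s)) * (\<Sum>j\<in>{1..K}. p j)"
proof -
  define b where "b = \<beta> powr s"
  have b: "0 < b" "b < 1" unfolding b_def using \<beta> s powr_less_mono2[of s \<beta> 1] by auto
  define W where "W = 2 powr s * (1 - \<beta>) powr s"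
  have W: "0 \<le> W" by (simp add: W_def)
  have eq: "(2 * ((1 - \<beta>) * \<beta> ^ i)) powr s = W * b ^ i" for i
    using \<beta> by (simp add: W_def b_def powr_mult powr_power powr_powr mult.commute flip: powr_realpow)
  define g where "g k = (\<Sum>j\<in>{1..k}. W * b ^ (k - j) * p j)" for k
  \<comment> \<open>An exact identity with a nonnegative remainder, which makes the induction
    close.\<close>
  have "(\<Sum>k\<in>{1..K}. g k)
      + W * b / (1 - b) * (\<Sum>j\<in>{1..K}. b ^ (K - j) * p j) = W / (1 - b) * (\<Sum>j\<in>{1..K}. p j)"
  proof (induction K)
    case (Suc K)
    let ?S = "\<Sum>j\<in>{1..K}. b ^ (K - j) * p j"
    have S: "(\<Sum>j\<in>{1..Suc K}. b ^ (Suc K - j) * p j) = b * ?S + p (Suc K)"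
    proof -
      have "(\<Sum>j\<in>{1..K}. b ^ (Suc K - j) * p j) = b * ?S"
        unfolding sum_distrib_left by (intro sum.cong refl) (simp add: Suc_diff_le)
      then show ?thesis by simp
    qed
    have in1: "g (Suc K) = W * (b * ?S + p (Suc K))"
      unfolding g_def by (subst S[symmetric]) (simp only: sum_distrib_left mult.assoc)
    have key: "W * x + W * b / (1 - b) * x = W / (1 - b) * x" for x
      using b by (simp add: field_simps)
    have "W * (b * ?S + p (Suc K)) + W * b / (1 - b) * (b * ?S + p (Suc K))
        = W * b / (1 - b) * ?S + W / (1 - b) * p (Suc K)"
      unfolding key by (simp add: ring_distribs)
    then show ?case using Suc in1 unfolding S by (simp add: ring_distribs)
  qed simp
  moreover have "0 \<le> W * b / (1 - b) * (\<Sum>j\<in>{1..K}. b ^ (K - j) * p j)"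
    using W b p by (intro mult_nonneg_nonneg divide_nonneg_nonneg sum_nonneg) auto
  ultimately show ?thesis unfolding eq g_def by (simp add: W_def b_def)
qed

section \<open>Square-integrable random matrices\<close>

definition square_integrable :: "'a measure \<Rightarrow> ('a \<Rightarrow> 'v::euclidean_space) \<Rightarrow> bool" where
  "square_integrable M Y \<longleftrightarrow> Y \<in> borel_measurable M \<and> integrable M (\<lambda>x. (norm (Y x))\<^sup>2)"

lemma square_integrableD:
  "square_integrable M Y \<Longrightarrow> Y \<in> borel_measurable M"
  "square_integrable M Y \<Longrightarrow> integrable M (\<lambda>x. (norm (Y x))\<^sup>2)"
  by (auto simp: square_integrable_def)

lemma norm_add_sq_le:
  fixes x y :: "'v::real_inner"
  shows "(norm (x + y))\<^sup>2 \<le> 2 * (norm x)\<^sup>2 + 2 * (norm y)\<^sup>2"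
proof -
  have "0 \<le> (norm (x - y))\<^sup>2" by simp
  then show ?thesis
    by (simp add: power2_norm_eq_inner inner_add_left inner_add_right inner_diff_left inner_diff_right
        inner_commute)
qed

lemma square_integrable_dominated:
  assumes "square_integrable M Z" "Y \<in> borel_measurable M" "\<And>x. norm (Y x) \<le> C * norm (Z x)"
  shows "square_integrable M Y"
  unfolding square_integrable_def
proof
  have "(norm (Y x))\<^sup>2 \<le> C\<^sup>2 * (norm (Z x))\<^sup>2" for x
    using power_mono[OF assms(3)[of x], of 2] by (simp add: power_mult_distrib)
  with assms(2) square_integrableD[OF assms(1)] show "integrable M (\<lambda>x. (norm (Y x))\<^sup>2)"
    by - (rule Bochner_Integration.integrable_bound[of M "\<lambda>x. C\<^sup>2 * (norm (Z x))\<^sup>2"], auto)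
qed fact

lemma square_integrable_scaleR: "square_integrable M Y \<Longrightarrow> square_integrable M (\<lambda>x. c *\<^sub>R Y x)"
  by (auto simp: square_integrable_def power_mult_distrib)

lemma square_integrable_add:
  assumes "square_integrable M Y" "square_integrable M Z"
  shows "square_integrable M (\<lambda>x. Y x + Z x)"
  unfolding square_integrable_def
proof
  show m: "(\<lambda>x. Y x + Z x) \<in> borel_measurable M"
    using assms by (auto simp: square_integrable_def)
  show "integrable M (\<lambda>x. (norm (Y x + Z x))\<^sup>2)"
    by (rule Bochner_Integration.integrable_bound[of M "\<lambda>x. 2 * (norm (Y x))\<^sup>2 + 2 * (norm (Z x))\<^sup>2"])
      (use m square_integrableD(2)[OF assms(1)] square_integrableD(2)[OF assms(2)]
        in \<open>auto intro: norm_add_sq_le\<close>)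
qed

lemma square_integrable_diff:
  assumes "square_integrable M Y" "square_integrable M Z"
  shows "square_integrable M (\<lambda>x. Y x - Z x)"
  using square_integrable_add[OF assms(1) square_integrable_scaleR[OF assms(2), of "-1"]] by simp

lemma (in finite_measure) square_integrable_const: "square_integrable M (\<lambda>x. c)"
  by (simp add: square_integrable_def)

lemma (in finite_measure) square_integrable_Lipschitz:
  fixes g :: "'v::euclidean_space \<Rightarrow> 'w::euclidean_space"
  assumes Y: "square_integrable M Y" and g: "\<And>x y. norm (g x - g y) \<le> L * norm (x - y)"
  shows "square_integrable M (\<lambda>x. g (Y x))"
proof -
  have "norm (g y - g z) \<le> max L 0 * norm (y - z)" for y z
    using g[of y z] by (meson max.cobounded1 mult_right_mono norm_ge_zero order_trans)
  then have "(max L 0)-lipschitz_on UNIV g" by (intro lipschitz_onI) (auto simp: dist_norm)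
  then have "continuous_on UNIV g" by (rule lipschitz_on_continuous_on)
  then have m: "(\<lambda>x. g (Y x)) \<in> borel_measurable M"
    using square_integrableD(1)[OF Y] by (rule borel_measurable_continuous_on)
  then have "square_integrable M (\<lambda>x. g (Y x) - g 0)"
    by (intro square_integrable_dominated[OF Y, where C = L]) (use g[of _ 0] in auto)
  from square_integrable_add[OF this square_integrable_const[of "g 0"]] show ?thesis by simp
qed

lemma square_integrable_inner:
  assumes "square_integrable M Y" "square_integrable M Z"
  shows "integrable M (\<lambda>x. Y x \<bullet> Z x)"
proof (rule Bochner_Integration.integrable_bound)
  show "integrable M (\<lambda>x. (norm (Y x))\<^sup>2 + (norm (Z x))\<^sup>2)"
    using assms by (simp add: square_integrable_def)
  show "(\<lambda>x. Y x \<bullet> Z x) \<in> borel_measurable M"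
    using assms by (auto simp: square_integrable_def)
  have "\<bar>Y x \<bullet> Z x\<bar> \<le> (norm (Y x))\<^sup>2 + (norm (Z x))\<^sup>2" for x
  proof -
    have "\<bar>Y x \<bullet> Z x\<bar> \<le> norm (Y x) * norm (Z x)" by (rule Cauchy_Schwarz_ineq2)
    also have "\<dots> \<le> 2 * norm (Y x) * norm (Z x)" by simp
    also have "\<dots> \<le> (norm (Y x))\<^sup>2 + (norm (Z x))\<^sup>2" by (rule sum_squares_bound)
    finally show ?thesis .
  qed
  then show "AE x in M. norm (Y x \<bullet> Z x) \<le> norm ((norm (Y x))\<^sup>2 + (norm (Z x))\<^sup>2)"
    by simp
qed

lemma borel_measurable_matrix_component:
  fixes Y :: "'a \<Rightarrow> real^'n^'m"
  assumes "Y \<in> borel_measurable F"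
  shows "(\<lambda>x. Y x $ i $ j) \<in> borel_measurable F"
  by (rule borel_measurable_continuous_on[OF _ assms]) (intro continuous_intros)

lemma integrable_matrix_component:
  fixes Y :: "'a \<Rightarrow> real^'n^'m"
  assumes "integrable M Y"
  shows "integrable M (\<lambda>x. Y x $ i $ j)"
  using integrable_bounded_linear[OF bounded_linear_compose[OF bounded_linear_vec_nth bounded_linear_vec_nth] assms]
  by simp

lemma square_integrable_component:
  fixes Y :: "'a \<Rightarrow> real^'n^'m"
  assumes "square_integrable M Y"
  shows "square_integrable M (\<lambda>x. Y x $ i $ j)"
proof (rule square_integrable_dominated[OF assms, where C = 1])
  show "(\<lambda>x. Y x $ i $ j) \<in> borel_measurable M"
    by (intro borel_measurable_matrix_component square_integrableD assms)
  show "norm (Y x $ i $ j) \<le> 1 * norm (Y x)" for x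
  proof -
    have "norm (Y x $ i $ j) \<le> norm (Y x $ i)" by (rule Finite_Cartesian_Product.norm_nth_le)
    also have "\<dots> \<le> norm (Y x)" by (rule Finite_Cartesian_Product.norm_nth_le)
    finally show ?thesis by simp
  qed
qed

text \<open>Noise is orthogonal to the past. The check is entrywise, as is
  \<open>mat_cond_exp\<close>; square integrability makes each product integrable, so
  \<open>H\<close> can be pulled through the conditional expectation.\<close>

lemma (in prob_space) expectation_inner_noise_eq_0:
  fixes H G D :: "'a \<Rightarrow> real^'n^'m"
  assumes F: "subalgebra M F" and H: "H \<in> borel_measurable F" "square_integrable M H"
    and G: "square_integrable M G" and D: "square_integrable M D"
    and ae: "AE x in M. mat_cond_exp M F G x = D x"
  shows "(\<integral>x. H x \<bullet> (G x - D x) \<partial>M) = 0"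
proof -
  interpret F: finite_measure_subalgebra M F
    by (rule finite_measure_subalgebra.intro) (use F finite_measure_axioms in \<open>auto simp: finite_measure_subalgebra_axioms_def\<close>)
  have comp: "(\<integral>x. H x $ i $ j * (G x $ i $ j - D x $ i $ j) \<partial>M) = 0"
    "integrable M (\<lambda>x. H x $ i $ j * (G x $ i $ j - D x $ i $ j))" for i j
  proof -
    note c = square_integrable_component
    have HG: "integrable M (\<lambda>x. H x $ i $ j * G x $ i $ j)"
      using square_integrable_inner[OF c[OF H(2)] c[OF G]] by simp
    have HD: "integrable M (\<lambda>x. H x $ i $ j * D x $ i $ j)"
      using square_integrable_inner[OF c[OF H(2)] c[OF D]] by simp
    show "integrable M (\<lambda>x. H x $ i $ j * (G x $ i $ j - D x $ i $ j))"
      using Bochner_Integration.integrable_diff[OF HG HD] by (simp add: right_diff_distrib)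
    have "(\<integral>x. H x $ i $ j * G x $ i $ j \<partial>M)
        = (\<integral>x. H x $ i $ j * real_cond_exp M F (\<lambda>x. G x $ i $ j) x \<partial>M)"
      by (rule F.real_cond_exp_intg(2)[symmetric, OF HG])
        (intro borel_measurable_matrix_component H square_integrableD G)+
    also have "\<dots> = (\<integral>x. H x $ i $ j * D x $ i $ j \<partial>M)"
    proof (rule integral_cong_AE)
      have "AE x in M. real_cond_exp M F (\<lambda>x. G x $ i $ j) x = D x $ i $ j"
        using ae by eventually_elim (auto simp: mat_cond_exp_def vec_eq_iff)
      then show "AE x in M. H x $ i $ j * real_cond_exp M F (\<lambda>x. G x $ i $ j) x = H x $ i $ j * D x $ i $ j"
        by eventually_elim simp
    qed (intro borel_measurable_times borel_measurable_matrix_component square_integrableD H D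
        borel_measurable_cond_exp2)+
    finally show "(\<integral>x. H x $ i $ j * (G x $ i $ j - D x $ i $ j) \<partial>M) = 0"
      using HG HD by (simp add: right_diff_distrib)
  qed
  have "(\<integral>x. H x \<bullet> (G x - D x) \<partial>M)
      = (\<integral>x. (\<Sum>i\<in>UNIV. \<Sum>j\<in>UNIV. H x $ i $ j * (G x $ i $ j - D x $ i $ j)) \<partial>M)"
    by (simp add: inner_vec_def)
  also have "\<dots> = (\<Sum>i\<in>UNIV. \<Sum>j\<in>UNIV. \<integral>x. H x $ i $ j * (G x $ i $ j - D x $ i $ j) \<partial>M)"
    by (simp add: comp(2))
  finally show ?thesis by (simp add: comp(1))
qed

lemma (in prob_space) expectation_norm_noise_split:
  fixes H G D :: "'a \<Rightarrow> real^'n^'m"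
  assumes F: "subalgebra M F" and H: "H \<in> borel_measurable F" "square_integrable M H"
    and G: "square_integrable M G" and D: "square_integrable M D"
    and ae: "AE x in M. mat_cond_exp M F G x = D x"
  shows "(\<integral>x. (norm (a *\<^sub>R H x + b *\<^sub>R (G x - D x)))\<^sup>2 \<partial>M)
    = a\<^sup>2 * (\<integral>x. (norm (H x))\<^sup>2 \<partial>M) + b\<^sup>2 * (\<integral>x. (norm (G x - D x))\<^sup>2 \<partial>M)"
proof -
  note N = square_integrable_diff[OF G D]
  have "(norm (a *\<^sub>R h + b *\<^sub>R v))\<^sup>2 = a\<^sup>2 * (norm h)\<^sup>2 + (2 * a * b * (h \<bullet> v) + b\<^sup>2 * (norm v)\<^sup>2)"
    for h v :: "real^'n^'m"
    unfolding power2_norm_eq_inner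
    by (simp add: inner_add_left inner_add_right inner_commute[of v h] power2_eq_square algebra_simps)
  then show ?thesis
    using square_integrableD(2)[OF H(2)] square_integrableD(2)[OF N] square_integrable_inner[OF H(2) N]
      expectation_inner_noise_eq_0[OF assms]
    by (simp add: integrable_add)
qed

lemma (in prob_space) expectation_trace_le:
  fixes A :: "'a \<Rightarrow> real^'n^'n"
  assumes F: "subalgebra M F" and A: "integrable M A"
    and ae: "AE x in M. mat_cond_exp M F A x \<preceq>\<^sub>L S"
  shows "(\<integral>x. trace (A x) \<partial>M) \<le> trace S"
proof -
  interpret F: finite_measure_subalgebra M F
    by (rule finite_measure_subalgebra.intro) (use F finite_measure_axioms in \<open>auto simp: finite_measure_subalgebra_axioms_def\<close>)
  note int = integrable_matrix_component[OF A]
  have "(\<integral>x. trace (A x) \<partial>M) = (\<Sum>i\<in>UNIV. \<integral>x. A x $ i $ i \<partial>M)"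
    by (simp add: trace_def int)
  also have "\<dots> = (\<Sum>i\<in>UNIV. \<integral>x. real_cond_exp M F (\<lambda>x. A x $ i $ i) x \<partial>M)"
    by (intro sum.cong refl F.real_cond_exp_int(2)[symmetric] int)
  also have "\<dots> = (\<integral>x. (\<Sum>i\<in>UNIV. real_cond_exp M F (\<lambda>x. A x $ i $ i) x) \<partial>M)"
    by (rule Bochner_Integration.integral_sum[symmetric]) (intro F.real_cond_exp_int(1) int)
  also have "\<dots> \<le> (\<integral>x. trace S \<partial>M)"
  proof (rule integral_mono_AE)
    show "integrable M (\<lambda>x. \<Sum>i\<in>UNIV. real_cond_exp M F (\<lambda>x. A x $ i $ i) x)"
      by (intro Bochner_Integration.integrable_sum F.real_cond_exp_int(1) int)
    show "AE x in M. (\<Sum>i\<in>UNIV. real_cond_exp M F (\<lambda>x. A x $ i $ i) x) \<le> trace S"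
      using ae
    proof eventually_elim
      case (elim x)
      have "0 \<le> trace (S - mat_cond_exp M F A x)"
        unfolding trace_onb[OF onb_axis]
        using elim by (intro sum_nonneg) (simp add: loewner_le_def pos_semidef_def)
      then show ?case by (simp add: trace_def mat_cond_exp_def sum_subtractf)
    qed
  qed simp
  finally show ?thesis by (simp add: prob_space)
qed

section \<open>Measurability of the algorithm\<close>

lemma borel_measurable_shampoo_M:
  "(\<And>j. j \<in> {1..k} \<Longrightarrow> G j \<in> borel_measurable F) \<Longrightarrow>
    (\<lambda>x. shampoo_M \<theta> (\<lambda>j. G j x) k) \<in> borel_measurable F"
  by (induction k) auto

lemma borel_measurable_shampoo_L:
  fixes G :: "nat \<Rightarrow> 'a \<Rightarrow> real^'n^'m"
  shows "(\<And>j. j \<in> {1..k} \<Longrightarrow> G j \<in> borel_measurable F) \<Longrightarrow>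
    (\<lambda>x. shampoo_L \<beta> (\<lambda>j. G j x) k) \<in> borel_measurable F"
proof (induction k)
  case (Suc k)
  then show ?case
    by (auto intro!: borel_measurable_add borel_measurable_scaleR borel_measurable_const
        borel_measurable_matrix_mult borel_measurable_transpose)
qed simp

lemma borel_measurable_shampoo_L_eps:
  fixes G :: "nat \<Rightarrow> 'a \<Rightarrow> real^'n^'m"
  assumes "\<And>j. j \<in> {1..k} \<Longrightarrow> G j \<in> borel_measurable F"
  shows "(\<lambda>x. shampoo_L_eps \<beta> \<epsilon> (\<lambda>j. G j x) k) \<in> borel_measurable F"
  unfolding shampoo_L_eps_def using borel_measurable_shampoo_L[of k G F \<beta>] assms by simp

lemma borel_measurable_shampoo_R_eps:
  fixes G :: "nat \<Rightarrow> 'a \<Rightarrow> real^'n^'m"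
  assumes "\<And>j. j \<in> {1..k} \<Longrightarrow> G j \<in> borel_measurable F"
  shows "(\<lambda>x. shampoo_R_eps \<beta> \<epsilon> (\<lambda>j. G j x) k) \<in> borel_measurable F"
  unfolding shampoo_R_eps_eq
  by (rule borel_measurable_shampoo_L_eps) (intro borel_measurable_transpose assms)

text \<open>Predictability: iterate \<open>Suc k\<close> is built from the gradients 1 to
  \<open>k\<close> only.\<close>

lemma borel_measurable_shampoo_X:
  fixes G :: "nat \<Rightarrow> 'a \<Rightarrow> real^'n^'m"
  assumes \<epsilon>: "0 < \<epsilon>" and \<beta>: "0 \<le> \<beta>" "\<beta> \<le> 1"
    and pq: "0 \<le> real_of_ereal (1 / (2 * p))" "0 \<le> real_of_ereal (1 / (2 * q))"
  shows "(\<And>j. j \<in> {1..k} \<Longrightarrow> G j \<in> borel_measurable F) \<Longrightarrow>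
    (\<lambda>x. shampoo_X \<eta> \<theta> \<beta> wd \<epsilon> p q X1 (\<lambda>j. G j x) (Suc k)) \<in> borel_measurable F"
proof (induction k)
  case (Suc k)
  have "(\<lambda>x. mat_powr (shampoo_L_eps \<beta> \<epsilon> (\<lambda>j. G j x) (Suc k)) (- real_of_ereal (1 / (2 * p)))) \<in> borel_measurable F"
    by (rule borel_measurable_mat_powr[OF borel_measurable_shampoo_L_eps \<epsilon>])
      (use Suc.prems pq in \<open>auto intro: shampoo_L_eps_ge \<beta>\<close>)
  moreover have "(\<lambda>x. mat_powr (shampoo_R_eps \<beta> \<epsilon> (\<lambda>j. G j x) (Suc k)) (- real_of_ereal (1 / (2 * q)))) \<in> borel_measurable F"
    by (rule borel_measurable_mat_powr[OF borel_measurable_shampoo_R_eps \<epsilon>])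
      (use Suc.prems pq in \<open>auto intro: shampoo_R_eps_ge \<beta>\<close>)
  moreover have "(\<lambda>x. shampoo_M \<theta> (\<lambda>j. G j x) (Suc k)) \<in> borel_measurable F"
    by (rule borel_measurable_shampoo_M) (rule Suc.prems)
  ultimately have "(\<lambda>x. mat_powr (shampoo_L_eps \<beta> \<epsilon> (\<lambda>j. G j x) (Suc k)) (- real_of_ereal (1 / (2 * p)))
      ** shampoo_M \<theta> (\<lambda>j. G j x) (Suc k)
      ** mat_powr (shampoo_R_eps \<beta> \<epsilon> (\<lambda>j. G j x) (Suc k)) (- real_of_ereal (1 / (2 * q)))) \<in> borel_measurable F"
    by (intro borel_measurable_matrix_mult)
  moreover have "(\<lambda>x. shampoo_X \<eta> \<theta> \<beta> wd \<epsilon> p q X1 (\<lambda>j. G j x) (Suc k)) \<in> borel_measurable F"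
    by (rule Suc.IH) (use Suc.prems in auto)
  ultimately show ?case
    by (subst shampoo_X.simps(2)) (simp del: shampoo_X.simps(2) shampoo_M.simps(2))
qed simp

lemma sets_grad_filtration:
  "sets (grad_filtration M G k)
    = sigma_sets (space M) {G j -` A \<inter> space M | j A. j \<in> {1..k} \<and> A \<in> sets borel}"
  unfolding grad_filtration_def by (rule sets_measure_of) auto

lemma space_grad_filtration [simp]: "space (grad_filtration M G k) = space M"
  unfolding grad_filtration_def by (rule space_measure_of) auto

lemma borel_measurable_grad_filtration:
  assumes "j \<in> {1..k}"
  shows "G j \<in> borel_measurable (grad_filtration M G k)"
proof (rule measurableI)
  fix A :: "(real^'b^'c) set" assume "A \<in> sets borel"
  then show "G j -` A \<inter> space (grad_filtration M G k) \<in> sets (grad_filtration M G k)"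
    unfolding sets_grad_filtration space_grad_filtration
    using assms by (intro sigma_sets.Basic) blast
qed simp

lemma subalgebra_grad_filtration:
  assumes "\<And>j. j \<in> {1..k} \<Longrightarrow> G j \<in> borel_measurable M"
  shows "subalgebra M (grad_filtration M G k)"
  unfolding subalgebra_def sets_grad_filtration space_grad_filtration
  by (intro conjI refl sets.sigma_sets_subset) (use assms in \<open>auto intro: measurable_sets\<close>)

section \<open>Constants\<close>

lemma half_reciprocal_exponents:
  fixes p q :: ereal
  assumes "0 < p" "0 < q" "1 / p + 1 / q = ereal (2 - w)"
  shows "0 \<le> real_of_ereal (1 / (2 * p))" "0 \<le> real_of_ereal (1 / (2 * q))"
    "real_of_ereal (1 / (2 * p)) + real_of_ereal (1 / (2 * q)) = 1 - w / 2"
proof -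
  have inv: "1 / (2 * r) = ereal (real_of_ereal (1 / r) / 2)" "1 / r = ereal (real_of_ereal (1 / r))"
    "0 \<le> real_of_ereal (1 / r)" if "0 < r" for r :: ereal
    using that by (cases r; simp add: one_ereal_def divide_ereal_def zero_ereal_def)+
  have "real_of_ereal (1 / p) + real_of_ereal (1 / q) = 2 - w"
    using assms(3) inv(2)[OF assms(1)] inv(2)[OF assms(2)] by (metis ereal.inject plus_ereal.simps(1))
  then show "0 \<le> real_of_ereal (1 / (2 * p))" "0 \<le> real_of_ereal (1 / (2 * q))"
    "real_of_ereal (1 / (2 * p)) + real_of_ereal (1 / (2 * q)) = 1 - w / 2"
    using inv(3)[OF assms(1)] inv(3)[OF assms(2)]
    unfolding inv(1)[OF assms(1)] inv(1)[OF assms(2)] by (simp_all del: divide_ereal_def)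
qed

text \<open>The constants have slack: \<open>3 powr (s * (1 - s)) * 7 powr s\<close> is at most 7,
  relaxed to 10, and 10 over \<open>s\<close> is 20 over \<open>2 * s\<close>. In the second term 7
  is relaxed to 10 and \<open>2 powr (1 - s)\<close> to \<open>2 powr ((1 - s) / s)\<close>, the
  form occurring in \<open>Chat\<close>.\<close>

lemma rate_constants_le:
  fixes s S D E y c :: real
  assumes s: "0 < s" "s \<le> 1" and pos: "0 < S" "0 < D" "0 < E" "0 < y" "0 < c"
  shows "(D powr (1 - s) * (3 * S\<^sup>2) powr s) powr (1 - s) * (7 * S * sqrt y / E powr (1 - s)) powr s / s
      + (2 powr s * c) powr ((1 - s) / s) * (7 * S * sqrt y / E powr (1 - s))
    \<le> 20 * S powr (3 * s - 2 * s\<^sup>2) * D powr ((1 - s)\<^sup>2) / ((2 * s) * E powr (s - s\<^sup>2)) * y powr (s / 2)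
      + 10 * (2 * c) powr (1 / s - 1) / E powr (1 - s) * (S\<^sup>2 * y) powr (1 / 2)"
proof (rule add_mono)
  define W where "W = S powr (3 * s - 2 * s\<^sup>2) * D powr ((1 - s)\<^sup>2) / E powr (s - s\<^sup>2) * y powr (s / 2)"
  have W: "0 \<le> W" by (simp add: W_def)
  have S2: "(S\<^sup>2) powr a = S powr (2 * a)" for a
  proof -
    have "(S\<^sup>2) powr a = (S powr 2) powr a" using pos by simp
    then show ?thesis by (simp only: powr_powr)
  qed
  have sq: "sqrt y = y powr (1 / 2)" using pos by (simp add: powr_half_sqrt)
  have "(D powr (1 - s) * (3 * S\<^sup>2) powr s) powr (1 - s)
      = D powr ((1 - s)\<^sup>2) * (3 powr (s * (1 - s)) * S powr (2 * s * (1 - s)))"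
    using pos by (simp add: powr_mult S2 powr_powr power2_eq_square[of "1 - s"] mult.assoc)
  moreover have "(7 * S * sqrt y / E powr (1 - s)) powr s
      = 7 powr s * S powr s * y powr (s / 2) / E powr (s - s\<^sup>2)"
    unfolding sq using pos by (simp add: powr_mult powr_powr powr_divide power2_eq_square algebra_simps)
  moreover have "S powr (2 * s * (1 - s)) * S powr s = S powr (3 * s - 2 * s\<^sup>2)"
    using pos by (simp add: powr_add[symmetric] power2_eq_square algebra_simps)
  ultimately have "(D powr (1 - s) * (3 * S\<^sup>2) powr s) powr (1 - s) * (7 * S * sqrt y / E powr (1 - s)) powr s
      = (3 powr (s * (1 - s)) * 7 powr s) * W"
    unfolding W_def by (simp add: mult_ac)
  also have "\<dots> \<le> 10 * W"
  proof (rule mult_right_mono[OF _ W])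
    have "(3::real) powr (s * (1 - s)) \<le> 3 powr (1 - s)" using s by (intro powr_mono) (auto simp: mult_left_le_one_le)
    also have "\<dots> \<le> 7 powr (1 - s)" using s by (intro powr_mono2) auto
    finally have "(3::real) powr (s * (1 - s)) * 7 powr s \<le> 7 powr (1 - s) * 7 powr s" by (rule mult_right_mono) simp
    then show "(3::real) powr (s * (1 - s)) * 7 powr s \<le> 10" by (simp add: powr_add[symmetric])
  qed
  finally have "(D powr (1 - s) * (3 * S\<^sup>2) powr s) powr (1 - s) * (7 * S * sqrt y / E powr (1 - s)) powr s / s
      \<le> 10 * W / s" using s by (simp add: divide_right_mono)
  then show "(D powr (1 - s) * (3 * S\<^sup>2) powr s) powr (1 - s) * (7 * S * sqrt y / E powr (1 - s)) powr s / s
    \<le> 20 * S powr (3 * s - 2 * s\<^sup>2) * D powr ((1 - s)\<^sup>2) / ((2 * s) * E powr (s - s\<^sup>2)) * y powr (s / 2)"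
    by (simp add: W_def field_simps)
next
  have h: "(S\<^sup>2 * y) powr (1 / 2) = S * sqrt y"
    using pos by (simp add: powr_half_sqrt real_sqrt_mult)
  have "(2 powr s * c) powr ((1 - s) / s) = 2 powr (1 - s) * c powr ((1 - s) / s)"
    using pos s by (simp add: powr_mult powr_powr)
  also have "\<dots> \<le> 2 powr ((1 - s) / s) * c powr ((1 - s) / s)"
  proof (intro mult_right_mono powr_mono)
    have "(1 - s) * s \<le> 1 - s" using s by (simp add: mult_left_le)
    then show "1 - s \<le> (1 - s) / s" using s by (simp add: le_divide_eq)
  qed auto
  also have "\<dots> = (2 * c) powr (1 / s - 1)" using pos s by (simp add: powr_mult diff_divide_distrib)
  finally have "(2 powr s * c) powr ((1 - s) / s) * (7 * S * sqrt y / E powr (1 - s))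
      \<le> (2 * c) powr (1 / s - 1) * (7 * S * sqrt y / E powr (1 - s))"
    using pos by (intro mult_right_mono) auto
  also have "\<dots> \<le> (2 * c) powr (1 / s - 1) * (10 * S * sqrt y / E powr (1 - s))"
    using pos by (intro mult_left_mono divide_right_mono mult_right_mono) auto
  also have "\<dots> = 10 * (2 * c) powr (1 / s - 1) / E powr (1 - s) * (S\<^sup>2 * y) powr (1 / 2)"
    unfolding h by simp
  finally show "(2 powr s * c) powr ((1 - s) / s) * (7 * S * sqrt y / E powr (1 - s))
    \<le> 10 * (2 * c) powr (1 / s - 1) / E powr (1 - s) * (S\<^sup>2 * y) powr (1 / 2)" .
qed

text \<open>The powers of \<open>S\<close> inside \<open>E\<close> combine with the numerators to
  \<open>S powr (w/2)\<close> and \<open>S powr (w - 1)\<close>. As \<open>S\<close> is the larger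
  of \<open>\<sigma>\<close> and \<open>sqrt y / \<gamma>\<close>, each is evaluated by cases; for
  \<open>w < 1\<close> the second is decreasing, so the bound
  \<open>sqrt y / \<gamma> \<le> S\<close> decides.\<close>

lemma rate_minimal_regularisation:
  fixes w S D y C \<tau> \<gamma> \<sigma> :: real
  assumes w: "0 < w" "w \<le> 2" and pos: "0 < D" "0 < y" "0 \<le> C" "0 < \<tau>" "0 < \<gamma>" "0 \<le> \<sigma>"
    and S: "S = sqrt (max (\<sigma>\<^sup>2) (y / \<gamma>\<^sup>2))" and E: "E = \<tau> * S\<^sup>2 / D"
  shows "20 * S powr (3*w/2 - w\<^sup>2/2) * D powr ((1 - w/2)\<^sup>2) / (w * E powr (w/2 - w\<^sup>2/4)) * y powr (w/4)
      + 10 * C / E powr (1 - w/2) * (S\<^sup>2 * y) powr (1/2)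
    \<le> 20 * D powr (1 - w/2) / (w * \<tau> powr (w/2 - w\<^sup>2/4))
          * max (\<sigma> powr (w/2) * y powr (w/4)) ((y / \<gamma>) powr (w/2))
        + 10 * C * D powr (1 - w/2) / \<tau> powr (1 - w/2)
          * (if 1 \<le> w
             then max (\<sigma> powr (w - 1) * y powr (1/2)) (1 / \<gamma> powr (w - 1) * y powr (w/2))
             else 1 / \<gamma> powr (w - 1) * y powr (w/2))"
proof (rule add_mono)
  define t where "t = sqrt y / \<gamma>"
  have t: "0 < t" using pos by (simp add: t_def)
  have "y / \<gamma>\<^sup>2 = t\<^sup>2" using pos by (simp add: t_def power_divide)
  then have S': "S = sqrt (max (\<sigma>\<^sup>2) (t\<^sup>2))" using S by simp
  have S_max: "S = max \<sigma> t"
  proof (cases "\<sigma> \<le> t")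
    case True
    then have "\<sigma>\<^sup>2 \<le> t\<^sup>2" using pos by (intro power_mono) auto
    then show ?thesis using S' True t by (simp add: max_absorb2)
  next
    case False
    then have "t\<^sup>2 \<le> \<sigma>\<^sup>2" using t by (intro power_mono) auto
    then show ?thesis using S' False pos by (simp add: max_absorb1)
  qed
  have S0: "0 < S" using t S_max by simp
  have S2: "(S\<^sup>2) powr a = S powr (2 * a)" for a
  proof -
    have "(S\<^sup>2) powr a = (S powr 2) powr a" using S0 by simp
    then show ?thesis by (simp only: powr_powr)
  qed
  have tp: "t powr a = y powr (a / 2) / \<gamma> powr a" for a
    using pos by (simp add: t_def powr_divide powr_half_sqrt[symmetric] powr_powr)
  have Ep: "E powr a = \<tau> powr a * S powr (2 * a) / D powr a" for a
    unfolding E using pos S0 by (simp add: powr_mult powr_divide S2)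
  have "S powr (w/2) * y powr (w/4) \<le> max (\<sigma> powr (w/2) * y powr (w/4)) ((y / \<gamma>) powr (w/2))"
  proof (cases "S = \<sigma>")
    case False
    then have "S = t" using S_max by (metis max_def)
    then have "S powr (w/2) * y powr (w/4) = (y / \<gamma>) powr (w/2)"
      using pos by (simp add: tp powr_divide flip: powr_add)
    then show ?thesis by simp
  qed simp
  then have "20 * D powr (1 - w/2) / (w * \<tau> powr (w/2 - w\<^sup>2/4)) * (S powr (w/2) * y powr (w/4))
      \<le> 20 * D powr (1 - w/2) / (w * \<tau> powr (w/2 - w\<^sup>2/4))
          * max (\<sigma> powr (w/2) * y powr (w/4)) ((y / \<gamma>) powr (w/2))"
    using w by (intro mult_left_mono) auto
  moreover have "20 * S powr (3*w/2 - w\<^sup>2/2) * D powr ((1 - w/2)\<^sup>2) / (w * E powr (w/2 - w\<^sup>2/4)) * y powr (w/4)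
      = 20 * D powr (1 - w/2) / (w * \<tau> powr (w/2 - w\<^sup>2/4)) * (S powr (w/2) * y powr (w/4))"
  proof -
    define a where "a = w/2 - w\<^sup>2/4"
    have e1: "3*w/2 - w\<^sup>2/2 = w/2 + 2 * a" "1 - w/2 = (1 - w/2)\<^sup>2 + a"
      by (simp_all add: a_def power2_eq_square algebra_simps)
    have "S powr (3*w/2 - w\<^sup>2/2) = S powr (w/2) * S powr (2 * a)"
      unfolding e1(1) by (rule powr_add)
    moreover have "D powr (1 - w/2) = D powr ((1 - w/2)\<^sup>2) * D powr a"
      by (subst e1(2)) (rule powr_add)
    ultimately show ?thesis
      unfolding a_def[symmetric] Ep using pos S0 w by (simp add: field_simps)
  qed
  ultimately show "20 * S powr (3*w/2 - w\<^sup>2/2) * D powr ((1 - w/2)\<^sup>2) / (w * E powr (w/2 - w\<^sup>2/4)) * y powr (w/4)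
    \<le> 20 * D powr (1 - w/2) / (w * \<tau> powr (w/2 - w\<^sup>2/4))
          * max (\<sigma> powr (w/2) * y powr (w/4)) ((y / \<gamma>) powr (w/2))" by simp
  let ?B = "if 1 \<le> w
             then max (\<sigma> powr (w - 1) * y powr (1/2)) (1 / \<gamma> powr (w - 1) * y powr (w/2))
             else 1 / \<gamma> powr (w - 1) * y powr (w/2)"
  have tB: "t powr (w - 1) * y powr (1/2) = 1 / \<gamma> powr (w - 1) * y powr (w/2)"
    using pos by (simp add: tp diff_divide_distrib flip: powr_add)
  have "S powr (w - 1) * y powr (1/2) \<le> ?B"
  proof (cases "1 \<le> w")
    case True
    show ?thesis
    proof (cases "S = \<sigma>")
      case False
      then have "S = t" using S_max by (metis max_def)
      then show ?thesis using True tB by simp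
    qed (use True in simp)
  next
    case False
    then have "S powr (w - 1) \<le> t powr (w - 1)" using t S_max by (intro powr_mono2') auto
    then have "S powr (w - 1) * y powr (1/2) \<le> t powr (w - 1) * y powr (1/2)" by (rule mult_right_mono) simp
    then show ?thesis using False tB by simp
  qed
  then have "10 * C * D powr (1 - w/2) / \<tau> powr (1 - w/2) * (S powr (w - 1) * y powr (1/2))
      \<le> 10 * C * D powr (1 - w/2) / \<tau> powr (1 - w/2) * ?B"
    using pos by (intro mult_left_mono) auto
  moreover have "10 * C / E powr (1 - w/2) * (S\<^sup>2 * y) powr (1/2)
      = 10 * C * D powr (1 - w/2) / \<tau> powr (1 - w/2) * (S powr (w - 1) * y powr (1/2))"
  proof -
    have "(S\<^sup>2 * y) powr (1/2) = S * y powr (1/2)"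
      using pos S0 by (simp add: powr_mult S2)
    moreover have "S = S powr (w - 1) * S powr (2 * (1 - w/2))"
      using S0 by (simp flip: powr_add)
    ultimately have "(S\<^sup>2 * y) powr (1/2) = S powr (w - 1) * S powr (2 * (1 - w/2)) * y powr (1/2)"
      by simp
    then show ?thesis unfolding Ep using pos S0 by (simp add: field_simps)
  qed
  ultimately show "10 * C / E powr (1 - w/2) * (S\<^sup>2 * y) powr (1/2)
    \<le> 10 * C * D powr (1 - w/2) / \<tau> powr (1 - w/2) * ?B" by simp
qed

lemma momentum_descent_rate:
  fixes L \<Delta> Kr c \<rho> S \<sigma> y \<eta> Se Sd :: real
  assumes pos: "0 < L" "0 < Kr" "0 < c" "0 < \<rho>" "0 < S" "0 \<le> Sd" and \<sigma>: "\<sigma>\<^sup>2 \<le> S\<^sup>2"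
    and y: "y = L * \<Delta> / Kr" and \<rho>: "sqrt y = \<rho> * S" and \<eta>: "\<eta> = c * \<rho> / (2 * L)"
    and Se: "\<rho> * Se \<le> 2 * L * \<Delta> + Kr * (\<rho>\<^sup>2 * \<sigma>\<^sup>2) + L\<^sup>2 / \<rho> * Sd"
  shows "2 / \<eta> * (\<Delta> - c / (4 * \<eta>) * Sd + \<eta> / (2 * c) * Se) \<le> Kr * (7 * S * sqrt y / c)"
proof -
  have "0 < sqrt y" using pos \<rho> by simp
  then have "y = (\<rho> * S)\<^sup>2" by (simp add: \<rho>[symmetric])
  then have L\<Delta>: "L * \<Delta> = Kr * (\<rho>\<^sup>2 * S\<^sup>2)" using y pos by (simp add: field_simps)
  have \<Delta>: "\<Delta> = Kr * (\<rho>\<^sup>2 * S\<^sup>2) / L" using L\<Delta> pos by (simp add: field_simps)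
  have "\<rho> * Se \<le> 2 * (Kr * (\<rho>\<^sup>2 * S\<^sup>2)) + Kr * (\<rho>\<^sup>2 * S\<^sup>2) + L\<^sup>2 / \<rho> * Sd"
  proof -
    have "Kr * (\<rho>\<^sup>2 * \<sigma>\<^sup>2) \<le> Kr * (\<rho>\<^sup>2 * S\<^sup>2)" using pos \<sigma> by (intro mult_left_mono) auto
    moreover have "2 * L * \<Delta> = 2 * (Kr * (\<rho>\<^sup>2 * S\<^sup>2))" by (simp only: mult.assoc L\<Delta>)
    ultimately show ?thesis using Se by linarith
  qed
  then have "Se \<le> (3 * (Kr * (\<rho>\<^sup>2 * S\<^sup>2)) + L\<^sup>2 / \<rho> * Sd) / \<rho>"
    using pos by (simp add: field_simps)
  also have "\<dots> = 3 * (Kr * (\<rho> * S\<^sup>2)) + L\<^sup>2 / \<rho>\<^sup>2 * Sd"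
    using pos by (simp add: field_simps power2_eq_square)
  finally have Se': "Se / c \<le> (3 * (Kr * (\<rho> * S\<^sup>2)) + L\<^sup>2 / \<rho>\<^sup>2 * Sd) / c"
    using pos by (simp add: divide_right_mono)
  have "2 / \<eta> * (\<Delta> - c / (4 * \<eta>) * Sd + \<eta> / (2 * c) * Se)
      = 4 * (Kr * (\<rho> * S\<^sup>2)) / c - 2 * (L\<^sup>2 / \<rho>\<^sup>2 * Sd) / c + Se / c"
    unfolding \<eta> \<Delta> using pos by (simp add: field_simps power2_eq_square)
  also have "\<dots> \<le> 4 * (Kr * (\<rho> * S\<^sup>2)) / c - 2 * (L\<^sup>2 / \<rho>\<^sup>2 * Sd) / c
      + (3 * (Kr * (\<rho> * S\<^sup>2)) + L\<^sup>2 / \<rho>\<^sup>2 * Sd) / c"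
    using Se' by simp
  also have "\<dots> = 7 * (Kr * (\<rho> * S\<^sup>2)) / c - (L\<^sup>2 / \<rho>\<^sup>2 * Sd) / c"
    unfolding add_divide_distrib by (simp add: mult.commute)
  also have "\<dots> \<le> 7 * (Kr * (\<rho> * S\<^sup>2)) / c" using pos by simp
  also have "\<dots> = Kr * (7 * S * sqrt y / c)" unfolding \<rho> by (simp add: power2_eq_square)
  finally show ?thesis .
qed

lemma concave_weighted_bound:
  fixes c D x x' t s :: real
  assumes "0 < s" "s \<le> 1" "0 \<le> c" "c \<le> D" "0 \<le> x" "x \<le> x'" "0 < t"
  shows "c powr (1 - s) * x powr s \<le> D powr (1 - s) * (s * t powr (s - 1) * x' + (1 - s) * t powr s)"
proof (rule mult_mono)
  show "c powr (1 - s) \<le> D powr (1 - s)" using assms by (intro powr_mono2) auto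
  have "x powr s \<le> x' powr s" using assms by (intro powr_mono2) auto
  also have "\<dots> \<le> s * t powr (s - 1) * x' + (1 - s) * t powr s"
    using assms by (intro powr_concave_tangent) auto
  finally show "x powr s \<le> s * t powr (s - 1) * x' + (1 - s) * t powr s" .
qed auto

theorem theorem2:
  fixes M :: "'a measure"
    and f :: "real^'n^'m \<Rightarrow> real" and gradf :: "real^'n^'m \<Rightarrow> real^'n^'m"
    and G X N :: "nat \<Rightarrow> 'a \<Rightarrow> real^'n^'m"
    and Leps :: "nat \<Rightarrow> 'a \<Rightarrow> real^'m^'m" and Reps :: "nat \<Rightarrow> 'a \<Rightarrow> real^'n^'n"
    and X1 :: "real^'n^'m"
    and SigL :: "real^'m^'m" and SigR :: "real^'n^'n"
    and p q :: ereal
    and \<omega> \<eta> \<theta> \<beta> \<epsilon> \<epsilon>h \<gamma> \<tau> L fstar \<sigma> \<sigma>h Chat m n :: real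
    and K :: nat
  assumes prob: "prob_space M"
    and dims: "m = real CARD('m)" "n = real CARD('n)"
    and K: "K \<ge> 1"
    \<comment> \<open>exponents and hyperparameters\<close>
    and \<omega>: "0 < \<omega>" "\<omega> \<le> 2"
    and pq: "0 < p" "0 < q" "1 / p + 1 / q = ereal (2 - \<omega>)"
    and hyper: "0 < \<eta>" "0 \<le> \<theta>" "\<theta> < 1" "0 < \<beta>" "\<beta> < 1" "0 < \<epsilon>"
    and \<gamma>: "0 < \<gamma>" "\<gamma> < 1"
    and \<tau>: "0 < \<tau>" "\<tau> \<le> 1"
    \<comment> \<open>objective\<close>
    and grad: "\<And>Y. GDERIV f Y :> gradf Y"
    and lower: "\<And>Y. fstar \<le> f Y"
    and start: "fstar < f X1"
    and L_pos: "0 < L"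
    and smooth: "\<And>Y Z. norm (gradf Z - gradf Y) \<le> L * norm (Z - Y)"
    \<comment> \<open>the algorithm, without weight decay\<close>
    and X: "\<And>k x. X k x = shampoo_X \<eta> \<theta> \<beta> 0 \<epsilon> p q X1 (\<lambda>j. G j x) k"
    and Leps: "\<And>k x. Leps k x = shampoo_L_eps \<beta> \<epsilon> (\<lambda>j. G j x) k"
    and Reps: "\<And>k x. Reps k x = shampoo_R_eps \<beta> \<epsilon> (\<lambda>j. G j x) k"
    and N: "\<And>k x. N k x = G k x - gradf (X k x)"
    \<comment> \<open>unbiasedness\<close>
    and G_int: "\<And>k. k \<in> {1..K} \<Longrightarrow> integrable M (G k)"
    and unbiased: "\<And>k. k \<in> {1..K} \<Longrightarrow>
      AE x in M. mat_cond_exp M (grad_filtration M G (k - 1)) (G k) x = gradf (X k x)"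
    \<comment> \<open>noise covariance\<close>
    and Sig: "pos_semidef SigL" "pos_semidef SigR"
    and N_int: "\<And>k. k \<in> {1..K} \<Longrightarrow> integrable M (\<lambda>x. N k x ** transpose (N k x))"
      "\<And>k. k \<in> {1..K} \<Longrightarrow> integrable M (\<lambda>x. transpose (N k x) ** N k x)"
    and cov_L: "\<And>k. k \<in> {1..K} \<Longrightarrow>
      AE x in M. mat_cond_exp M (grad_filtration M G (k - 1))
                   (\<lambda>y. N k y ** transpose (N k y)) x \<preceq>\<^sub>L SigL"
    and cov_R: "\<And>k. k \<in> {1..K} \<Longrightarrow>
      AE x in M. mat_cond_exp M (grad_filtration M G (k - 1))
                   (\<lambda>y. transpose (N k y) ** N k y) x \<preceq>\<^sub>L SigR"
    \<comment> \<open>parameter choices\<close>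
    and \<sigma>: "\<sigma> = sqrt ((trace SigL + trace SigR) / 2)"
    and \<sigma>h: "\<sigma>h = sqrt (max (\<sigma>\<^sup>2) (L * (f X1 - fstar) / (real K * \<gamma>\<^sup>2)))"
    and \<theta>_eq: "1 - \<theta> = sqrt (L * (f X1 - fstar) / (real K * \<sigma>h\<^sup>2))"
    and \<epsilon>h: "\<epsilon> \<le> \<epsilon>h"
    and \<eta>_eq: "\<eta> = \<epsilon>h powr (1 - \<omega>/2) * sqrt ((f X1 - fstar) / (4 * L * real K * \<sigma>h\<^sup>2))"
    and \<epsilon>_eq: "\<epsilon> = \<tau> * \<sigma>h\<^sup>2 / (m + n)"
    and Chat: "Chat = (2 * (1 - \<beta>) powr (\<omega>/2) / (1 - \<beta> powr (\<omega>/2))) powr (2/\<omega> - 1)"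
  shows
    "(\<forall>k\<in>{1..K}. integrable M (\<lambda>x. nuclear_norm (mat_powr (mat_abs (gradf (X k x))) \<omega>))) \<and>
     ((\<forall>k\<in>{1..K}. AE x in M. \<epsilon>h *\<^sub>R mat 1 \<preceq>\<^sub>L Leps k x \<and> \<epsilon>h *\<^sub>R mat 1 \<preceq>\<^sub>L Reps k x) \<longrightarrow>
      (1 / real K) * (\<Sum>k=1..K. \<integral>x. nuclear_norm (mat_powr (mat_abs (gradf (X k x))) \<omega>) \<partial>M)
      \<le> 20 * \<sigma>h powr (3*\<omega>/2 - \<omega>\<^sup>2/2) * (m + n) powr ((1 - \<omega>/2)\<^sup>2)
            / (\<omega> * \<epsilon>h powr (\<omega>/2 - \<omega>\<^sup>2/4))
          * (L * (f X1 - fstar) / real K) powr (\<omega>/4)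
        + 10 * Chat / \<epsilon>h powr (1 - \<omega>/2)
          * (\<sigma>h\<^sup>2 * L * (f X1 - fstar) / real K) powr (1/2)) \<and>
     (\<epsilon>h = \<epsilon> \<longrightarrow>
      (\<forall>k\<in>{1..K}. \<forall>x. \<epsilon>h *\<^sub>R mat 1 \<preceq>\<^sub>L Leps k x \<and> \<epsilon>h *\<^sub>R mat 1 \<preceq>\<^sub>L Reps k x) \<and>
      (1 / real K) * (\<Sum>k=1..K. \<integral>x. nuclear_norm (mat_powr (mat_abs (gradf (X k x))) \<omega>) \<partial>M)
      \<le> 20 * (m + n) powr (1 - \<omega>/2) / (\<omega> * \<tau> powr (\<omega>/2 - \<omega>\<^sup>2/4))
          * max (\<sigma> powr (\<omega>/2) * (L * (f X1 - fstar) / real K) powr (\<omega>/4))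
                ((L * (f X1 - fstar) / (real K * \<gamma>)) powr (\<omega>/2))
        + 10 * Chat * (m + n) powr (1 - \<omega>/2) / \<tau> powr (1 - \<omega>/2)
          * (if 1 \<le> \<omega>
             then max (\<sigma> powr (\<omega> - 1) * (L * (f X1 - fstar) / real K) powr (1/2))
                      (1 / \<gamma> powr (\<omega> - 1) * (L * (f X1 - fstar) / real K) powr (\<omega>/2))
             else 1 / \<gamma> powr (\<omega> - 1) * (L * (f X1 - fstar) / real K) powr (\<omega>/2)))"
proof -
  interpret prob_space M by (rule prob)

  \<comment> \<open>Parameters and their relations\<close>
  define s where "s = \<omega> / 2"
  define k1 where "k1 = real_of_ereal (1 / (2 * p))"
  define k2 where "k2 = real_of_ereal (1 / (2 * q))"
  define \<Delta> where "\<Delta> = f X1 - fstar"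
  define D where "D = m + n"
  define c0 where "c0 = \<epsilon>h powr (1 - s)"
  define \<rho> where "\<rho> = 1 - \<theta>"
  define Kr where "Kr = real K"
  define y where "y = L * \<Delta> / Kr"
  have s: "0 < s" "s \<le> 1" and \<omega>s: "\<omega> = 2 * s" using \<omega> by (auto simp: s_def)
  have \<Delta>: "0 < \<Delta>" using start by (simp add: \<Delta>_def)
  have Kr: "0 < Kr" using K by (simp add: Kr_def)
  have D: "0 < D" "m \<le> D" "n \<le> D" by (auto simp: D_def dims intro!: add_pos_pos)
  have y: "0 < y" using L_pos \<Delta> Kr by (simp add: y_def)
  have \<epsilon>h0: "0 < \<epsilon>h" using \<epsilon>h hyper(6) by linarith
  have c0: "0 < c0" using \<epsilon>h0 by (simp add: c0_def)
  have k: "0 \<le> k1" "0 \<le> k2" "k1 + k2 = 1 - s"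
    unfolding k1_def k2_def s_def by (rule half_reciprocal_exponents[OF pq])+
  have tr: "0 \<le> trace SigL" "0 \<le> trace SigR"
    using Sig by (auto simp: trace_onb[OF onb_axis] pos_semidef_def intro!: sum_nonneg)
  have \<sigma>0: "0 \<le> \<sigma>" and \<sigma>2: "\<sigma>\<^sup>2 = (trace SigL + trace SigR) / 2"
    using tr by (simp_all add: \<sigma>)
  have \<sigma>h': "\<sigma>h = sqrt (max (\<sigma>\<^sup>2) (y / \<gamma>\<^sup>2))"
    by (simp add: \<sigma>h y_def \<Delta>_def Kr_def)
  have yg: "0 < y / \<gamma>\<^sup>2" using y \<gamma> by simp
  then have \<sigma>h0: "0 < \<sigma>h" unfolding \<sigma>h' by (simp add: less_max_iff_disj)
  have \<sigma>h2: "\<sigma>h\<^sup>2 = max (\<sigma>\<^sup>2) (y / \<gamma>\<^sup>2)" unfolding \<sigma>h' using yg by (simp add: le_max_iff_disj)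
  have \<sigma>\<sigma>h: "\<sigma>\<^sup>2 \<le> \<sigma>h\<^sup>2" unfolding \<sigma>h2 by simp
  have \<rho>0: "0 < \<rho>" "\<rho> \<le> 1" using hyper by (auto simp: \<rho>_def)
  have \<rho>y: "\<rho> = sqrt (y / \<sigma>h\<^sup>2)"
    by (simp add: \<rho>_def \<theta>_eq y_def \<Delta>_def Kr_def)
  have sy: "sqrt y = \<rho> * \<sigma>h" unfolding \<rho>y using \<sigma>h0 by (simp add: real_sqrt_divide)
  \<comment> \<open>In this form \<open>L * \<eta>\<close> is \<open>c0 * \<rho> / 2\<close>, so the
    step-size condition of the descent is \<open>\<rho> \<le> 1\<close>.\<close>
  have \<eta>': "\<eta> = c0 * \<rho> / (2 * L)"
  proof -
    have "\<Delta> / (4 * L * Kr * \<sigma>h\<^sup>2) = (\<rho> / (2 * L))\<^sup>2"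
      unfolding \<rho>y power_divide using y \<sigma>h0 L_pos Kr by (simp add: y_def field_simps power2_eq_square)
    then have "sqrt (\<Delta> / (4 * L * Kr * \<sigma>h\<^sup>2)) = \<rho> / (2 * L)"
      using \<rho>0 L_pos by (simp add: real_sqrt_unique)
    then show ?thesis by (simp add: \<eta>_eq c0_def s_def \<Delta>_def Kr_def)
  qed
  have L\<eta>: "L * \<eta> \<le> c0 / 2" unfolding \<eta>' using L_pos \<rho>0 c0 by (simp add: field_simps)

  \<comment> \<open>Adaptedness and square integrability\<close>
  define F where "F k = grad_filtration M G k" for k
  define Mm where "Mm k x = shampoo_M \<theta> (\<lambda>j. G j x) k" for k x
  define g where "g k x = gradf (X k x)" for k x
  have X_1: "X (Suc 0) x = X1" for x by (simp add: X)
  have X_Suc: "X (Suc k) x = X k x - \<eta> *\<^sub>R (mat_powr (Leps k x) (- k1) ** Mm k x ** mat_powr (Reps k x) (- k2))"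
    if "1 \<le> k" for k x
    unfolding X Leps Reps Mm_def k1_def k2_def using that by (subst shampoo_X.simps(2)) simp
  have Lge: "\<epsilon> *\<^sub>R mat 1 \<preceq>\<^sub>L Leps k x" "\<epsilon> *\<^sub>R mat 1 \<preceq>\<^sub>L Reps k x" for k x
    unfolding Leps Reps using hyper by (auto intro: shampoo_L_eps_ge shampoo_R_eps_ge)
  have GN: "G k x = g k x + N k x" for k x by (simp add: g_def N)
  have NG: "N k x = G k x - g k x" for k x by (simp add: g_def N)

  have G_meas: "G j \<in> borel_measurable M" if "j \<in> {1..K}" for j
    using G_int[OF that] by (rule borel_measurable_integrable)
  have sub: "subalgebra M (F k)" if "k \<le> K" for k
    unfolding F_def by (rule subalgebra_grad_filtration) (use that in \<open>auto intro: G_meas\<close>)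
  have FM: "h \<in> borel_measurable M" if "h \<in> borel_measurable (F k)" "k \<le> K" for h :: "'a \<Rightarrow> real^'n^'m" and k
    using measurable_from_subalg[OF sub[OF that(2)] that(1)] .
  have G_F: "G j \<in> borel_measurable (F k)" if "j \<in> {1..k}" for j k
    unfolding F_def by (rule borel_measurable_grad_filtration[OF that])
  have X_F: "X (Suc k) \<in> borel_measurable (F k)" for k
  proof -
    have "(\<lambda>x. shampoo_X \<eta> \<theta> \<beta> 0 \<epsilon> p q X1 (\<lambda>j. G j x) (Suc k)) \<in> borel_measurable (F k)"
      by (rule borel_measurable_shampoo_X) (use hyper k G_F in \<open>auto simp: k1_def k2_def\<close>)
    then show ?thesis unfolding X[abs_def] .
  qed
  have M_F: "Mm k \<in> borel_measurable (F k)" for k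
    unfolding Mm_def[abs_def] by (rule borel_measurable_shampoo_M) (rule G_F)
  have gradf_cont: "continuous_on UNIV gradf"
    by (rule lipschitz_on_continuous_on[of L]) (auto intro!: lipschitz_onI simp: dist_norm smooth less_imp_le[OF L_pos])
  have g_F: "g (Suc k) \<in> borel_measurable (F k)" for k
    unfolding g_def[abs_def] by (rule borel_measurable_continuous_on[OF gradf_cont X_F])
  have N_sq: "square_integrable M (N k)" if k: "k \<in> {1..K}" for k
  proof -
    obtain j where j: "k = Suc j" using k by (cases k) auto
    have "g k \<in> borel_measurable M" unfolding j by (rule FM[OF g_F]) (use k j in simp)
    then have "N k \<in> borel_measurable M" unfolding NG[abs_def] using G_meas[OF k] by simp
    moreover have "integrable M (\<lambda>x. trace (N k x ** transpose (N k x)))"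
      unfolding trace_def
      by (intro Bochner_Integration.integrable_sum integrable_matrix_component N_int(1) k)
    ultimately show ?thesis by (simp add: square_integrable_def trace_mult_transpose)
  qed
  have g_sq: "square_integrable M (g k)" if "square_integrable M (X k)" for k
    unfolding g_def[abs_def] by (rule square_integrable_Lipschitz[OF that smooth])
  \<comment> \<open>Momentum and next iterate are treated jointly: \<open>Mm (Suc k)\<close>
    involves the gradient at \<open>X (Suc k)\<close>, and the following iterate involves
    \<open>Mm (Suc k)\<close>. Square integrability of \<open>G k\<close> is itself a consequence,
    via gradient plus noise.\<close>
  have MX_sq: "k \<le> K \<Longrightarrow> square_integrable M (Mm k) \<and> square_integrable M (X (Suc k))" for k
  proof (induction k)
    case 0
    have "Mm 0 = (\<lambda>x. 0)" "X (Suc 0) = (\<lambda>x. X1)" by (auto simp: Mm_def fun_eq_iff X_1)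
    then show ?case by (simp add: square_integrable_const)
  next
    case (Suc k)
    then have sq: "square_integrable M (Mm k)" "square_integrable M (X (Suc k))" by auto
    have "Mm (Suc k) = (\<lambda>x. \<theta> *\<^sub>R Mm k x + (1 - \<theta>) *\<^sub>R (g (Suc k) x + N (Suc k) x))"
      by (simp add: fun_eq_iff Mm_def GN)
    then have M_sq: "square_integrable M (Mm (Suc k))"
      using Suc.prems by (simp add: square_integrable_add square_integrable_scaleR sq g_sq N_sq)
    define U where "U x = mat_powr (Leps (Suc k) x) (- k1) ** Mm (Suc k) x ** mat_powr (Reps (Suc k) x) (- k2)" for x
    have XU: "X (Suc (Suc k)) x = X (Suc k) x - \<eta> *\<^sub>R U x" for x
      using X_Suc[of "Suc k" x] by (simp add: U_def)
    \<comment> \<open>The direction is recovered from two iterates already known to be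
      measurable.\<close>
    have "U x = (1 / \<eta>) *\<^sub>R (X (Suc k) x - X (Suc (Suc k)) x)" for x
      using hyper(1) by (simp add: XU)
    then have "U \<in> borel_measurable M"
      using FM[OF X_F, of "Suc k"] FM[OF X_F, of k] Suc.prems
      by (simp add: fun_eq_iff borel_measurable_scaleR borel_measurable_diff cong: measurable_cong)
    \<comment> \<open>The bound with \<open>\<epsilon>\<close> holds at every sample, unlike the one
      with \<open>\<epsilon>h\<close>.\<close>
    then have "square_integrable M U"
      by (rule square_integrable_dominated[OF M_sq, where C = "\<epsilon> powr (- (k1 + k2))"])
        (unfold U_def, rule norm_two_sided_le[OF Lge hyper(6) k(1,2)])
    then have "square_integrable M (\<lambda>x. X (Suc k) x - \<eta> *\<^sub>R U x)"
      by (intro square_integrable_diff square_integrable_scaleR sq)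
    then show ?case using M_sq by (simp add: XU[symmetric])
  qed
  have X_sq: "square_integrable M (X k)" if "k \<in> {1..Suc K}" for k
    using MX_sq[of "k - 1"] that by (cases k) auto
  have gk_sq: "square_integrable M (g k)" if "k \<in> {1..K}" for k
    using that by (intro g_sq X_sq) auto
  have G_sq: "square_integrable M (G k)" if "k \<in> {1..K}" for k
    using square_integrable_add[OF gk_sq N_sq] that unfolding GN[abs_def] by blast

  \<comment> \<open>Integrability of the target quantity\<close>
  define P where "P k x = trpow (transpose (g k x) ** g k x) s" for k x
  have nuc: "nuclear_norm (mat_powr (mat_abs (gradf (X k x))) \<omega>) = P k x" for k x
    by (simp add: nuclear_norm_mat_abs_powr P_def g_def s_def)
  have P0: "0 \<le> P k x" for k x
    unfolding P_def by (rule trpow_nonneg[OF pos_semidef_transpose_mult])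
  have P_int: "integrable M (P k)" if "k \<in> {1..K}" for k
  proof (rule Bochner_Integration.integrable_bound)
    show "integrable M (\<lambda>x. n powr (1 - s) * ((norm (g k x))\<^sup>2 + 1))"
      using square_integrableD(2)[OF gk_sq[OF that]] by simp
    show "P k \<in> borel_measurable M"
      unfolding P_def[abs_def] using square_integrableD(1)[OF gk_sq[OF that]]
      by (intro borel_measurable_trpow borel_measurable_matrix_mult borel_measurable_transpose s
          pos_semidef_transpose_mult)
    have "P k x \<le> n powr (1 - s) * ((norm (g k x))\<^sup>2 + 1)" for x
    proof -
      have "P k x \<le> n powr (1 - s) * ((norm (g k x))\<^sup>2) powr s"
        using trpow_le_trace[OF pos_semidef_transpose_mult, of s "g k x"] s
        by (simp add: P_def dims trace_mult_transpose)
      also have "((norm (g k x))\<^sup>2) powr s \<le> s * 1 powr (s - 1) * (norm (g k x))\<^sup>2 + (1 - s) * 1 powr s"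
        by (rule powr_concave_tangent) (use s in auto)
      also have "\<dots> \<le> (norm (g k x))\<^sup>2 + 1"
        using s mult_right_mono[of s 1 "(norm (g k x))\<^sup>2"] by simp
      finally show ?thesis by (simp add: mult_left_mono)
    qed
    then show "AE x in M. norm (P k x) \<le> norm (n powr (1 - s) * ((norm (g k x))\<^sup>2 + 1))"
      by (simp add: P0 abs_mult)
  qed

  \<comment> \<open>Noise level and momentum error\<close>
  have noise: "(\<integral>x. (norm (N k x))\<^sup>2 \<partial>M) \<le> \<sigma>\<^sup>2" if kK: "k \<in> {1..K}" for k
  proof -
    have "k - 1 \<le> K" using kK by auto
    from expectation_trace_le[OF sub[OF this] N_int(1)[OF kK]] expectation_trace_le[OF sub[OF this] N_int(2)[OF kK]]
    have "(\<integral>x. (norm (N k x))\<^sup>2 \<partial>M) \<le> trace SigL" "(\<integral>x. (norm (N k x))\<^sup>2 \<partial>M) \<le> trace SigR"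
      using cov_L[OF kK] cov_R[OF kK] by (simp_all add: F_def trace_mult_transpose)
    \<comment> \<open>Both Gram matrices have the squared norm as trace, so both bounds hold and so
      does their mean.\<close>
    then show ?thesis unfolding \<sigma>2 by simp
  qed

  define e where "e k = (\<integral>x. (norm (Mm k x - g k x))\<^sup>2 \<partial>M)" for k
  define d where "d k = (\<integral>x. (norm (X (Suc k) x - X k x))\<^sup>2 \<partial>M)" for k
  define P' where "P' k = (\<integral>x. P k x \<partial>M)" for k
  have e0: "0 \<le> e k" and d0: "0 \<le> d k" and P'0: "0 \<le> P' k" for k
    by (simp_all add: e_def d_def P'_def P0 Bochner_Integration.integral_nonneg)
  have M_sq: "square_integrable M (Mm k)" if "k \<le> K" for k using MX_sq[OF that] by blast
  have Mg_sq: "square_integrable M (\<lambda>x. Mm k x - g k x)" if "k \<in> {1..K}" for k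
    using that by (intro square_integrable_diff gk_sq M_sq) auto
  have dX_sq: "square_integrable M (\<lambda>x. X (Suc k) x - X k x)" if "k \<in> {1..K}" for k
    using that by (intro square_integrable_diff X_sq) auto
  have e_split: "e (Suc j) \<le> \<theta>\<^sup>2 * (\<integral>x. (norm (Mm j x - g (Suc j) x))\<^sup>2 \<partial>M) + \<rho>\<^sup>2 * \<sigma>\<^sup>2"
    if j: "Suc j \<in> {1..K}" for j
  proof -
    have jK: "j \<le> K" using j by simp
    \<comment> \<open>Old momentum and new gradient both depend only on the gradients 1 to
      \<open>j\<close>, so the noise at \<open>Suc j\<close> is orthogonal to
      \<open>H\<close>.\<close>
    define H where "H x = Mm j x - g (Suc j) x" for x
    have H: "H \<in> borel_measurable (F j)" "square_integrable M H"
      unfolding H_def[abs_def] using M_F[of j] g_F[of j]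
      by (auto intro!: square_integrable_diff M_sq jK gk_sq j)
    have "Mm (Suc j) x - g (Suc j) x = \<theta> *\<^sub>R H x + \<rho> *\<^sub>R (G (Suc j) x - g (Suc j) x)" for x
      by (simp add: Mm_def H_def \<rho>_def algebra_simps)
    then have "e (Suc j) = \<theta>\<^sup>2 * (\<integral>x. (norm (H x))\<^sup>2 \<partial>M)
        + \<rho>\<^sup>2 * (\<integral>x. (norm (G (Suc j) x - g (Suc j) x))\<^sup>2 \<partial>M)"
      unfolding e_def
      using expectation_norm_noise_split[OF sub[OF jK] H G_sq[OF j] gk_sq[OF j], of \<theta> \<rho>]
        unbiased[OF j] by (simp add: F_def g_def)
    also have "(\<integral>x. (norm (G (Suc j) x - g (Suc j) x))\<^sup>2 \<partial>M) \<le> \<sigma>\<^sup>2"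
      using noise[OF j] by (simp add: NG)
    finally show ?thesis by (simp add: H_def mult_left_mono)
  qed
  have e_base: "e 1 \<le> 2 * L * \<Delta> + \<rho>\<^sup>2 * \<sigma>\<^sup>2"
  proof -
    have "(norm (gradf X1))\<^sup>2 \<le> 2 * L * \<Delta>"
      unfolding \<Delta>_def by (rule norm_gradient_sq_le[OF grad smooth lower L_pos])
    moreover have "\<theta>\<^sup>2 * (norm (gradf X1))\<^sup>2 \<le> 1 * (norm (gradf X1))\<^sup>2"
      using hyper by (intro mult_right_mono power_le_one) auto
    \<comment> \<open>The momentum at index 0 is zero, so the first error is the initial gradient
      damped by \<open>\<theta>\<close>, plus noise.\<close>
    moreover have "e 1 \<le> \<theta>\<^sup>2 * (norm (gradf X1))\<^sup>2 + \<rho>\<^sup>2 * \<sigma>\<^sup>2"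
      using e_split[of 0] K by (simp add: Mm_def g_def X_1 prob_space)
    ultimately show ?thesis by simp
  qed
  have e_step: "e (Suc j) \<le> \<theta> * e j + L\<^sup>2 / \<rho> * d j + \<rho>\<^sup>2 * \<sigma>\<^sup>2" if j: "1 \<le> j" "j < K" for j
  proof -
    have jK: "j \<in> {1..K}" "Suc j \<in> {1..K}" using j by auto
    have pw: "\<theta>\<^sup>2 * (norm (Mm j x - g (Suc j) x))\<^sup>2
        \<le> \<theta> * (norm (Mm j x - g j x))\<^sup>2 + L\<^sup>2 / \<rho> * (norm (X (Suc j) x - X j x))\<^sup>2" for x
    proof -
      have "\<theta>\<^sup>2 * (norm ((Mm j x - g j x) + (g j x - g (Suc j) x)))\<^sup>2
          \<le> \<theta> * (norm (Mm j x - g j x))\<^sup>2 + \<theta>\<^sup>2 / (1 - \<theta>) * (norm (g j x - g (Suc j) x))\<^sup>2"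
        by (rule norm_momentum_split) (use hyper in auto)
      also have "\<theta>\<^sup>2 / (1 - \<theta>) * (norm (g j x - g (Suc j) x))\<^sup>2
          \<le> 1 / \<rho> * (L * norm (X (Suc j) x - X j x))\<^sup>2"
      proof (rule mult_mono)
        show "\<theta>\<^sup>2 / (1 - \<theta>) \<le> 1 / \<rho>"
          unfolding \<rho>_def using hyper by (intro divide_right_mono power_le_one) auto
        show "(norm (g j x - g (Suc j) x))\<^sup>2 \<le> (L * norm (X (Suc j) x - X j x))\<^sup>2"
          unfolding g_def using smooth[of "X j x" "X (Suc j) x"]
          by (intro power_mono) (auto simp: norm_minus_commute)
      qed (use \<rho>0 in auto)
      finally show ?thesis by (simp add: power_mult_distrib)
    qed
    have int: "integrable M (\<lambda>x. (norm (Mm j x - g (Suc j) x))\<^sup>2)"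
      "integrable M (\<lambda>x. (norm (Mm j x - g j x))\<^sup>2)"
      "integrable M (\<lambda>x. (norm (X (Suc j) x - X j x))\<^sup>2)"
      using jK by (auto intro!: square_integrableD(2) Mg_sq dX_sq square_integrable_diff M_sq gk_sq)
    have "\<theta>\<^sup>2 * (\<integral>x. (norm (Mm j x - g (Suc j) x))\<^sup>2 \<partial>M)
        = (\<integral>x. \<theta>\<^sup>2 * (norm (Mm j x - g (Suc j) x))\<^sup>2 \<partial>M)" by simp
    also have "\<dots> \<le> (\<integral>x. \<theta> * (norm (Mm j x - g j x))\<^sup>2 + L\<^sup>2 / \<rho> * (norm (X (Suc j) x - X j x))\<^sup>2 \<partial>M)"
      by (rule Bochner_Integration.integral_mono) (use int pw in auto)
    also have "\<dots> = \<theta> * e j + L\<^sup>2 / \<rho> * d j" unfolding e_def d_def using int by simp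
    finally show ?thesis using e_split[OF jK(2)] by simp
  qed
  have sum_e: "\<rho> * (\<Sum>k\<in>{1..K}. e k)
      \<le> 2 * L * \<Delta> + Kr * (\<rho>\<^sup>2 * \<sigma>\<^sup>2) + L\<^sup>2 / \<rho> * (\<Sum>k\<in>{1..K}. d k)"
    using momentum_sum_bound[where e = e and d = d and A = "2 * L * \<Delta>" and B = "\<rho>\<^sup>2 * \<sigma>\<^sup>2" and C = "L\<^sup>2 / \<rho>",
        OF hyper(2,3) K e_base e_step e0 _ d0] \<rho>0
    by (simp add: \<rho>_def Kr_def)

  \<comment> \<open>An integrable majorant for both preconditioner traces\<close>
  define w where "w k j = (1 - \<beta>) * \<beta> ^ (k - j)" for k j :: nat
  have w0: "0 \<le> w k j" for k j using hyper by (simp add: w_def)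
  \<comment> \<open>\<open>t\<close> bounds the expectation of the bracket in \<open>Q\<close>:
    \<open>D * \<epsilon> = \<tau> * \<sigma>h^2\<close> contributes at most
    \<open>\<sigma>h^2\<close>, the doubled noise at most twice that. A tangent taken there returns
    exactly \<open>t powr s\<close>.\<close>
  define t where "t = 3 * \<sigma>h\<^sup>2"
  have t0: "0 < t" using \<sigma>h0 by (simp add: t_def)
  \<comment> \<open>Using \<open>D\<close> for both dimensions gives one majorant for left and
    right. It is affine in the squared noise and the \<open>P j\<close>, all known to be
    integrable.\<close>
  define Q where "Q k x = D powr (1 - s) * (s * t powr (s - 1)
      * (D * \<epsilon> + 2 * (\<Sum>j\<in>{1..k}. w k j * (norm (N j x))\<^sup>2)) + (1 - s) * t powr s)
      + (\<Sum>j\<in>{1..k}. (2 * w k j) powr s * P j x)" for k x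
  have noise_sum0: "0 \<le> (\<Sum>j\<in>{1..k}. w k j * (norm (N j x))\<^sup>2)" for k x
    by (intro sum_nonneg mult_nonneg_nonneg w0) simp
  have QL: "trpow (Leps k x) s \<le> Q k x" for k x
  proof -
    have "trpow (Leps k x) s \<le> m powr (1 - s)
        * (m * \<epsilon> + 2 * (\<Sum>j\<in>{1..k}. w k j * (norm (N j x))\<^sup>2)) powr s
        + (\<Sum>j\<in>{1..k}. (2 * w k j) powr s * P j x)"
      using trpow_shampoo_L_eps_le[of \<beta> \<epsilon> s k "\<lambda>j. G j x" "\<lambda>j. g j x" "\<lambda>j. N j x"] hyper s
      unfolding Leps P_def w_def dims by (simp add: GN)
    also have "m powr (1 - s) * (m * \<epsilon> + 2 * (\<Sum>j\<in>{1..k}. w k j * (norm (N j x))\<^sup>2)) powr s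
        \<le> D powr (1 - s) * (s * t powr (s - 1)
          * (D * \<epsilon> + 2 * (\<Sum>j\<in>{1..k}. w k j * (norm (N j x))\<^sup>2)) + (1 - s) * t powr s)"
      by (rule concave_weighted_bound) (use s D t0 noise_sum0 hyper in \<open>auto simp: dims intro!: mult_right_mono\<close>)
    finally show ?thesis by (simp add: Q_def)
  qed
  have QR: "trpow (Reps k x) s \<le> Q k x" for k x
  proof -
    have "trpow (Reps k x) s \<le> n powr (1 - s)
        * (n * \<epsilon> + 2 * (\<Sum>j\<in>{1..k}. w k j * (norm (N j x))\<^sup>2)) powr s
        + (\<Sum>j\<in>{1..k}. (2 * w k j) powr s * P j x)"
      using trpow_shampoo_L_eps_le[of \<beta> \<epsilon> s k "\<lambda>j. transpose (G j x)" "\<lambda>j. transpose (g j x)" "\<lambda>j. transpose (N j x)"]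
        hyper s
      unfolding Reps shampoo_R_eps_eq P_def w_def dims
      by (simp add: GN transpose_add trpow_transpose_mult)
    also have "n powr (1 - s) * (n * \<epsilon> + 2 * (\<Sum>j\<in>{1..k}. w k j * (norm (N j x))\<^sup>2)) powr s
        \<le> D powr (1 - s) * (s * t powr (s - 1)
          * (D * \<epsilon> + 2 * (\<Sum>j\<in>{1..k}. w k j * (norm (N j x))\<^sup>2)) + (1 - s) * t powr s)"
      by (rule concave_weighted_bound) (use s D t0 noise_sum0 hyper in \<open>auto simp: dims intro!: mult_right_mono\<close>)
    finally show ?thesis by (simp add: Q_def)
  qed
  have N2_int: "integrable M (\<lambda>x. (norm (N k x))\<^sup>2)" if "k \<in> {1..K}" for k
    by (rule square_integrableD(2)[OF N_sq[OF that]])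
  have Q_int: "integrable M (Q k)" if "k \<in> {1..K}" for k
    unfolding Q_def[abs_def] using that
    by (intro Bochner_Integration.integrable_add Bochner_Integration.integrable_mult_right
        Bochner_Integration.integrable_sum integrable_const N2_int P_int) auto
  have Q_exp: "(\<integral>x. Q k x \<partial>M) \<le> D powr (1 - s) * t powr s + (\<Sum>j\<in>{1..k}. (2 * w k j) powr s * P' j)"
    if kK: "k \<in> {1..K}" for k
  proof -
    have sub': "j \<in> {1..K}" if "j \<in> {1..k}" for j using that kK by auto
    have int1: "integrable M (\<lambda>x. \<Sum>j\<in>{1..k}. w k j * (norm (N j x))\<^sup>2)"
      by (intro Bochner_Integration.integrable_sum Bochner_Integration.integrable_mult_right N2_int sub')
    have int2: "integrable M (\<lambda>x. \<Sum>j\<in>{1..k}. (2 * w k j) powr s * P j x)"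
      by (intro Bochner_Integration.integrable_sum Bochner_Integration.integrable_mult_right P_int sub')
    have I1: "(\<integral>x. (\<Sum>j\<in>{1..k}. w k j * (norm (N j x))\<^sup>2) \<partial>M) = (\<Sum>j\<in>{1..k}. w k j * (\<integral>x. (norm (N j x))\<^sup>2 \<partial>M))"
      by (subst Bochner_Integration.integral_sum) (auto intro!: Bochner_Integration.integrable_mult_right N2_int sub')
    have I2: "(\<integral>x. (\<Sum>j\<in>{1..k}. (2 * w k j) powr s * P j x) \<partial>M) = (\<Sum>j\<in>{1..k}. (2 * w k j) powr s * P' j)"
      unfolding P'_def
      by (subst Bochner_Integration.integral_sum) (auto intro!: Bochner_Integration.integrable_mult_right P_int sub')
    have "(\<Sum>j\<in>{1..k}. w k j * (\<integral>x. (norm (N j x))\<^sup>2 \<partial>M)) \<le> (\<Sum>j\<in>{1..k}. w k j * \<sigma>\<^sup>2)"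
      by (intro sum_mono mult_left_mono noise w0 sub')
    also have "\<dots> = (\<Sum>j\<in>{1..k}. w k j) * \<sigma>\<^sup>2" by (simp add: sum_distrib_right)
    also have "\<dots> \<le> 1 * \<sigma>\<^sup>2"
      unfolding w_def by (intro mult_right_mono sum_geometric_weights_le) (use hyper in auto)
    finally have Nsum: "(\<Sum>j\<in>{1..k}. w k j * (\<integral>x. (norm (N j x))\<^sup>2 \<partial>M)) \<le> \<sigma>h\<^sup>2" using \<sigma>\<sigma>h by simp
    have "D * \<epsilon> = \<tau> * \<sigma>h\<^sup>2" using D(1) by (simp add: \<epsilon>_eq D_def)
    also have "\<dots> \<le> 1 * \<sigma>h\<^sup>2" using \<tau> by (intro mult_right_mono) auto
    finally have De: "D * \<epsilon> + 2 * (\<Sum>j\<in>{1..k}. w k j * (\<integral>x. (norm (N j x))\<^sup>2 \<partial>M)) \<le> t"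
      using Nsum by (simp add: t_def)
    have "(\<integral>x. Q k x \<partial>M) = D powr (1 - s) * (s * t powr (s - 1)
      * (D * \<epsilon> + 2 * (\<Sum>j\<in>{1..k}. w k j * (\<integral>x. (norm (N j x))\<^sup>2 \<partial>M))) + (1 - s) * t powr s)
      + (\<Sum>j\<in>{1..k}. (2 * w k j) powr s * P' j)"
      unfolding Q_def using int1 int2 by (simp add: I1 I2 prob_space del: One_nat_def)
    also have "\<dots> \<le> D powr (1 - s) * (s * t powr (s - 1) * t + (1 - s) * t powr s)
      + (\<Sum>j\<in>{1..k}. (2 * w k j) powr s * P' j)"
      using De s by (intro add_right_mono mult_left_mono add_mono order_refl) auto
    also have "s * t powr (s - 1) * t + (1 - s) * t powr s = t powr s"
      using t0 by (simp add: powr_diff algebra_simps)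
    finally show ?thesis .
  qed

  \<comment> \<open>Deterministic weights\<close>
  define cb where "cb = (1 - \<beta>) powr s / (1 - \<beta> powr s)"
  have cb: "0 < cb"
    unfolding cb_def using hyper s powr_less_mono2[of s \<beta> 1] by (intro divide_pos_pos) auto
  define pb where "pb = (\<Sum>k\<in>{1..K}. P' k) / Kr"
  \<comment> \<open>\<open>T\<close> bounds the mean of the expectations of \<open>Q\<close> and
    contains the unknown \<open>pb\<close>; \<open>Z\<close> plays the same role for the
    preconditioned gradients.\<close>
  define T where "T = D powr (1 - s) * t powr s + 2 powr s * cb * pb"
  define Z where "Z = 7 * \<sigma>h * sqrt y / c0"
  have pb0: "0 \<le> pb" unfolding pb_def using Kr P'0 by (intro divide_nonneg_pos sum_nonneg) auto
  have T0: "0 < D powr (1 - s) * t powr s" using D t0 by simp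
  then have T: "0 < T" unfolding T_def using pb0 cb by (intro add_pos_nonneg) auto
  have Z: "0 < Z" unfolding Z_def using \<sigma>h0 y c0 by simp
  have sum_Q: "(\<Sum>k\<in>{1..K}. \<integral>x. Q k x \<partial>M) \<le> Kr * T"
  proof -
    have "(\<Sum>k\<in>{1..K}. \<integral>x. Q k x \<partial>M)
        \<le> (\<Sum>k\<in>{1..K}. D powr (1 - s) * t powr s + (\<Sum>j\<in>{1..k}. (2 * w k j) powr s * P' j))"
      by (rule sum_mono) (rule Q_exp)
    also have "\<dots> = Kr * (D powr (1 - s) * t powr s) + (\<Sum>k\<in>{1..K}. \<Sum>j\<in>{1..k}. (2 * w k j) powr s * P' j)"
      by (simp add: sum.distrib Kr_def)
    also have "(\<Sum>k\<in>{1..K}. \<Sum>j\<in>{1..k}. (2 * w k j) powr s * P' j) \<le> 2 powr s * cb * (\<Sum>j\<in>{1..K}. P' j)"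
      unfolding w_def cb_def by (rule sum_powr_weights_le) (use hyper s P'0 in auto)
    also have "2 powr s * cb * (\<Sum>j\<in>{1..K}. P' j) = Kr * (2 powr s * cb * pb)"
      using Kr by (simp add: pb_def)
    finally show ?thesis by (simp add: T_def algebra_simps)
  qed
  have Zc: "\<epsilon>h powr (1 - s) = c0" by (simp add: c0_def)
  have avg: "(1 / real K) * (\<Sum>k=1..K. \<integral>x. nuclear_norm (mat_powr (mat_abs (gradf (X k x))) \<omega>) \<partial>M) = pb"
    by (simp add: nuc pb_def P'_def Kr_def)

  \<comment> \<open>The rate under the lower bounds on the preconditioners\<close>
  have main: "pb \<le> 20 * \<sigma>h powr (3*\<omega>/2 - \<omega>\<^sup>2/2) * D powr ((1 - \<omega>/2)\<^sup>2)
            / (\<omega> * \<epsilon>h powr (\<omega>/2 - \<omega>\<^sup>2/4)) * y powr (\<omega>/4)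
        + 10 * Chat / \<epsilon>h powr (1 - \<omega>/2) * (\<sigma>h\<^sup>2 * y) powr (1/2)"
    if ae: "\<forall>k\<in>{1..K}. AE x in M. \<epsilon>h *\<^sub>R mat 1 \<preceq>\<^sub>L Leps k x \<and> \<epsilon>h *\<^sub>R mat 1 \<preceq>\<^sub>L Reps k x"
  proof -
    define R where "R x = T powr (1 - s) * Z powr s * ((1 - s) / T * (\<Sum>k\<in>{1..K}. Q k x) + s / Z * (2 / \<eta> *
        (\<Delta> - c0 / (4 * \<eta>) * (\<Sum>k\<in>{1..K}. (norm (X (Suc k) x - X k x))\<^sup>2)
          + \<eta> / (2 * c0) * (\<Sum>k\<in>{1..K}. (norm (Mm k x - g k x))\<^sup>2))))" for x
    have "AE x in M. \<forall>k\<in>{1..K}. \<epsilon>h *\<^sub>R mat 1 \<preceq>\<^sub>L Leps k x \<and> \<epsilon>h *\<^sub>R mat 1 \<preceq>\<^sub>L Reps k x"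
      using ae by (intro AE_finite_allI) auto
    then have pw: "AE x in M. (\<Sum>k\<in>{1..K}. P k x) \<le> R x"
    proof eventually_elim
      case (elim x)
      have "(\<Sum>k\<in>{1..K}. trpow (transpose (gradf (X k x)) ** gradf (X k x)) s)
        \<le> T powr (1 - s) * Z powr s * ((1 - s) / T * (\<Sum>k\<in>{1..K}. Q k x) + s / Z * (2 / \<eta> *
        (f (X 1 x) - fstar - \<epsilon>h powr (1 - s) / (4 * \<eta>) * (\<Sum>k\<in>{1..K}. (norm (X (Suc k) x - X k x))\<^sup>2)
          + \<eta> / (2 * \<epsilon>h powr (1 - s)) * (\<Sum>k\<in>{1..K}. (norm (Mm k x - gradf (X k x)))\<^sup>2))))"
        by (rule shampoo_trajectory_bound[OF grad smooth lower _ _ \<epsilon>h0 k s(1) hyper(1) _ _ QL[of _ x] QR[of _ x] T Z])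
          (use elim L\<eta> X_Suc in \<open>auto simp: c0_def\<close>)
      then show ?case by (simp add: R_def P_def g_def c0_def \<Delta>_def X_1)
    qed
    have dsum: "integrable M (\<lambda>x. \<Sum>k\<in>{1..K}. (norm (X (Suc k) x - X k x))\<^sup>2)"
      "(\<integral>x. (\<Sum>k\<in>{1..K}. (norm (X (Suc k) x - X k x))\<^sup>2) \<partial>M) = (\<Sum>k\<in>{1..K}. d k)"
      unfolding d_def
      by (auto intro!: Bochner_Integration.integrable_sum Bochner_Integration.integral_sum square_integrableD(2) dX_sq)
    have esum: "integrable M (\<lambda>x. \<Sum>k\<in>{1..K}. (norm (Mm k x - g k x))\<^sup>2)"
      "(\<integral>x. (\<Sum>k\<in>{1..K}. (norm (Mm k x - g k x))\<^sup>2) \<partial>M) = (\<Sum>k\<in>{1..K}. e k)"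
      unfolding e_def
      by (auto intro!: Bochner_Integration.integrable_sum Bochner_Integration.integral_sum square_integrableD(2) Mg_sq)
    have Qsum: "integrable M (\<lambda>x. \<Sum>k\<in>{1..K}. Q k x)"
      "(\<integral>x. (\<Sum>k\<in>{1..K}. Q k x) \<partial>M) = (\<Sum>k\<in>{1..K}. \<integral>x. Q k x \<partial>M)"
      by (auto intro!: Bochner_Integration.integrable_sum Bochner_Integration.integral_sum Q_int)
    have Psum: "integrable M (\<lambda>x. \<Sum>k\<in>{1..K}. P k x)"
      "(\<integral>x. (\<Sum>k\<in>{1..K}. P k x) \<partial>M) = (\<Sum>k\<in>{1..K}. P' k)"
      unfolding P'_def
      by (auto intro!: Bochner_Integration.integrable_sum Bochner_Integration.integral_sum P_int)
    have R_int: "integrable M R"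
      unfolding R_def[abs_def] using dsum(1) esum(1) Qsum(1) by simp
    have "Kr * pb = (\<integral>x. (\<Sum>k\<in>{1..K}. P k x) \<partial>M)"
      unfolding Psum(2) pb_def using Kr by simp
    also have "\<dots> \<le> (\<integral>x. R x \<partial>M)" by (rule integral_mono_AE[OF Psum(1) R_int pw])
    also have "\<dots> = T powr (1 - s) * Z powr s * ((1 - s) / T * (\<Sum>k\<in>{1..K}. \<integral>x. Q k x \<partial>M) + s / Z * (2 / \<eta> *
        (\<Delta> - c0 / (4 * \<eta>) * (\<Sum>k\<in>{1..K}. d k) + \<eta> / (2 * c0) * (\<Sum>k\<in>{1..K}. e k))))"
      unfolding R_def using dsum esum Qsum by (simp add: prob_space)
    \<comment> \<open>After this replacement the weights cancel and \<open>(1 - s) + s\<close>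
      remains.\<close>
    also have "\<dots> \<le> T powr (1 - s) * Z powr s * ((1 - s) / T * (Kr * T) + s / Z * (Kr * Z))"
    proof (intro mult_left_mono add_mono sum_Q)
      show "2 / \<eta> * (\<Delta> - c0 / (4 * \<eta>) * (\<Sum>k\<in>{1..K}. d k) + \<eta> / (2 * c0) * (\<Sum>k\<in>{1..K}. e k)) \<le> Kr * Z"
        unfolding Z_def
        by (rule momentum_descent_rate[OF L_pos Kr c0 \<rho>0(1) \<sigma>h0 _ \<sigma>\<sigma>h y_def sy \<eta>' sum_e]) (simp add: sum_nonneg d0)
    qed (use s T Z in auto)
    also have "(1 - s) / T * (Kr * T) + s / Z * (Kr * Z) = Kr"
    proof -
      have "(1 - s) / T * (Kr * T) = (1 - s) * Kr" "s / Z * (Kr * Z) = s * Kr" using T Z by simp_all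
      then show ?thesis by (simp add: algebra_simps)
    qed
    finally have "pb \<le> T powr (1 - s) * Z powr s"
      using Kr by (simp add: mult.commute[of Kr pb])
    \<comment> \<open>Opening \<open>T\<close> exposes \<open>pb\<close> on the right, with feedback
      coefficient \<open>2 powr s * cb\<close>.\<close>
    then have "pb \<le> (D powr (1 - s) * t powr s) powr (1 - s) * Z powr s / s
        + (2 powr s * cb) powr ((1 - s) / s) * Z"
      unfolding T_def by (intro self_bounding_solve pb0 T0 Z s) (use cb in auto)
    also have "\<dots> \<le> 20 * \<sigma>h powr (3 * s - 2 * s\<^sup>2) * D powr ((1 - s)\<^sup>2) / ((2 * s) * \<epsilon>h powr (s - s\<^sup>2)) * y powr (s / 2)
      + 10 * (2 * cb) powr (1 / s - 1) / \<epsilon>h powr (1 - s) * (\<sigma>h\<^sup>2 * y) powr (1 / 2)"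
      unfolding Z_def c0_def t_def by (rule rate_constants_le[OF s \<sigma>h0 D(1) \<epsilon>h0 y cb])
    also have "(2 * cb) powr (1 / s - 1) = Chat"
      by (simp add: Chat cb_def s_def)
    finally show ?thesis by (simp add: \<omega>s power2_eq_square)
  qed

  have eqs: "L * (f X1 - fstar) / real K = y" "L * (f X1 - fstar) / (real K * \<gamma>) = y / \<gamma>"
    "\<sigma>h\<^sup>2 * L * (f X1 - fstar) / real K = \<sigma>h\<^sup>2 * y"
    by (simp_all add: y_def \<Delta>_def Kr_def)
  have C0: "0 \<le> Chat" by (simp add: Chat)
  show ?thesis
    unfolding avg eqs D_def[symmetric]
  proof (intro conjI impI)
    show "\<forall>k\<in>{1..K}. integrable M (\<lambda>x. nuclear_norm (mat_powr (mat_abs (gradf (X k x))) \<omega>))"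
      unfolding nuc using P_int by simp
  next
    assume "\<forall>k\<in>{1..K}. AE x in M. \<epsilon>h *\<^sub>R mat 1 \<preceq>\<^sub>L Leps k x \<and> \<epsilon>h *\<^sub>R mat 1 \<preceq>\<^sub>L Reps k x"
    then show "pb \<le> 20 * \<sigma>h powr (3*\<omega>/2 - \<omega>\<^sup>2/2) * D powr ((1 - \<omega>/2)\<^sup>2)
            / (\<omega> * \<epsilon>h powr (\<omega>/2 - \<omega>\<^sup>2/4)) * y powr (\<omega>/4)
        + 10 * Chat / \<epsilon>h powr (1 - \<omega>/2) * (\<sigma>h\<^sup>2 * y) powr (1/2)"
      by (rule main)
  next
    assume eq: "\<epsilon>h = \<epsilon>"
    then show "\<forall>k\<in>{1..K}. \<forall>x. \<epsilon>h *\<^sub>R mat 1 \<preceq>\<^sub>L Leps k x \<and> \<epsilon>h *\<^sub>R mat 1 \<preceq>\<^sub>L Reps k x"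
      using Lge by simp
  next
    assume eq: "\<epsilon>h = \<epsilon>"
    have "pb \<le> 20 * \<sigma>h powr (3*\<omega>/2 - \<omega>\<^sup>2/2) * D powr ((1 - \<omega>/2)\<^sup>2)
            / (\<omega> * \<epsilon>h powr (\<omega>/2 - \<omega>\<^sup>2/4)) * y powr (\<omega>/4)
        + 10 * Chat / \<epsilon>h powr (1 - \<omega>/2) * (\<sigma>h\<^sup>2 * y) powr (1/2)"
      by (rule main) (use eq Lge in simp)
    also have "\<dots> \<le> 20 * D powr (1 - \<omega>/2) / (\<omega> * \<tau> powr (\<omega>/2 - \<omega>\<^sup>2/4))
          * max (\<sigma> powr (\<omega>/2) * y powr (\<omega>/4)) ((y / \<gamma>) powr (\<omega>/2))
        + 10 * Chat * D powr (1 - \<omega>/2) / \<tau> powr (1 - \<omega>/2)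
          * (if 1 \<le> \<omega>
             then max (\<sigma> powr (\<omega> - 1) * y powr (1/2)) (1 / \<gamma> powr (\<omega> - 1) * y powr (\<omega>/2))
             else 1 / \<gamma> powr (\<omega> - 1) * y powr (\<omega>/2))"
      by (rule rate_minimal_regularisation[OF \<omega> D(1) y C0 \<tau>(1) \<gamma>(1) \<sigma>0 \<sigma>h']) (simp add: eq \<epsilon>_eq D_def)
    finally show "pb \<le> 20 * D powr (1 - \<omega>/2) / (\<omega> * \<tau> powr (\<omega>/2 - \<omega>\<^sup>2/4))
          * max (\<sigma> powr (\<omega>/2) * y powr (\<omega>/4)) ((y / \<gamma>) powr (\<omega>/2))
        + 10 * Chat * D powr (1 - \<omega>/2) / \<tau> powr (1 - \<omega>/2)
          * (if 1 \<le> \<omega>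
             then max (\<sigma> powr (\<omega> - 1) * y powr (1/2)) (1 / \<gamma> powr (\<omega> - 1) * y powr (\<omega>/2))
             else 1 / \<gamma> powr (\<omega> - 1) * y powr (\<omega>/2))" .
  qed
qed

end
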